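(* Let $[M,\mathcal S]$ be a compatible pair, and let $b_+\in\mathcal S_+$. Put $a_+=\exp(b_+)$, $b=b_++\tilde b_+$ and $a=a_+\tilde a_+=\exp(b)$. Then, for $N\ge 1$, $$\det P_N M(a)P_N = G[a]^N\,\hat F[a]\,\det(I+Q_NKQ_N),$$ where $$\hat F[a]=\det T(a^{-1})M(a)=\exp\Big(\mathrm{trace}(M(b)-T(b))+\tfrac12\,\mathrm{trace}\,H(b)^2\Big)$$ and $K=M(a_+^{-1})T(a_+)-I$.
   Context: Notation. $\mathbb T$ is the unit circle; for $a\in L^1(\mathbb T)$ the Fourier coefficients are $a_n=[a]_n=\frac1{2\pi}\int_{-\pi}^{\pi}a(e^{i\theta})e^{-in\theta}\,d\theta$, $n\in\mathbb Z$; $\tilde a(t)=a(t^{-1})$. $\ell^2$ is the space of complex square-summable sequences $\{x_n\}_{n=0}^\infty$, $\mathcal L(\ell^2)$ the bounded linear operators on it, $\mathcal C_1(\ell^2)$ the trace class operators. For $a\in L^\infty(\mathbb T)$, $T(a)=(a_{j-k})_{j,k\ge0}$ and $H(a)=(a_{j+k+1})_{j,k\ge0}$ are the Toeplitz and Hankel operators on $\ell^2$. For operators of the form identity plus trace class, $\det$ is the operator (Fredholm) determinant. Compatible pair. $\mathcal S$ is a unital Banach algebra of functions on $\mathbb T$, continuously embedded in $L^\infty(\mathbb T)$, such that (i) the Riesz projection $\sum_{k\in\mathbb Z}a_ke^{ik\theta}\mapsto\sum_{k\ge0}a_ke^{ik\theta}$ is well defined and bounded on $\mathcal S$, and (ii)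 $a\mapsto\tilde a$ is well defined and bounded on $\mathcal S$. Put $\mathcal S_\pm=\{a\in\mathcal S: a_n=0 \text{ for all } n \text{ with } \pm n<0\}$ and $\mathcal S_0=\{a\in\mathcal S:a=\tilde a\}$. $M:\mathcal S\to\mathcal L(\ell^2)$ is a linear continuous map such that: (a) for $a\in\mathcal S$, $M(a)-T(a)\in\mathcal C_1(\ell^2)$ and $\|M(a)-T(a)\|_{\mathcal C_1(\ell^2)}\le C\|a\|_{\mathcal S}$ with a constant $C$ independent of $a$; (b) $M(abc)=T(a)M(b)M(c)$ whenever $a\in\mathcal S_-$, $b\in\mathcal S$, $c\in\mathcal S_0$; (c) $M(1)=I$. Then $[M,\mathcal S]$ is called a compatible pair. $P_N$ is the projection on $\ell^2$ keeping the first $N$ entries $x_0,\dots,x_{N-1}$ and replacing the others by $0$; $Q_N=I-P_N$; $\det P_NAP_N$ is the determinant of $P_NAP_N$ acting on the image of $P_N$, i.e. of the upper-left $N\times N$ section of $A$. For $a=\exp(b)$, $G[a]=\exp\big(\frac1{2\pi}\int_{-\pi}^\pi \log a(e^{i\theta})\,d\theta\big)$ with $\log a=b$. *)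

theory Defs
  imports "HOL-Analysis.Analysis" "Jordan_Normal_Form.Determinant"
begin

typedef ell2 = "{x :: nat \<Rightarrow> complex. summable (\<lambda>n. (cmod (x n))\<^sup>2)}"
  morphisms seq Abs_ell2
  by (rule exI[of _ "\<lambda>_. 0"]) simp

setup_lifting type_definition_ell2

lemma summable_seq: "summable (\<lambda>n. (cmod (seq x n))\<^sup>2)"
  using seq[of x] by simp

lemma square_summable_scale:
  "summable (\<lambda>n. (cmod (x n))\<^sup>2) \<Longrightarrow> summable (\<lambda>n. (cmod (c * x n))\<^sup>2)"
  by (simp add: norm_mult power_mult_distrib summable_mult)

lemma square_summable_add:
  assumes "summable (\<lambda>n. (cmod (x n))\<^sup>2)" "summable (\<lambda>n. (cmod (y n))\<^sup>2)"
  shows "summable (\<lambda>n. (cmod (x n + y n))\<^sup>2)"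
proof (rule summable_comparison_test')
  show "summable (\<lambda>n. 2 * (cmod (x n))\<^sup>2 + 2 * (cmod (y n))\<^sup>2)"
    using assms by (intro summable_add summable_mult)
  fix n :: nat
  have "(cmod (x n + y n))\<^sup>2 \<le> (cmod (x n) + cmod (y n))\<^sup>2"
    by (intro power_mono norm_triangle_ineq) auto
  also have "\<dots> \<le> 2 * (cmod (x n))\<^sup>2 + 2 * (cmod (y n))\<^sup>2"
    using zero_le_power2[of "cmod (x n) - cmod (y n)"]
    by (simp add: power2_eq_square algebra_simps)
  finally show "norm ((cmod (x n + y n))\<^sup>2) \<le> 2 * (cmod (x n))\<^sup>2 + 2 * (cmod (y n))\<^sup>2"
    by simp
qed

lemma summable_inner_seq: "summable (\<lambda>n. inner (seq x n) (seq y n))"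
proof (rule summable_comparison_test')
  show "summable (\<lambda>n. (cmod (seq x n))\<^sup>2 + (cmod (seq y n))\<^sup>2)"
    by (intro summable_add summable_seq)
  fix n :: nat
  have "\<bar>inner (seq x n) (seq y n)\<bar> \<le> cmod (seq x n) * cmod (seq y n)"
    by (rule Cauchy_Schwarz_ineq2)
  also have "\<dots> \<le> (cmod (seq x n))\<^sup>2 + (cmod (seq y n))\<^sup>2"
    using zero_le_power2[of "cmod (seq x n) - cmod (seq y n)"]
      zero_le_power2[of "cmod (seq x n)"] zero_le_power2[of "cmod (seq y n)"]
    by (simp add: power2_eq_square algebra_simps) (smt (verit) zero_le_mult_iff norm_ge_zero)
  finally show "norm (inner (seq x n) (seq y n)) \<le> (cmod (seq x n))\<^sup>2 + (cmod (seq y n))\<^sup>2"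
    by simp
qed

lift_definition scaleC :: "complex \<Rightarrow> ell2 \<Rightarrow> ell2" is "\<lambda>c x n. c * x n"
  by (rule square_summable_scale)

text \<open>
  As a type-class instance \<open>ell2\<close> carries the real inner product
  \<open>Re (\<Sum>n. x\<^sub>n * cnj y\<^sub>n)\<close>, whose norm is the usual norm of the complex Hilbert space.
\<close>

instantiation ell2 :: real_inner
begin

lift_definition zero_ell2 :: ell2 is "\<lambda>_. 0" by simp
lift_definition plus_ell2 :: "ell2 \<Rightarrow> ell2 \<Rightarrow> ell2" is "\<lambda>x y n. x n + y n"
  by (rule square_summable_add)
lift_definition uminus_ell2 :: "ell2 \<Rightarrow> ell2" is "\<lambda>x n. - x n" by simp
lift_definition minus_ell2 :: "ell2 \<Rightarrow> ell2 \<Rightarrow> ell2" is "\<lambda>x y n. x n - y n"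
proof -
  fix x y :: "nat \<Rightarrow> complex"
  assume "summable (\<lambda>n. (cmod (x n))\<^sup>2)" "summable (\<lambda>n. (cmod (y n))\<^sup>2)"
  then show "summable (\<lambda>n. (cmod (x n - y n))\<^sup>2)"
    using square_summable_add[of x "\<lambda>n. - y n"] by simp
qed
lift_definition scaleR_ell2 :: "real \<Rightarrow> ell2 \<Rightarrow> ell2" is "\<lambda>r x n. r *\<^sub>R x n"
  by (simp add: power_mult_distrib summable_mult)

definition inner_ell2 :: "ell2 \<Rightarrow> ell2 \<Rightarrow> real" where
  "inner_ell2 x y = (\<Sum>n. inner (seq x n) (seq y n))"
definition norm_ell2 :: "ell2 \<Rightarrow> real" where
  "norm_ell2 x = sqrt (\<Sum>n. (cmod (seq x n))\<^sup>2)"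
definition dist_ell2 :: "ell2 \<Rightarrow> ell2 \<Rightarrow> real" where
  "dist_ell2 x y = norm (x - y)"
definition sgn_ell2 :: "ell2 \<Rightarrow> ell2" where
  "sgn_ell2 x = inverse (norm x) *\<^sub>R x"
definition uniformity_ell2 :: "(ell2 \<times> ell2) filter" where
  "uniformity_ell2 = (INF e\<in>{0 <..}. principal {(x, y). dist x y < e})"
definition open_ell2 :: "ell2 set \<Rightarrow> bool" where
  "open_ell2 U \<longleftrightarrow> (\<forall>x\<in>U. eventually (\<lambda>(x', y). x' = x \<longrightarrow> y \<in> U) uniformity)"

instance
proof
  fix x y z :: ell2 and r s :: real
  show "x + y + z = x + (y + z)" by transfer (simp add: add.assoc)
  show "x + y = y + x" by transfer (simp add: add.commute)
  show "0 + x = x" by transfer simp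
  show "- x + x = 0" by transfer simp
  show "x - y = x + - y" by transfer simp
  show "r *\<^sub>R (x + y) = r *\<^sub>R x + r *\<^sub>R y" by transfer (simp add: scaleR_add_right)
  show "(r + s) *\<^sub>R x = r *\<^sub>R x + s *\<^sub>R x" by transfer (simp add: scaleR_add_left)
  show "r *\<^sub>R s *\<^sub>R x = (r * s) *\<^sub>R x" by transfer simp
  show "1 *\<^sub>R x = x" by transfer simp
  show "dist x y = norm (x - y)" by (rule dist_ell2_def)
  show "sgn x = inverse (norm x) *\<^sub>R x" by (rule sgn_ell2_def)
  show "uniformity = (INF e\<in>{0 <..}. principal {(x :: ell2, y). dist x y < e})"
    by (rule uniformity_ell2_def)
  show "open U \<longleftrightarrow> (\<forall>x\<in>U. eventually (\<lambda>(x', y). x' = x \<longrightarrow> y \<in> U) uniformity)"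
    for U :: "ell2 set"
    by (rule open_ell2_def)
  show "inner x y = inner y x" by (simp add: inner_ell2_def inner_commute)
  show "inner (x + y) z = inner x z + inner y z"
    unfolding inner_ell2_def
    by (simp add: plus_ell2.rep_eq inner_add_left suminf_add summable_inner_seq)
  show "inner (r *\<^sub>R x) y = r * inner x y"
    unfolding inner_ell2_def
    by (simp add: scaleR_ell2.rep_eq suminf_mult summable_inner_seq)
  show "0 \<le> inner x x"
    unfolding inner_ell2_def by (intro suminf_nonneg summable_inner_seq) simp
  show "inner x x = 0 \<longleftrightarrow> x = 0"
  proof -
    have "inner x x = 0 \<longleftrightarrow> (\<forall>n. inner (seq x n) (seq x n) = 0)"
      unfolding inner_ell2_def by (intro suminf_eq_zero_iff summable_inner_seq) simp
    also have "\<dots> \<longleftrightarrow> x = 0" by (simp add: seq_inject[symmetric] zero_ell2.rep_eq fun_eq_iff)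
    finally show ?thesis .
  qed
  show "norm x = sqrt (inner x x)"
    by (simp add: norm_ell2_def inner_ell2_def power2_norm_eq_inner)
qed

end

text \<open>
  The library's bounded operators \<open>ell2 \<Rightarrow>\<^sub>L ell2\<close> are only real-linear.  The bounded
  operators of the complex Hilbert space are those satisfying \<open>complex_linear\<close>; for them the
  library's operator norm is the usual one.
\<close>

definition complex_linear :: "(ell2 \<Rightarrow>\<^sub>L ell2) \<Rightarrow> bool" where
  "complex_linear A \<longleftrightarrow> (\<forall>c x. blinfun_apply A (scaleC c x) = scaleC c (blinfun_apply A x))"

definition basis_vec :: "nat \<Rightarrow> ell2" where
  "basis_vec k = Abs_ell2 (\<lambda>n. if n = k then 1 else 0)"

definition entry :: "(ell2 \<Rightarrow>\<^sub>L ell2) \<Rightarrow> nat \<Rightarrow> nat \<Rightarrow> complex" where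
  "entry A j k = seq (blinfun_apply A (basis_vec k)) j"

text \<open>Meaningful only if the infinite matrix \<open>m\<close> defines a bounded operator.\<close>

definition matrix_op :: "(nat \<Rightarrow> nat \<Rightarrow> complex) \<Rightarrow> ell2 \<Rightarrow>\<^sub>L ell2" where
  "matrix_op m = Blinfun (\<lambda>x. Abs_ell2 (\<lambda>j. \<Sum>k. m j k * seq x k))"

definition P_proj :: "nat \<Rightarrow> ell2 \<Rightarrow>\<^sub>L ell2" where
  "P_proj N = Blinfun (\<lambda>x. Abs_ell2 (\<lambda>n. if n < N then seq x n else 0))"

definition Q_proj :: "nat \<Rightarrow> ell2 \<Rightarrow>\<^sub>L ell2" where
  "Q_proj N = id_blinfun - P_proj N"

definition det_section :: "nat \<Rightarrow> (ell2 \<Rightarrow>\<^sub>L ell2) \<Rightarrow> complex" where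
  "det_section N A =
     Determinant.det (Matrix.mat N N (\<lambda>(j, k). entry (P_proj N o\<^sub>L A o\<^sub>L P_proj N) j k))"

definition rank_le :: "nat \<Rightarrow> (ell2 \<Rightarrow>\<^sub>L ell2) \<Rightarrow> bool" where
  "rank_le n F \<longleftrightarrow>
     (\<exists>v :: nat \<Rightarrow> ell2. \<forall>x. \<exists>c :: nat \<Rightarrow> complex.
        blinfun_apply F x = (\<Sum>i<n. scaleC (c i) (v i)))"

text \<open>
  The singular numbers \<open>s\<^sub>0(A) \<ge> s\<^sub>1(A) \<ge> \<dots>\<close> of a Hilbert space operator, taken as its
  approximation numbers; the trace class and its norm are given by their sum.
\<close>

definition singular_number :: "(ell2 \<Rightarrow>\<^sub>L ell2) \<Rightarrow> nat \<Rightarrow> real" where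
  "singular_number A n = Inf {norm (A - F) | F. complex_linear F \<and> rank_le n F}"

definition trace_class :: "(ell2 \<Rightarrow>\<^sub>L ell2) \<Rightarrow> bool" where
  "trace_class A \<longleftrightarrow> complex_linear A \<and> summable (singular_number A)"

definition trace_norm :: "(ell2 \<Rightarrow>\<^sub>L ell2) \<Rightarrow> real" where
  "trace_norm A = (\<Sum>n. singular_number A n)"

definition op_trace :: "(ell2 \<Rightarrow>\<^sub>L ell2) \<Rightarrow> complex" where
  "op_trace A = (\<Sum>n. entry A n n)"

definition principal_minor :: "(ell2 \<Rightarrow>\<^sub>L ell2) \<Rightarrow> nat set \<Rightarrow> complex" where
  "principal_minor A J =
     Determinant.det (Matrix.mat (card J) (card J)
       (\<lambda>(p, q). entry A (sorted_list_of_set J ! p) (sorted_list_of_set J ! q)))"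

text \<open>
  The Fredholm determinant of \<open>B = I + A\<close> with \<open>A\<close> of trace class, by Fredholm's expansion
  \<open>det (I + A) = (\<Sum>n. tr (\<Lambda>\<^sup>n A))\<close>, where \<open>tr (\<Lambda>\<^sup>n A)\<close> is the sum of the principal
  \<open>n \<times> n\<close> minors of \<open>A\<close>.  Note that the argument is \<open>B\<close>, not \<open>A\<close>.
\<close>

definition fredholm_det :: "(ell2 \<Rightarrow>\<^sub>L ell2) \<Rightarrow> complex" where
  "fredholm_det B = (\<Sum>\<^sub>\<infinity>J | finite J. principal_minor (B - id_blinfun) J)"

text \<open>
  A function on the circle is represented by a function \<open>complex \<Rightarrow> complex\<close>, of which only the
  values at the points \<open>cis \<theta>\<close> matter, and those only up to a null set of \<open>\<theta>\<close>.
\<close>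

definition eq_circle :: "(complex \<Rightarrow> complex) \<Rightarrow> (complex \<Rightarrow> complex) \<Rightarrow> bool" where
  "eq_circle f g \<longleftrightarrow> (AE \<theta> in lebesgue_on {-pi..pi}. f (cis \<theta>) = g (cis \<theta>))"

definition fourier :: "(complex \<Rightarrow> complex) \<Rightarrow> int \<Rightarrow> complex" where
  "fourier a n =
     1 / of_real (2 * pi) *
     (LINT \<theta>|lebesgue_on {-pi..pi}. a (cis \<theta>) * exp (- (\<i> * of_int n * of_real \<theta>)))"

definition flip :: "(complex \<Rightarrow> complex) \<Rightarrow> complex \<Rightarrow> complex" where
  "flip a t = a (inverse t)"

definition toeplitz :: "(complex \<Rightarrow> complex) \<Rightarrow> ell2 \<Rightarrow>\<^sub>L ell2" where
  "toeplitz a = matrix_op (\<lambda>j k. fourier a (int j - int k))"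

definition hankel :: "(complex \<Rightarrow> complex) \<Rightarrow> ell2 \<Rightarrow>\<^sub>L ell2" where
  "hankel a = matrix_op (\<lambda>j k. fourier a (int j + int k + 1))"

text \<open>\<open>G[a]\<close> for \<open>a = exp b\<close>, as a function of the logarithm \<open>b\<close>.\<close>

definition G_exp :: "(complex \<Rightarrow> complex) \<Rightarrow> complex" where
  "G_exp b = exp (1 / of_real (2 * pi) * (LINT \<theta>|lebesgue_on {-pi..pi}. b (cis \<theta>)))"

text \<open>
  A unital Banach algebra \<open>S\<close> with norm \<open>nrm\<close>, continuously embedded in \<open>L\<^sup>\<infinity>\<close> of the circle.
  Classes modulo null sets are represented by making \<open>S\<close> closed, and \<open>nrm\<close> invariant, under
  almost everywhere equality.  No normalisation of \<open>nrm\<close> at the unit is required.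
\<close>

locale circle_banach_algebra =
  fixes S :: "(complex \<Rightarrow> complex) set"
    and nrm :: "(complex \<Rightarrow> complex) \<Rightarrow> real"
  assumes ae_closed: "\<And>f g. f \<in> S \<Longrightarrow> eq_circle f g \<Longrightarrow> g \<in> S \<and> nrm g = nrm f"
    and one_mem: "(\<lambda>t. 1) \<in> S"
    and add_mem: "\<And>f g. f \<in> S \<Longrightarrow> g \<in> S \<Longrightarrow> (\<lambda>t. f t + g t) \<in> S"
    and scale_mem: "\<And>c f. f \<in> S \<Longrightarrow> (\<lambda>t. c * f t) \<in> S"
    and mult_mem: "\<And>f g. f \<in> S \<Longrightarrow> g \<in> S \<Longrightarrow> (\<lambda>t. f t * g t) \<in> S"
    and nrm_nonneg: "\<And>f. f \<in> S \<Longrightarrow> 0 \<le> nrm f"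
    and nrm_zero: "\<And>f. f \<in> S \<Longrightarrow> nrm f = 0 \<longleftrightarrow> eq_circle f (\<lambda>t. 0)"
    and nrm_add: "\<And>f g. f \<in> S \<Longrightarrow> g \<in> S \<Longrightarrow> nrm (\<lambda>t. f t + g t) \<le> nrm f + nrm g"
    and nrm_scale: "\<And>c f. f \<in> S \<Longrightarrow> nrm (\<lambda>t. c * f t) = cmod c * nrm f"
    and nrm_mult: "\<And>f g. f \<in> S \<Longrightarrow> g \<in> S \<Longrightarrow> nrm (\<lambda>t. f t * g t) \<le> nrm f * nrm g"
    and complete: "\<And>X. \<lbrakk>\<And>n :: nat. X n \<in> S;
        \<And>e. e > 0 \<Longrightarrow> \<exists>N. \<forall>m\<ge>N. \<forall>n\<ge>N. nrm (\<lambda>t. X m t - X n t) < e\<rbrakk>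
        \<Longrightarrow> \<exists>f\<in>S. (\<lambda>n. nrm (\<lambda>t. X n t - f t)) \<longlonglongrightarrow> 0"
    and measurable: "\<And>f. f \<in> S \<Longrightarrow> (\<lambda>\<theta>. f (cis \<theta>)) \<in> borel_measurable (lebesgue_on {-pi..pi})"
    and embedding:
      "\<exists>C. \<forall>f\<in>S. AE \<theta> in lebesgue_on {-pi..pi}. cmod (f (cis \<theta>)) \<le> C * nrm f"

definition S_plus :: "(complex \<Rightarrow> complex) set \<Rightarrow> (complex \<Rightarrow> complex) set" where
  "S_plus S = {a \<in> S. \<forall>n<0. fourier a n = 0}"

definition S_minus :: "(complex \<Rightarrow> complex) set \<Rightarrow> (complex \<Rightarrow> complex) set" where
  "S_minus S = {a \<in> S. \<forall>n>0. fourier a n = 0}"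

definition S_even :: "(complex \<Rightarrow> complex) set \<Rightarrow> (complex \<Rightarrow> complex) set" where
  "S_even S = {a \<in> S. eq_circle a (flip a)}"

text \<open>
  \<open>M\<close> is a function on representatives; \<open>M_add\<close>, \<open>M_scale\<close> and \<open>M_bounded\<close> force it to
  respect almost everywhere equality on \<open>S\<close>.  Its values outside \<open>S\<close> are irrelevant.
\<close>

locale compatible_pair = circle_banach_algebra S nrm
  for S :: "(complex \<Rightarrow> complex) set"
    and nrm :: "(complex \<Rightarrow> complex) \<Rightarrow> real" +
  fixes M :: "(complex \<Rightarrow> complex) \<Rightarrow> ell2 \<Rightarrow>\<^sub>L ell2"
  assumes riesz: "\<exists>C. \<forall>f\<in>S. \<exists>g\<in>S.
        (\<forall>k. fourier g k = (if k \<ge> 0 then fourier f k else 0)) \<and> nrm g \<le> C * nrm f"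
    and flip_bounded: "\<exists>C. \<forall>f\<in>S. flip f \<in> S \<and> nrm (flip f) \<le> C * nrm f"
    and M_complex_linear: "\<And>f. f \<in> S \<Longrightarrow> complex_linear (M f)"
    and M_add: "\<And>f g. f \<in> S \<Longrightarrow> g \<in> S \<Longrightarrow> M (\<lambda>t. f t + g t) = M f + M g"
    and M_scale: "\<And>c f x. f \<in> S \<Longrightarrow>
        blinfun_apply (M (\<lambda>t. c * f t)) x = scaleC c (blinfun_apply (M f) x)"
    and M_bounded: "\<exists>C. \<forall>f\<in>S. norm (M f) \<le> C * nrm f"
    and M_trace_class: "\<exists>C. \<forall>f\<in>S. trace_class (M f - toeplitz f)
        \<and> trace_norm (M f - toeplitz f) \<le> C * nrm f"
    and M_mult: "\<And>a b c. a \<in> S_minus S \<Longrightarrow> b \<in> S \<Longrightarrow> c \<in> S_even S \<Longrightarrow>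
        M (\<lambda>t. a t * b t * c t) = toeplitz a o\<^sub>L M b o\<^sub>L M c"
    and M_one: "M (\<lambda>t. 1) = id_blinfun"

end

(*
Put U = T(flip b_+), L = T(b_+) and B = M(b).  For a in S_- the operator T(ab) - T(a)T(b) is of
trace class by the axioms for M and constant along diagonals, hence zero; so T(a_+) = exp L,
T(flip a_+) = exp U, while M(a) = exp B because M is multiplicative on even functions.  Applying
the axioms to (f + flip f)^2 shows that T(flip f) T(f) - T(f) T(flip f) is of trace class for
f in S_+; for f = b_+ it equals H(b)^2.  Since exp L is lower and exp U upper triangular, the
section of M(a) differs by the factor G[a]^N from that of A = exp(-L) exp B exp(-U), whose inverse
is I + K, and Jacobi's identity applies.  The determinant det A = det (exp(-U) exp(-L) exp B) is
computed by differentiating s |-> det (exp(-sU) exp(-sL) exp(sB)).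

Determinants are handled without singular value decompositions.  A trace class operator is a sum of
rank one operators x_i (x) y_i with summable |x_i| |y_i|, hence its entries satisfy
|a_jk| <= u_j v_k with u, v in l^2.  This bounds the principal minors on J by |J|! times the product
of the u_j v_j, which is summable over all finite J, so that all identities for determinants follow
from those of the finite sections by dominated convergence.
*)
theory Submission
  imports Defs
begin

section \<open>Fredholm determinants of infinite matrices\<close>

text \<open>The obstacle is that the axioms make none of \<open>B\<close>, \<open>U\<close>,
  \<open>L\<close> trace class, only \<open>D = B - U - L\<close> and the commutator of
  \<open>U\<close> and \<open>L\<close>. Every estimate therefore concerns a difference in which the
  bounded parts cancel, with a remainder bounded in trace norm; this is what \<open>nuclear\<close>
  records, with an explicit constant. The logarithmic derivative of the determinant at s is the
  trace of \<open>B - L - exp (s L) U exp (- s L)\<close>, that is, trace D - s trace (L U - U L):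
  the trace of \<open>exp (s L) U exp (- s L) - U\<close> need not vanish as it would for trace
  class \<open>U\<close>, and it is linear in s. Integration from 0 to 1 produces the factor 1/2.
  The majorant \<open>u_j v_k\<close> matters because all permutations in a minor then have the same
  bound, and |J|! times the weight products, summed over all J of size k, is at most (sum u_j
  v_j)^k. Hence small operators satisfy det (I + A) = 1 + trace A up to a quadratic error.
  Transposes and pairings are taken without conjugation: this turns T(f) into T(flip f), and facts
  on S_- into facts on S_+.\<close>

lemma tendsto_infsum_dominated:
  fixes f :: "nat \<Rightarrow> 'a \<Rightarrow> 'b :: banach"
  assumes lim: "\<And>x. x \<in> S \<Longrightarrow> (\<lambda>n. f n x) \<longlonglongrightarrow> h x"
    and le: "\<And>n x. x \<in> S \<Longrightarrow> norm (f n x) \<le> g x"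
    and g: "g summable_on S"
  shows "(\<lambda>n. infsum (f n) S) \<longlonglongrightarrow> infsum h S"
proof -
  have hle: "norm (h x) \<le> g x" if "x \<in> S" for x
    using that by (intro LIMSEQ_le_const2[OF tendsto_norm[OF lim[OF that]]]) (auto intro: le)
  have fs: "f n summable_on S" for n
    using g by (rule abs_summable_summable[OF summable_on_comparison_test]) (auto simp: le)
  have hs: "h summable_on S"
    using g by (rule abs_summable_summable[OF summable_on_comparison_test]) (auto simp: hle)
  have ds: "(\<lambda>x. norm (f n x - h x)) summable_on S" for n
  proof (rule summable_on_comparison_test)
    show "(\<lambda>x. 2 * g x) summable_on S" using g by (rule summable_on_cmult_right)
    show "norm (f n x - h x) \<le> 2 * g x" if "x \<in> S" for x
      using le[OF that, of n] hle[OF that] norm_triangle_ineq4[of "f n x" "h x"] by linarith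
  qed auto
  have "(\<lambda>n. infsum (\<lambda>x. norm (f n x - h x)) S) \<longlonglongrightarrow> 0"
  proof (rule LIMSEQ_I)
    fix r :: real assume r: "r > 0"
    \<comment> \<open>The difference \<open>f n x - h x\<close> is bounded by
      \<open>2 * g x\<close>, so a tail of \<open>g\<close> of at most \<open>r / 8\<close> costs at
      most \<open>r / 4\<close>; the finite set \<open>F\<close> is allowed
      \<open>r / 2\<close>.\<close>
    obtain F where F: "finite F" "F \<subseteq> S" "dist (sum g F) (infsum g S) \<le> r / 8"
      using infsum_finite_approximation[OF g, of "r/8"] r by auto
    have "infsum g S = sum g F + infsum g (S - F)"
      using F g infsum_Un_disjoint[of g F "S - F"] summable_on_subset_banach[OF g, of "S - F"]
      by (simp add: Un_absorb1)
    hence tail: "infsum g (S - F) \<le> r / 8" using F(3) by (simp add: dist_real_def)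
    have "(\<lambda>n. \<Sum>x\<in>F. norm (f n x - h x)) \<longlonglongrightarrow> (\<Sum>x\<in>F. norm (h x - h x))"
      by (intro tendsto_intros lim) (use F in auto)
    hence "eventually (\<lambda>n. (\<Sum>x\<in>F. norm (f n x - h x)) < r / 2) sequentially"
      by (intro order_tendstoD(2)[where a = "r/2"]) (use r in auto)
    then obtain N where N: "\<And>n. n \<ge> N \<Longrightarrow> (\<Sum>x\<in>F. norm (f n x - h x)) < r / 2"
      by (auto simp: eventually_sequentially)
    have "norm (infsum (\<lambda>x. norm (f n x - h x)) S - 0) < r" if "n \<ge> N" for n
    proof -
      have "infsum (\<lambda>x. norm (f n x - h x)) S
          = (\<Sum>x\<in>F. norm (f n x - h x)) + infsum (\<lambda>x. norm (f n x - h x)) (S - F)"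
        using F infsum_Un_disjoint[of "\<lambda>x. norm (f n x - h x)" F "S - F"]
          summable_on_subset_banach[OF ds, of "S - F"]
        by (simp add: Un_absorb1)
      also have "infsum (\<lambda>x. norm (f n x - h x)) (S - F) \<le> infsum (\<lambda>x. 2 * g x) (S - F)"
      proof (rule infsum_mono)
        show "(\<lambda>x. norm (f n x - h x)) summable_on S - F"
          using ds by (rule summable_on_subset_banach) auto
        show "(\<lambda>x. 2 * g x) summable_on S - F"
          using g by (intro summable_on_cmult_right summable_on_subset_banach[OF g]) auto
        show "norm (f n x - h x) \<le> 2 * g x" if "x \<in> S - F" for x
          using le[of x n] hle[of x] that norm_triangle_ineq4[of "f n x" "h x"] by force
      qed
      also have "\<dots> = 2 * infsum g (S - F)" by (rule infsum_cmult_right')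
      finally have "infsum (\<lambda>x. norm (f n x - h x)) S < r"
        using N[OF that] tail r by linarith
      moreover have "infsum (\<lambda>x. norm (f n x - h x)) S \<ge> 0" by (intro infsum_nonneg) auto
      ultimately show ?thesis by simp
    qed
    thus "\<exists>N. \<forall>n\<ge>N. norm (infsum (\<lambda>x. norm (f n x - h x)) S - 0) < r" by blast
  qed
  moreover have "norm (infsum (f n) S - infsum h S) \<le> infsum (\<lambda>x. norm (f n x - h x)) S" for n
  proof -
    have "infsum (f n) S - infsum h S = infsum (\<lambda>x. f n x + - h x) S"
      using fs hs by (subst infsum_add) (auto simp: infsum_uminus summable_on_uminus)
    thus ?thesis using norm_infsum_bound[OF ds[of n]] by simp
  qed
  ultimately have "(\<lambda>n. infsum (f n) S - infsum h S) \<longlonglongrightarrow> 0"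
    by (rule Lim_null_comparison[OF always_eventually[OF allI], rotated])
  thus ?thesis by (simp add: LIM_zero_iff)
qed

text \<open>The Leibniz formula over an arbitrary index set instead of an initial segment: minors on
  \<open>J\<close> then involve no renumbering, and a permutation of \<open>J\<close> is literally a
  permutation of every larger set.\<close>

definition ldet :: "(nat \<Rightarrow> nat \<Rightarrow> complex) \<Rightarrow> nat set \<Rightarrow> complex" where
  "ldet m J = (\<Sum>p | p permutes J. of_int (sign p) * (\<Prod>j\<in>J. m j (p j)))"

lemma det_mat_eq_ldet: "Determinant.det (Matrix.mat n n (\<lambda>(i, j). m i j)) = ldet m {..<n}"
proof -
  have "Determinant.det (Matrix.mat n n (\<lambda>(i, j). m i j)) =
     (\<Sum>p | p permutes {..<n}. of_int (sign p) * (\<Prod>i<n. Matrix.mat n n (\<lambda>(i, j). m i j) $$ (i, p i)))"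
    using det_def'[of "Matrix.mat n n (\<lambda>(i, j). m i j)" n] by (simp add: atLeast0LessThan)
  also have "\<dots> = ldet m {..<n}"
    unfolding ldet_def
  proof (intro sum.cong refl)
    fix p assume "p \<in> {p. p permutes {..<n}}"
    hence *: "p i < n" if "i < n" for i using permutes_in_image[of p "{..<n}" i] that by auto
    have "(\<Prod>i<n. Matrix.mat n n (\<lambda>(i, j). m i j) $$ (i, p i)) = (\<Prod>j<n. m j (p j))"
      by (rule prod.cong) (simp_all add: *)
    thus "of_int (sign p) * (\<Prod>i<n. Matrix.mat n n (\<lambda>(i, j). m i j) $$ (i, p i)) =
        of_int (sign p) * (\<Prod>j<n. m j (p j))"
      by (simp cong: prod.cong)
  qed
  finally show ?thesis .
qed

text \<open>Conjugation by \<open>f\<close> maps the permutations of \<open>A\<close> onto those of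
  \<open>B\<close> and keeps the sign.\<close>

lemma ldet_reindex:
  assumes f: "bij_betw f A B" and A: "finite A"
  shows "ldet m B = ldet (\<lambda>i j. m (f i) (f j)) A"
proof -
  have inj: "inj_on f A" and B: "B = f ` A" using f by (auto simp: bij_betw_def)
  let ?g = "\<lambda>p x. if x \<in> B then f (p (inv_into A f x)) else x"
  have eq: "?g p = map_permutation A f p" for p
    by (auto simp: map_permutation_def restrict_id_def fun_eq_iff B)
  have "bij_betw (map_permutation A f) {p. p permutes A} {p. p permutes B}"
    using bij_betw_permutations[OF f] unfolding eq .
  hence "ldet m B = (\<Sum>p | p permutes A. of_int (sign (map_permutation A f p)) *
      (\<Prod>j\<in>B. m j (map_permutation A f p j)))"
    unfolding ldet_def by (rule sum.reindex_bij_betw[symmetric])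
  also have "\<dots> = ldet (\<lambda>i j. m (f i) (f j)) A"
    unfolding ldet_def
  proof (intro sum.cong refl arg_cong2[where f="(*)"])
    fix p assume p: "p \<in> {p. p permutes A}"
    thus "complex_of_int (sign (map_permutation A f p)) = of_int (sign p)"
      using sign_map_permutation[OF inj _ A] by simp
  next
    fix p assume p: "p \<in> {p. p permutes A}"
    have "(\<Prod>j\<in>B. m j (map_permutation A f p j)) = (\<Prod>j\<in>A. m (f j) (map_permutation A f p (f j)))"
      unfolding B using inj by (simp add: prod.reindex)
    also have "\<dots> = (\<Prod>j\<in>A. m (f j) (f (p j)))"
      using inj by (simp add: map_permutation_apply cong: prod.cong)
    finally show "(\<Prod>j\<in>B. m j (map_permutation A f p j)) = (\<Prod>j\<in>A. m (f j) (f (p j)))" .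
  qed
  finally show ?thesis .
qed

lemma principal_minor_eq_ldet:
  assumes "finite J"
  shows "principal_minor A J = ldet (entry A) J"
proof -
  let ?s = "\<lambda>i. sorted_list_of_set J ! i"
  have "bij_betw ?s {..<card J} J"
    using assms by (intro bij_betw_nth) auto
  from ldet_reindex[OF this, of "entry A"]
  show ?thesis unfolding principal_minor_def
    by (simp add: det_mat_eq_ldet[symmetric])
qed

abbreviation kron :: "nat \<Rightarrow> nat \<Rightarrow> complex" where
  "kron i j \<equiv> (if i = j then 1 else 0)"

text \<open>Multiplying out the rows, each row picks either \<open>m\<close> or the identity. If the
  rows in \<open>S - J\<close> pick the identity, exactly the permutations fixing
  \<open>S - J\<close> pointwise survive, and these are the permutations of
  \<open>J\<close>.\<close>

lemma ldet_kron_add: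
  assumes S: "finite S"
  shows "ldet (\<lambda>i j. kron i j + m i j) S = (\<Sum>J\<in>Pow S. ldet m J)"
proof -
  have "ldet (\<lambda>i j. kron i j + m i j) S =
      (\<Sum>p | p permutes S. of_int (sign p) *
        (\<Sum>J\<in>Pow S. (\<Prod>j\<in>J. m j (p j)) * (\<Prod>j\<in>S-J. kron j (p j))))"
    unfolding ldet_def
    by (intro sum.cong refl arg_cong2[where f="(*)"], subst add.commute, rule prod_add[OF S])
  also have "\<dots> = (\<Sum>J\<in>Pow S. \<Sum>p | p permutes S. of_int (sign p) *
        ((\<Prod>j\<in>J. m j (p j)) * (\<Prod>j\<in>S-J. kron j (p j))))"
    by (simp add: sum_distrib_left) (rule sum.swap)
  also have "\<dots> = (\<Sum>J\<in>Pow S. ldet m J)"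
  proof (rule sum.cong[OF refl])
    fix J assume J: "J \<in> Pow S"
    have *: "(\<Prod>j\<in>S-J. kron j (p j)) = (if p permutes J then 1 else 0)" if p: "p permutes S" for p
    proof (cases "p permutes J")
      case True
      thus ?thesis by (auto simp: permutes_not_in intro!: prod.neutral)
    next
      case False
      have "\<exists>j\<in>S-J. p j \<noteq> j"
      proof (rule ccontr)
        assume "\<not> ?thesis"
        hence "p permutes J" using permutes_superset[OF p, of J] by auto
        thus False using False by simp
      qed
      then obtain j where "j \<in> S - J" "kron j (p j) = 0" by auto
      hence "(\<Prod>j\<in>S-J. kron j (p j)) = 0" using S by (intro prod_zero) blast+
      thus ?thesis using False by simp
    qed
    have "(\<Sum>p | p permutes S. of_int (sign p) *
        ((\<Prod>j\<in>J. m j (p j)) * (\<Prod>j\<in>S-J. kron j (p j)))) =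
        (\<Sum>p | p permutes S. if p permutes J then of_int (sign p) * (\<Prod>j\<in>J. m j (p j)) else 0)"
      by (intro sum.cong refl) (simp add: *)
    also have "\<dots> = (\<Sum>p\<in>{p. p permutes S} \<inter> {p. p permutes J}. of_int (sign p) * (\<Prod>j\<in>J. m j (p j)))"
      by (subst sum.inter_restrict) (auto simp: finite_permutations S)
    also have "{p. p permutes S} \<inter> {p. p permutes J} = {p. p permutes J}"
      using J permutes_subset by auto
    finally show "(\<Sum>p | p permutes S. of_int (sign p) *
        ((\<Prod>j\<in>J. m j (p j)) * (\<Prod>j\<in>S-J. kron j (p j)))) = ldet m J"
      by (simp add: ldet_def)
  qed
  finally show ?thesis .
qed

text \<open>Every permutation yields the same product of weights, because the factors
  \<open>v\<close> are only rearranged. The crude factor \<open>fact (card J)\<close> is absorbed by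
  \<open>elementary_symmetric_le\<close> after summation over all \<open>J\<close> of a given
  size.\<close>

lemma norm_ldet_le:
  assumes J: "finite J" and le: "\<And>i j. cmod (m i j) \<le> u i * v j"
  shows "cmod (ldet m J) \<le> fact (card J) * (\<Prod>j\<in>J. u j * v j)"
proof -
  have "cmod (ldet m J) \<le> (\<Sum>p | p permutes J. \<Prod>j\<in>J. u j * v j)"
    unfolding ldet_def
  proof (rule sum_norm_le)
    fix p assume p: "p \<in> {p. p permutes J}"
    have "cmod (of_int (sign p) * (\<Prod>j\<in>J. m j (p j))) = (\<Prod>j\<in>J. cmod (m j (p j)))"
      by (simp add: norm_mult prod_norm sign_def)
    also have "\<dots> \<le> (\<Prod>j\<in>J. u j * v (p j))" by (intro prod_mono) (auto simp: le)
    also have "\<dots> = (\<Prod>j\<in>J. u j) * (\<Prod>j\<in>J. v j)"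
      using p prod.permute[of p J v] by (simp add: prod.distrib o_def)
    finally show "cmod (of_int (sign p) * (\<Prod>j\<in>J. m j (p j))) \<le> (\<Prod>j\<in>J. u j * v j)"
      by (simp add: prod.distrib)
  qed
  also have "\<dots> = fact (card J) * (\<Prod>j\<in>J. u j * v j)"
    using J by (simp add: card_permutations)
  finally show ?thesis .
qed

section \<open>Summability over all finite index sets\<close>

lemma sum_Pow_card:
  assumes "finite S"
  shows "(\<Sum>J\<in>Pow S. f J) = (\<Sum>k\<le>card S. \<Sum>J | J \<subseteq> S \<and> card J = k. f J)"
proof -
  have "(\<Sum>k\<le>card S. \<Sum>J | J \<in> Pow S \<and> card J = k. f J) = (\<Sum>J\<in>Pow S. f J)"
    using assms by (intro sum.group) (auto simp: card_mono)
  thus ?thesis by simp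
qed

text \<open>The left side collects the terms with distinct indices in the expansion of the power.
  The induction separates the sets that contain the new element \<open>a\<close>; its last step
  keeps only the first two terms of the binomial expansion of
  \<open>(sum w S + w a) ^ k\<close>.\<close>

lemma elementary_symmetric_le:
  fixes w :: "nat \<Rightarrow> real"
  assumes "finite S" "\<And>j. w j \<ge> 0"
  shows "fact k * (\<Sum>J | J \<subseteq> S \<and> card J = k. prod w J) \<le> sum w S ^ k"
  using assms(1)
proof (induction S arbitrary: k rule: finite_induct)
  case empty
  have "{J :: nat set. J \<subseteq> {} \<and> card J = k} = (if k = 0 then {{}} else {})" by auto
  thus ?case by simp
next
  case (insert a S)
  show ?case
  proof (cases k)
    case 0
    have "{J. J \<subseteq> insert a S \<and> card J = 0} = {{}}"
      using insert.hyps by (auto dest: finite_subset)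
    thus ?thesis using 0 by simp
  next
    case (Suc l)
    have fin: "finite {J. J \<subseteq> S \<and> card J = n}" for n using insert.hyps by simp
    have eq: "{J. J \<subseteq> insert a S \<and> card J = k} =
       {J. J \<subseteq> S \<and> card J = k} \<union> insert a ` {J. J \<subseteq> S \<and> card J = l}" (is "?L = ?R")
    proof (intro equalityI subsetI)
      fix J assume J: "J \<in> ?L"
      hence fJ: "finite J" using insert.hyps by (auto intro: finite_subset)
      show "J \<in> ?R"
      proof (cases "a \<in> J")
        case True
        hence "J = insert a (J - {a})" "J - {a} \<subseteq> S" "card (J - {a}) = l"
          using J Suc fJ by (auto simp: card_Diff_singleton)
        thus ?thesis by blast
      qed (use J in auto)
    next
      fix J assume "J \<in> ?R"
      thus "J \<in> ?L"
      proof
        assume "J \<in> insert a ` {J. J \<subseteq> S \<and> card J = l}"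
        then obtain J' where "J = insert a J'" "J' \<subseteq> S" "card J' = l" by auto
        moreover have "finite J'" "a \<notin> J'" using calculation insert.hyps by (auto dest: finite_subset)
        ultimately show ?thesis using Suc by auto
      qed auto
    qed
    have inj: "inj_on (insert a) {J. J \<subseteq> S \<and> card J = l}"
      using insert.hyps by (intro inj_onI) (metis (no_types, lifting) mem_Collect_eq subsetD insert_ident)
    have "(\<Sum>J\<in>?L. prod w J) = (\<Sum>J | J \<subseteq> S \<and> card J = k. prod w J)
        + (\<Sum>J | J \<subseteq> S \<and> card J = l. prod w (insert a J))"
      unfolding eq using fin insert.hyps inj
      by (subst sum.union_disjoint) (auto simp: sum.reindex)
    also have "(\<Sum>J | J \<subseteq> S \<and> card J = l. prod w (insert a J))
        = w a * (\<Sum>J | J \<subseteq> S \<and> card J = l. prod w J)"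
      unfolding sum_distrib_left
    proof (intro sum.cong refl)
      fix J assume "J \<in> {J. J \<subseteq> S \<and> card J = l}"
      thus "prod w (insert a J) = w a * prod w J"
        using insert.hyps by (subst prod.insert) (auto dest: finite_subset)
    qed
    finally have "fact k * (\<Sum>J\<in>?L. prod w J) = fact k * (\<Sum>J | J \<subseteq> S \<and> card J = k. prod w J)
       + real k * w a * (fact l * (\<Sum>J | J \<subseteq> S \<and> card J = l. prod w J))"
      by (simp add: Suc algebra_simps)
    also have "\<dots> \<le> sum w S ^ k + real k * w a * sum w S ^ l"
      by (intro add_mono mult_left_mono insert.IH) (use assms(2) in auto)
    also have "\<dots> \<le> (sum w S + w a) ^ k"
    proof -
      have s: "sum w S \<ge> 0" using assms(2) by (simp add: sum_nonneg)
      have "x ^ n * x + real (Suc n) * y * x ^ n \<le> (x + y) ^ n * (x + y)" if "x \<ge> 0" "y \<ge> 0" for x y :: real and n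
      proof (induction n)
        case (Suc n)
        have "x ^ Suc n * x + real (Suc (Suc n)) * y * x ^ Suc n
            = (x ^ n * x + real (Suc n) * y * x ^ n) * x + y * x ^ n * x" by (simp add: algebra_simps)
        also have "\<dots> \<le> (x ^ n * x + real (Suc n) * y * x ^ n) * x + (x ^ n * x + real (Suc n) * y * x ^ n) * y"
          using that by (simp add: algebra_simps)
        also have "\<dots> = (x ^ n * x + real (Suc n) * y * x ^ n) * (x + y)" by (simp add: algebra_simps)
        also have "\<dots> \<le> ((x + y) ^ n * (x + y)) * (x + y)"
          using Suc that by (intro mult_right_mono) auto
        finally show ?case by (simp add: algebra_simps)
      qed (simp add: algebra_simps)
      from this[OF s assms(2), of l a] show ?thesis by (simp add: Suc algebra_simps)
    qed
    finally show ?thesis using insert.hyps by (simp add: add.commute)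
  qed
qed

text \<open>Separates the factorial of the size of a disjoint union at the price of an exponential
  factor, the bound for the binomial coefficient.\<close>

lemma fact_add_le: "(fact (m + k) :: real) \<le> 2 ^ (m + k) * fact m * fact k"
proof -
  have "fact m * fact k * ((m + k) choose m) = fact (m + k)"
    using binomial_fact_lemma[of m "m + k"] by simp
  moreover have "(m + k) choose m \<le> 2 ^ (m + k)" by (rule binomial_le_pow2)
  ultimately have "fact (m + k) \<le> fact m * fact k * (2 ^ (m + k) :: nat)"
    by (metis mult_le_mono2)
  hence "real (fact (m + k)) \<le> real (fact m * fact k * 2 ^ (m + k))" by (rule of_nat_mono)
  thus ?thesis by (simp add: algebra_simps)
qed

text \<open>The weight \<open>1 / 4\<close> is chosen against the factor \<open>2 ^ k\<close> of
  \<open>fact_add_le\<close>: sets of size \<open>k\<close> contribute at most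
  \<open>2 ^ m * fact m * (1 / 2) ^ k\<close>, and the geometric series gives one more factor 2. The
  parameter \<open>m\<close> stands for the number of indices outside \<open>S\<close>.\<close>

lemma sum_Pow_fact_le:
  fixes w :: "nat \<Rightarrow> real"
  assumes S: "finite S" and w: "\<And>j. w j \<ge> 0" and small: "sum w S \<le> 1 / 4"
  shows "(\<Sum>J\<in>Pow S. fact (m + card J) * prod w J) \<le> 2 ^ Suc m * fact m"
proof -
  have "(\<Sum>J\<in>Pow S. fact (m + card J) * prod w J)
      = (\<Sum>k\<le>card S. \<Sum>J | J \<subseteq> S \<and> card J = k. fact (m + k) * prod w J)"
    unfolding sum_Pow_card[OF S] by (intro sum.cong) auto
  also have "\<dots> \<le> (\<Sum>k\<le>card S. 2 ^ m * fact m * (1 / 2) ^ k)"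
  proof (rule sum_mono)
    fix k
    have nn: "(\<Sum>J | J \<subseteq> S \<and> card J = k. prod w J) \<ge> 0" using w by (intro sum_nonneg prod_nonneg)
    have "(\<Sum>J | J \<subseteq> S \<and> card J = k. fact (m + k) * prod w J)
        = fact (m + k) * (\<Sum>J | J \<subseteq> S \<and> card J = k. prod w J)" by (simp add: sum_distrib_left)
    also have "\<dots> \<le> (2 ^ (m + k) * fact m * fact k) * (\<Sum>J | J \<subseteq> S \<and> card J = k. prod w J)"
      by (intro mult_right_mono fact_add_le nn)
    also have "\<dots> = 2 ^ (m + k) * fact m * (fact k * (\<Sum>J | J \<subseteq> S \<and> card J = k. prod w J))" by simp
    also have "\<dots> \<le> 2 ^ (m + k) * fact m * sum w S ^ k"
      by (intro mult_left_mono elementary_symmetric_le S w) auto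
    also have "\<dots> \<le> 2 ^ (m + k) * fact m * (1 / 4) ^ k"
      by (intro mult_left_mono power_mono small) (auto intro: sum_nonneg w)
    also have "(2::real) ^ (m + k) * fact m * (1 / 4) ^ k = 2 ^ m * fact m * (1 / 2) ^ k"
    proof -
      have "(2::real) ^ k * (1/4) ^ k = (1/2) ^ k" by (simp flip: power_mult_distrib)
      thus ?thesis by (simp add: power_add)
    qed
    finally show "(\<Sum>J | J \<subseteq> S \<and> card J = k. fact (m + k) * prod w J) \<le> 2 ^ m * fact m * (1 / 2) ^ k" .
  qed
  also have "\<dots> = 2 ^ m * fact m * (\<Sum>k\<le>card S. (1 / 2) ^ k)" by (simp add: sum_distrib_left)
  also have "\<dots> \<le> 2 ^ m * fact m * 2"
  proof (rule mult_left_mono)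
    have "(\<Sum>k\<le>card S. (1 / 2 :: real) ^ k) = 2 - (1 / 2) ^ card S"
      by (induction "card S") (auto simp: sum_gp0)
    thus "(\<Sum>k\<le>card S. (1 / 2 :: real) ^ k) \<le> 2" by simp
  qed auto
  finally show ?thesis by simp
qed

text \<open>Bounding the sets of size \<open>k\<close> by the \<open>k\<close>-th power of the total
  weight gives a convergent series only for weight below 1. Hence an initial segment
  \<open>I\<close> is split off that leaves weight at most \<open>1 / 4\<close>; a finite set is the
  union of one of the finitely many subsets of \<open>I\<close> and a set in the light tail.\<close>

lemma fact_prod_summable_on:
  fixes w :: "nat \<Rightarrow> real"
  assumes w: "\<And>j. w j \<ge> 0" "summable w"
  shows "(\<lambda>J. fact (card J) * prod w J) summable_on {J. finite J}"
proof -
  obtain N where N: "norm (sum w {m..<n}) < 1 / 4" if "m \<ge> N" for m n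
    using w(2) unfolding summable_Cauchy by (meson zero_less_divide_1_iff zero_less_numeral)
  define I where "I = {..<N}"
  have small: "sum w S \<le> 1 / 4" if S: "finite S" "S \<inter> I = {}" for S
  proof -
    obtain n where "S \<subseteq> {..<n}" using S(1) finite_nat_iff_bounded by blast
    hence "S \<subseteq> {N..<n}" using S(2) by (auto simp: I_def disjoint_iff not_less)
    hence "sum w S \<le> sum w {N..<n}" using w by (intro sum_mono2) auto
    thus ?thesis using N[of N n] by simp
  qed
  define B where "B = (\<Sum>J\<in>Pow I. prod w J * (2 ^ Suc (card J) * fact (card J)))"
  have bound: "sum (\<lambda>J. fact (card J) * prod w J) F \<le> B"
    if F: "F \<subseteq> {J. finite J}" "finite F" for F
  proof -
    define S where "S = \<Union>F - I"
    have fS: "finite S" using F by (auto simp: S_def)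
    have fI: "finite I" by (simp add: I_def)
    have disj: "S \<inter> I = {}" by (auto simp: S_def)
    \<comment> \<open>Enlarging \<open>F\<close> to all unions of a subset of \<open>I\<close> and a
      subset of \<open>S\<close> turns the sum into an iterated sum, whose inner part is the one
      bounded by \<open>sum_Pow_fact_le\<close>.\<close>
    have "F \<subseteq> (\<lambda>(J, J'). J \<union> J') ` (Pow I \<times> Pow S)"
    proof
      fix J assume "J \<in> F"
      hence "J = (\<lambda>(J, J'). J \<union> J') (J \<inter> I, J \<inter> S)" "(J \<inter> I, J \<inter> S) \<in> Pow I \<times> Pow S"
        by (auto simp: S_def)
      thus "J \<in> (\<lambda>(J, J'). J \<union> J') ` (Pow I \<times> Pow S)" by blast
    qed
    hence "sum (\<lambda>J. fact (card J) * prod w J) F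
        \<le> sum (\<lambda>J. fact (card J) * prod w J) ((\<lambda>(J, J'). J \<union> J') ` (Pow I \<times> Pow S))"
      using fS fI w by (intro sum_mono2) (auto intro!: mult_nonneg_nonneg prod_nonneg)
    also have "\<dots> = (\<Sum>(J, J')\<in>Pow I \<times> Pow S. fact (card (J \<union> J')) * prod w (J \<union> J'))"
    proof (subst sum.reindex)
      show "inj_on (\<lambda>(J, J'). J \<union> J') (Pow I \<times> Pow S)"
        using disj by (auto simp: inj_on_def) blast+
    qed (auto simp: case_prod_unfold o_def)
    also have "\<dots> = (\<Sum>J\<in>Pow I. \<Sum>J'\<in>Pow S. fact (card J + card J') * (prod w J * prod w J'))"
      unfolding sum.cartesian_product[symmetric]
    proof (intro sum.cong refl)
      fix J J' assume "J \<in> Pow I" "J' \<in> Pow S"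
      hence "finite J" "finite J'" "J \<inter> J' = {}"
        using fI fS disj by (auto dest: finite_subset)
      thus "fact (card (J \<union> J')) * prod w (J \<union> J') = fact (card J + card J') * (prod w J * prod w J')"
        by (simp add: card_Un_disjoint prod.union_disjoint)
    qed
    also have "\<dots> = (\<Sum>J\<in>Pow I. prod w J * (\<Sum>J'\<in>Pow S. fact (card J + card J') * prod w J'))"
      by (simp add: sum_distrib_left algebra_simps)
    also have "\<dots> \<le> B"
      unfolding B_def
      by (intro sum_mono mult_left_mono sum_Pow_fact_le fS w(1) small disj prod_nonneg)
    finally show ?thesis .
  qed
  show ?thesis
    by (rule nonneg_bdd_above_summable_on)
      (use w bound in \<open>auto intro!: bdd_aboveI2[where M=B] mult_nonneg_nonneg prod_nonneg\<close>)
qed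

section \<open>Infinite determinants under a square summable rank one majorant\<close>

lemma Cauchy_Schwarz_series:
  fixes x y :: "nat \<Rightarrow> complex"
  assumes "summable (\<lambda>n. (cmod (x n))\<^sup>2)" "summable (\<lambda>n. (cmod (y n))\<^sup>2)"
  shows "summable (\<lambda>n. cmod (x n * y n))"
    and "(\<Sum>n. cmod (x n * y n)) \<le> sqrt (\<Sum>n. (cmod (x n))\<^sup>2) * sqrt (\<Sum>n. (cmod (y n))\<^sup>2)"
    and "cmod (\<Sum>n. x n * y n) \<le> sqrt (\<Sum>n. (cmod (x n))\<^sup>2) * sqrt (\<Sum>n. (cmod (y n))\<^sup>2)"
proof -
  let ?C = "sqrt (\<Sum>n. (cmod (x n))\<^sup>2) * sqrt (\<Sum>n. (cmod (y n))\<^sup>2)"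
  have le: "(\<Sum>i<n. cmod (x i * y i)) \<le> ?C" for n
  proof -
    have "(\<Sum>i<n. cmod (x i * y i)) = (\<Sum>i<n. \<bar>cmod (x i)\<bar> * \<bar>cmod (y i)\<bar>)" by (simp add: norm_mult)
    also have "\<dots> \<le> L2_set (\<lambda>i. cmod (x i)) {..<n} * L2_set (\<lambda>i. cmod (y i)) {..<n}"
      by (rule L2_set_mult_ineq)
    also have "\<dots> \<le> ?C"
      unfolding L2_set_def
      by (intro mult_mono real_sqrt_le_mono sum_le_suminf assms) (auto intro!: suminf_nonneg assms sum_nonneg)
    finally show ?thesis .
  qed
  show s: "summable (\<lambda>n. cmod (x n * y n))"
    by (rule summableI_nonneg_bounded[OF _ le]) auto
  show le': "(\<Sum>n. cmod (x n * y n)) \<le> ?C" using le by (intro suminf_le_const s) auto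
  show "cmod (\<Sum>n. x n * y n) \<le> ?C" using summable_norm[OF s] le' by linarith
qed

text \<open>The argument is the perturbation: the value is the determinant of identity plus
  \<open>m\<close>, whereas \<open>fredholm_det\<close> takes the whole operator.\<close>

definition fdet :: "(nat \<Rightarrow> nat \<Rightarrow> complex) \<Rightarrow> complex" where
  "fdet m = (\<Sum>\<^sub>\<infinity>J | finite J. ldet m J)"

text \<open>The property of trace class matrices on which the determinant theory rests: it makes
  \<open>u j * v j\<close> summable, as the sum over finite sets requires, and it is stable under
  products.\<close>

definition dominated :: "(nat \<Rightarrow> nat \<Rightarrow> complex) \<Rightarrow> (nat \<Rightarrow> real) \<Rightarrow> (nat \<Rightarrow> real) \<Rightarrow> bool" where
  "dominated m u v \<longleftrightarrow> (\<forall>i. 0 \<le> u i) \<and> (\<forall>i. 0 \<le> v i) \<and>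
     summable (\<lambda>i. (u i)\<^sup>2) \<and> summable (\<lambda>i. (v i)\<^sup>2) \<and> (\<forall>i j. cmod (m i j) \<le> u i * v j)"

lemma dominated_weight_nonneg: "dominated m u v \<Longrightarrow> 0 \<le> u j * v j"
  by (simp add: dominated_def)

lemma dominated_weight_summable:
  assumes "dominated m u v"
  shows "summable (\<lambda>j. u j * v j)"
proof -
  have "summable (\<lambda>j. cmod (complex_of_real (u j) * complex_of_real (v j)))"
    using assms by (intro Cauchy_Schwarz_series(1)) (auto simp: dominated_def)
  thus ?thesis using assms by (simp add: norm_mult dominated_def)
qed

lemma fredholm_det_eq_fdet: "fredholm_det (id_blinfun + A) = fdet (entry A)"
  unfolding fredholm_det_def fdet_def
  by (intro infsum_cong) (simp add: principal_minor_eq_ldet)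

lemma ldet_cong: "(\<And>i j. i \<in> J \<Longrightarrow> j \<in> J \<Longrightarrow> m i j = m' i j) \<Longrightarrow> ldet m J = ldet m' J"
  unfolding ldet_def
  by (intro sum.cong refl arg_cong2[where f="(*)"] prod.cong) (auto simp: permutes_in_image)

lemma ldet_zero_row:
  assumes "finite J" "i \<in> J" "\<And>j. m i j = 0"
  shows "ldet m J = 0"
  unfolding ldet_def
proof (intro sum.neutral ballI)
  fix p
  have "(\<Prod>j\<in>J. m j (p j)) = 0" using assms by (intro prod_zero) auto
  thus "of_int (sign p) * (\<Prod>j\<in>J. m j (p j)) = 0" by simp
qed

text \<open>A minor whose index set meets a zero row vanishes, so the infinite sum runs over subsets
  of \<open>{..<n}\<close>, and \<open>ldet_kron_add\<close> resums it.\<close>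

lemma fdet_finite_rows:
  assumes "\<And>i j. i \<ge> n \<Longrightarrow> m i j = 0"
  shows "fdet m = ldet (\<lambda>i j. kron i j + m i j) {..<n}"
proof -
  have "fdet m = infsum (ldet m) (Pow {..<n})"
    unfolding fdet_def
  proof (rule infsum_cong_neutral)
    fix J assume "J \<in> {J. finite J} - Pow {..<n}"
    then obtain i where "finite J" "i \<in> J" "i \<ge> n" by (auto simp: subset_iff not_less)
    thus "ldet m J = 0" using assms by (intro ldet_zero_row[of J i]) auto
  qed (auto dest: finite_subset)
  thus ?thesis by (simp add: ldet_kron_add)
qed

lemma tendsto_fdet:
  assumes dom: "dominated m u v"
    and lim: "\<And>i j. (\<lambda>n. a n i j) \<longlonglongrightarrow> m i j"
    and le: "\<And>n i j. cmod (a n i j) \<le> u i * v j"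
  shows "(\<lambda>n. fdet (a n)) \<longlonglongrightarrow> fdet m"
  unfolding fdet_def
proof (rule tendsto_infsum_dominated)
  show "(\<lambda>J. fact (card J) * (\<Prod>j\<in>J. u j * v j)) summable_on {J. finite J}"
    using dominated_weight_nonneg[OF dom] dominated_weight_summable[OF dom]
    by (rule fact_prod_summable_on)
  show "(\<lambda>n. ldet (a n) J) \<longlonglongrightarrow> ldet m J" for J
    unfolding ldet_def by (intro tendsto_intros lim)
  show "cmod (ldet (a n) J) \<le> fact (card J) * (\<Prod>j\<in>J. u j * v j)" if "J \<in> {J. finite J}" for n J
    using that le by (intro norm_ldet_le) auto
qed

text \<open>The matrices \<open>a n\<close> may vary with \<open>n\<close>, and the bound is asked
  inside the \<open>n \<times> n\<close> block. This admits the product of two blocks, whose inner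
  sum stops at \<open>n\<close>, in place of the block of a product.\<close>

lemma tendsto_ldet_section:
  assumes dom: "dominated m u v"
    and lim: "\<And>i j. (\<lambda>n. a n i j) \<longlonglongrightarrow> m i j"
    and le: "\<And>n i j. i < n \<Longrightarrow> j < n \<Longrightarrow> cmod (a n i j) \<le> u i * v j"
  shows "(\<lambda>n. ldet (\<lambda>i j. kron i j + a n i j) {..<n}) \<longlonglongrightarrow> fdet m"
proof -
  have uv: "0 \<le> u i * v j" for i j using dom by (simp add: dominated_def)
  have "(\<lambda>n. fdet (\<lambda>i j. if i < n \<and> j < n then a n i j else 0)) \<longlonglongrightarrow> fdet m"
  proof (rule tendsto_fdet[OF dom])
    fix i j
    have "\<forall>\<^sub>F n in sequentially. (if i < n \<and> j < n then a n i j else 0) = a n i j"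
      using eventually_gt_at_top[of "max i j"] by eventually_elim auto
    thus "(\<lambda>n. if i < n \<and> j < n then a n i j else 0) \<longlonglongrightarrow> m i j"
      using lim[of i j] by (simp add: tendsto_cong)
  qed (auto simp: le uv)
  moreover have "fdet (\<lambda>i j. if i < n \<and> j < n then a n i j else 0)
      = ldet (\<lambda>i j. kron i j + a n i j) {..<n}" for n
    by (subst fdet_finite_rows[where n = n]) (auto intro!: ldet_cong)
  ultimately show ?thesis by simp
qed

lemma ldet_mult:
  "ldet (\<lambda>i j. \<Sum>l<n. a i l * b l j) {..<n} = ldet a {..<n} * ldet b {..<n}"
proof -
  let ?A = "Matrix.mat n n (\<lambda>(i, j). a i j)" and ?B = "Matrix.mat n n (\<lambda>(i, j). b i j)"
  have "?A * ?B = Matrix.mat n n (\<lambda>(i, j). \<Sum>l<n. a i l * b l j)"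
    by (rule eq_matI) (auto simp: scalar_prod_def atLeast0LessThan)
  hence "Determinant.det (Matrix.mat n n (\<lambda>(i, j). \<Sum>l<n. a i l * b l j))
      = Determinant.det ?A * Determinant.det ?B"
    using det_mult[of ?A n ?B] by simp
  thus ?thesis by (simp add: det_mat_eq_ldet)
qed

text \<open>Both determinants are Schur complements in the block matrix with rows
  \<open>(1, A)\<close> and \<open>(- B, 1)\<close>, which is factored once with the unipotent
  \<open>?L\<close> on the right and once with \<open>?L\<close> on the left.\<close>

lemma det_one_add_mult_commute:
  fixes A B :: "'a :: idom mat"
  assumes A: "A \<in> carrier_mat n n" and B: "B \<in> carrier_mat n n"
  shows "Determinant.det (1\<^sub>m n + A * B) = Determinant.det (1\<^sub>m n + B * A)"
proof -
  let ?L = "four_block_mat (1\<^sub>m n) (0\<^sub>m n n) (- B) (1\<^sub>m n)"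
  have mB: "- B \<in> carrier_mat n n" using B by simp
  have "four_block_mat (1\<^sub>m n + A * B) A (0\<^sub>m n n) (1\<^sub>m n) * ?L
      = four_block_mat (1\<^sub>m n) A (- B) (1\<^sub>m n)"
    using A B by (subst mult_four_block_mat[of _ n n _ n _ n])
      (auto simp: add_uminus_minus_mat intro!: arg_cong2[where f="\<lambda>x y. four_block_mat x A y (1\<^sub>m n)"] eq_matI)
  moreover have "?L * four_block_mat (1\<^sub>m n) A (0\<^sub>m n n) (1\<^sub>m n + B * A)
      = four_block_mat (1\<^sub>m n) A (- B) (1\<^sub>m n)"
    using A B by (subst mult_four_block_mat[of _ n n _ n _ n])
      (auto intro!: arg_cong2[where f="\<lambda>x y. four_block_mat (1\<^sub>m n) x (- B) y"] eq_matI)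
  ultimately have "Determinant.det (four_block_mat (1\<^sub>m n + A * B) A (0\<^sub>m n n) (1\<^sub>m n)) * Determinant.det ?L =
      Determinant.det ?L * Determinant.det (four_block_mat (1\<^sub>m n) A (0\<^sub>m n n) (1\<^sub>m n + B * A))"
    using A B det_mult[of "four_block_mat (1\<^sub>m n + A * B) A (0\<^sub>m n n) (1\<^sub>m n)" "n + n" ?L]
      det_mult[of ?L "n + n" "four_block_mat (1\<^sub>m n) A (0\<^sub>m n n) (1\<^sub>m n + B * A)"] by simp
  moreover have "Determinant.det ?L = 1"
    using B by (subst det_four_block_mat_upper_right_zero[of _ n _ n]) auto
  ultimately show ?thesis
    using A B by (simp add: det_four_block_mat_lower_left_zero[of _ n _ n])
qed

lemma ldet_kron_add_mult_commute:
  "ldet (\<lambda>i j. kron i j + (\<Sum>l<n. a i l * b l j)) {..<n} =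
   ldet (\<lambda>i j. kron i j + (\<Sum>l<n. b i l * a l j)) {..<n}"
proof -
  have *: "1\<^sub>m n + Matrix.mat n n (\<lambda>(i, j). a i j) * Matrix.mat n n (\<lambda>(i, j). b i j)
      = Matrix.mat n n (\<lambda>(i, j). kron i j + (\<Sum>l<n. a i l * b l j))" for a b :: "nat \<Rightarrow> nat \<Rightarrow> complex"
    by (rule eq_matI) (auto simp: scalar_prod_def atLeast0LessThan)
  show ?thesis
    using det_one_add_mult_commute[of "Matrix.mat n n (\<lambda>(i, j). a i j)" n "Matrix.mat n n (\<lambda>(i, j). b i j)"]
    by (simp add: * det_mat_eq_ldet)
qed

lemma summable_mult_dominated:
  assumes "dominated a u v" "dominated b u' v'"
  shows "summable (\<lambda>l. cmod (a i l * b l j))"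
    and "(\<Sum>l. cmod (a i l * b l j)) \<le> u i * (\<Sum>l. v l * u' l) * v' j"
proof -
  have vu: "summable (\<lambda>l. v l * u' l)"
  proof -
    have "dominated (\<lambda>_ _. 0) v u'" using assms by (simp add: dominated_def)
    thus ?thesis by (rule dominated_weight_summable)
  qed
  have le: "cmod (a i l * b l j) \<le> (u i * v' j) * (v l * u' l)" for l
  proof -
    have "cmod (a i l * b l j) \<le> (u i * v l) * (u' l * v' j)"
      unfolding norm_mult using assms by (intro mult_mono) (auto simp: dominated_def)
    thus ?thesis by (simp add: mult_ac)
  qed
  show s: "summable (\<lambda>l. cmod (a i l * b l j))"
    by (rule summable_comparison_test'[OF summable_mult[OF vu]]) (use le in auto)
  have "(\<Sum>l. cmod (a i l * b l j)) \<le> (\<Sum>l. (u i * v' j) * (v l * u' l))"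
    by (intro suminf_le le s summable_mult vu)
  thus "(\<Sum>l. cmod (a i l * b l j)) \<le> u i * (\<Sum>l. v l * u' l) * v' j"
    using suminf_mult[OF vu, of "u i * v' j"] by (simp add: mult_ac)
qed

lemma summable_square_add:
  fixes x y :: "nat \<Rightarrow> real"
  assumes "summable (\<lambda>i. (x i)\<^sup>2)" "summable (\<lambda>i. (y i)\<^sup>2)"
  shows "summable (\<lambda>i. (x i + y i)\<^sup>2)"
  using square_summable_add[of "\<lambda>i. complex_of_real (x i)" "\<lambda>i. complex_of_real (y i)"] assms
  by (simp flip: of_real_add)

text \<open>The block of a product is not the product of the blocks. The product of the blocks of
  \<open>1 + a\<close> and \<open>1 + b\<close> has its inner sum cut at \<open>l < n\<close>; these
  truncated matrices converge to the full one under a common majorant, so finite multiplicativity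
  passes to the limit.\<close>

lemma fdet_mult:
  assumes a: "dominated a u v" and b: "dominated b u' v'"
  shows "fdet (\<lambda>i j. a i j + b i j + (\<Sum>l. a i l * b l j)) = fdet a * fdet b"
proof -
  define \<sigma> where "\<sigma> = (\<Sum>l. v l * u' l)"
  define m where "m = (\<lambda>i j. a i j + b i j + (\<Sum>l. a i l * b l j))"
  \<comment> \<open>\<open>U i * V j\<close> is a single product that dominates the three bounds
    \<open>u i * v j\<close>, \<open>u' i * v' j\<close> and \<open>\<sigma> * u i * v' j\<close>
    together.\<close>
  define U where "U = (\<lambda>i. (1 + \<sigma>) * u i + u' i)"
  define V where "V = (\<lambda>i. v i + v' i)"
  note sm = summable_mult_dominated[OF a b]
  have \<sigma>0: "\<sigma> \<ge> 0"
    unfolding \<sigma>_def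
  proof (rule suminf_nonneg)
    have "dominated (\<lambda>_ _. 0) v u'" using a b by (simp add: dominated_def)
    thus "summable (\<lambda>l. v l * u' l)" by (rule dominated_weight_summable)
  qed (use a b in \<open>auto simp: dominated_def\<close>)
  have le: "cmod (a i j + b i j + (\<Sum>l<n. a i l * b l j)) \<le> U i * V j" for i j n
  proof -
    have "cmod (\<Sum>l<n. a i l * b l j) \<le> (\<Sum>l<n. cmod (a i l * b l j))" by (rule norm_sum)
    also have "\<dots> \<le> (\<Sum>l. cmod (a i l * b l j))" by (intro sum_le_suminf sm) auto
    also have "\<dots> \<le> u i * \<sigma> * v' j" using sm(2) by (simp add: \<sigma>_def)
    finally have "cmod (a i j + b i j + (\<Sum>l<n. a i l * b l j)) \<le> u i * v j + u' i * v' j + u i * \<sigma> * v' j"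
      using a b norm_triangle_ineq[of "a i j + b i j" "\<Sum>l<n. a i l * b l j"] norm_triangle_ineq[of "a i j" "b i j"]
      unfolding dominated_def by smt
    also have "\<dots> \<le> U i * V j"
    proof -
      have "0 \<le> u i" "0 \<le> u' i" "0 \<le> v j" "0 \<le> v' j" using a b by (auto simp: dominated_def)
      hence "0 \<le> \<sigma> * u i * v j" "0 \<le> u i * v' j" "0 \<le> u' i * v j" using \<sigma>0 by auto
      thus ?thesis by (simp add: U_def V_def algebra_simps)
    qed
    finally show ?thesis .
  qed
  have lim0: "(\<lambda>n. \<Sum>l<n. a i l * b l j) \<longlonglongrightarrow> (\<Sum>l. a i l * b l j)" for i j
    by (intro summable_LIMSEQ summable_norm_cancel[OF sm(1)])
  have lim: "(\<lambda>n. a i j + b i j + (\<Sum>l<n. a i l * b l j)) \<longlonglongrightarrow> m i j" for i j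
    unfolding m_def by (intro tendsto_intros lim0)
  have dm: "dominated m U V"
    unfolding dominated_def
  proof (intro conjI allI)
    show "summable (\<lambda>i. (U i)\<^sup>2)" unfolding U_def
      using a b by (intro summable_square_add) (auto simp: dominated_def power_mult_distrib intro!: summable_mult)
    show "summable (\<lambda>i. (V i)\<^sup>2)" unfolding V_def
      using a b by (intro summable_square_add) (auto simp: dominated_def)
    show "0 \<le> U i" "0 \<le> V i" for i using a b \<sigma>0 by (auto simp: U_def V_def dominated_def)
    show "cmod (m i j) \<le> U i * V j" for i j
      by (rule LIMSEQ_le_const2[OF tendsto_norm[OF lim]]) (auto intro: le)
  qed
  have "(\<lambda>n. ldet (\<lambda>i j. kron i j + (a i j + b i j + (\<Sum>l<n. a i l * b l j))) {..<n}) \<longlonglongrightarrow> fdet m"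
    by (rule tendsto_ldet_section[OF dm lim le])
  moreover have "ldet (\<lambda>i j. kron i j + (a i j + b i j + (\<Sum>l<n. a i l * b l j))) {..<n}
     = ldet (\<lambda>i j. kron i j + a i j) {..<n} * ldet (\<lambda>i j. kron i j + b i j) {..<n}" for n
    unfolding ldet_mult[symmetric]
  proof (rule ldet_cong)
    fix i j assume ij: "i \<in> {..<n}" "j \<in> {..<n}"
    have "(\<Sum>l<n. (kron i l + a i l) * (kron l j + b l j)) =
       (\<Sum>l<n. (if l = i then kron i j + b i j else 0) + ((if l = j then a i j else 0) + a i l * b l j))"
      by (intro sum.cong) (auto simp: algebra_simps)
    also have "\<dots> = kron i j + (a i j + b i j + (\<Sum>l<n. a i l * b l j))"
      using ij by (simp add: sum.distrib)
    finally show "kron i j + (a i j + b i j + (\<Sum>l<n. a i l * b l j)) = 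
       (\<Sum>l<n. (kron i l + a i l) * (kron l j + b l j))" by simp
  qed
  moreover have "(\<lambda>n. ldet (\<lambda>i j. kron i j + a i j) {..<n} * ldet (\<lambda>i j. kron i j + b i j) {..<n})
      \<longlonglongrightarrow> fdet a * fdet b"
    using a b by (intro tendsto_mult tendsto_ldet_section[OF a] tendsto_ldet_section[OF b])
      (auto simp: dominated_def)
  ultimately show ?thesis using LIMSEQ_unique m_def by auto
qed

section \<open>Hilbert-Schmidt factors and cyclicity of determinant and trace\<close>

definition hilbert_schmidt :: "(nat \<Rightarrow> nat \<Rightarrow> complex) \<Rightarrow> bool" where
  "hilbert_schmidt c \<longleftrightarrow> (\<lambda>(i, j). (cmod (c i j))\<^sup>2) summable_on UNIV"

lemma hilbert_schmidt_transpose: "hilbert_schmidt c \<Longrightarrow> hilbert_schmidt (\<lambda>i j. c j i)"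
  unfolding hilbert_schmidt_def
  using summable_on_swap[of "\<lambda>(i, j). (cmod (c i j))\<^sup>2" UNIV UNIV] by simp

lemma hilbert_schmidt_rows:
  assumes "hilbert_schmidt c"
  shows "summable (\<lambda>j. (cmod (c i j))\<^sup>2)" and "summable (\<lambda>i. \<Sum>j. (cmod (c i j))\<^sup>2)"
proof -
  have s: "(\<lambda>(i, j). (cmod (c i j))\<^sup>2) summable_on UNIV \<times> UNIV"
    using assms by (simp add: hilbert_schmidt_def)
  have row: "(\<lambda>j. (cmod (c i j))\<^sup>2) summable_on UNIV" for i
    using summable_on_SigmaD1[of "\<lambda>i j. (cmod (c i j))\<^sup>2" UNIV "\<lambda>_. UNIV" i] s by simp
  thus "summable (\<lambda>j. (cmod (c i j))\<^sup>2)" by (rule summable_on_imp_summable)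
  have "(\<lambda>i. infsum (\<lambda>j. (cmod (c i j))\<^sup>2) UNIV) summable_on UNIV"
    using summable_on_Sigma_banach[of "\<lambda>i j. (cmod (c i j))\<^sup>2" UNIV "\<lambda>_. UNIV"] s by simp
  moreover have "infsum (\<lambda>j. (cmod (c i j))\<^sup>2) UNIV = (\<Sum>j. (cmod (c i j))\<^sup>2)" for i
    using has_sum_imp_sums[OF has_sum_infsum[OF row]] by (simp add: sums_iff)
  ultimately show "summable (\<lambda>i. \<Sum>j. (cmod (c i j))\<^sup>2)"
    by (simp add: summable_on_imp_summable)
qed

lemma hilbert_schmidtI:
  assumes "\<And>i. summable (\<lambda>j. (cmod (c i j))\<^sup>2)" and "summable (\<lambda>i. \<Sum>j. (cmod (c i j))\<^sup>2)"
  shows "hilbert_schmidt c"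
proof -
  have "(\<lambda>(i, j). (cmod (c i j))\<^sup>2) summable_on (SIGMA i:UNIV. UNIV)"
  proof (rule summable_on_SigmaI)
    show "((\<lambda>j. case (i, j) of (i, j) \<Rightarrow> (cmod (c i j))\<^sup>2) has_sum (\<Sum>j. (cmod (c i j))\<^sup>2)) UNIV" for i
      using assms(1) by (auto intro!: sums_nonneg_imp_has_sum summable_sums)
    show "(\<lambda>i. \<Sum>j. (cmod (c i j))\<^sup>2) summable_on UNIV"
      using assms by (intro summable_nonneg_imp_summable_on suminf_nonneg) auto
  qed auto
  thus ?thesis by (simp add: hilbert_schmidt_def)
qed

text \<open>\<open>u i\<close> and \<open>v j\<close> are the Euclidean norms of row
  \<open>i\<close> of \<open>c\<close> and of column \<open>j\<close> of \<open>r\<close>, so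
  Cauchy-Schwarz gives the majorant. The bound on partial sums is the one that
  \<open>tendsto_ldet_section\<close> asks for.\<close>

lemma hilbert_schmidt_mult:
  assumes c: "hilbert_schmidt c" and r: "hilbert_schmidt r"
  defines "u \<equiv> \<lambda>i. sqrt (\<Sum>l. (cmod (c i l))\<^sup>2)" and "v \<equiv> \<lambda>j. sqrt (\<Sum>l. (cmod (r l j))\<^sup>2)"
  shows "dominated (\<lambda>i j. \<Sum>l. c i l * r l j) u v"
    and "summable (\<lambda>l. cmod (c i l * r l j))"
    and "cmod (\<Sum>l<n. c i l * r l j) \<le> u i * v j"
proof -
  note rc = hilbert_schmidt_rows[OF c] and rr = hilbert_schmidt_rows[OF hilbert_schmidt_transpose[OF r]]
  note cs = Cauchy_Schwarz_series[OF rc(1) rr(1)]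
  show s: "summable (\<lambda>l. cmod (c i l * r l j))" by (rule cs)
  have "cmod (\<Sum>l<n. c i l * r l j) \<le> (\<Sum>l<n. cmod (c i l * r l j))" by (rule norm_sum)
  also have "\<dots> \<le> (\<Sum>l. cmod (c i l * r l j))" by (rule sum_le_suminf[OF s]) auto
  also have "\<dots> \<le> u i * v j" unfolding u_def v_def by (rule cs)
  finally show "cmod (\<Sum>l<n. c i l * r l j) \<le> u i * v j" .
  show "dominated (\<lambda>i j. \<Sum>l. c i l * r l j) u v"
    unfolding dominated_def u_def v_def
    using rc rr cs(3) by (auto intro!: suminf_nonneg simp: suminf_nonneg)
qed

text \<open>With the inner sum cut at the block size this is the identity for square matrices; both
  sides converge under their Hilbert-Schmidt majorants.\<close>

lemma fdet_mult_commute: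
  assumes c: "hilbert_schmidt c" and r: "hilbert_schmidt r"
  shows "fdet (\<lambda>i j. \<Sum>l. c i l * r l j) = fdet (\<lambda>i j. \<Sum>l. r i l * c l j)"
proof -
  note cr = hilbert_schmidt_mult[OF c r] and rc = hilbert_schmidt_mult[OF r c]
  have "(\<lambda>n. ldet (\<lambda>i j. kron i j + (\<Sum>l<n. c i l * r l j)) {..<n}) \<longlonglongrightarrow> fdet (\<lambda>i j. \<Sum>l. c i l * r l j)"
    by (rule tendsto_ldet_section[OF cr(1) _ cr(3)])
      (intro summable_LIMSEQ summable_norm_cancel[OF cr(2)])
  moreover have "(\<lambda>n. ldet (\<lambda>i j. kron i j + (\<Sum>l<n. r i l * c l j)) {..<n}) \<longlonglongrightarrow> fdet (\<lambda>i j. \<Sum>l. r i l * c l j)"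
    by (rule tendsto_ldet_section[OF rc(1) _ rc(3)])
      (intro summable_LIMSEQ summable_norm_cancel[OF rc(2)])
  ultimately show ?thesis
    unfolding ldet_kron_add_mult_commute[of c r] by (rule LIMSEQ_unique)
qed

lemma trace_mult_commute:
  assumes c: "hilbert_schmidt c" and r: "hilbert_schmidt r"
  shows "(\<Sum>i. \<Sum>l. c i l * r l i) = (\<Sum>i. \<Sum>l. r i l * c l i)"
proof -
  have s: "(\<lambda>(i, l). c i l * r l i) summable_on UNIV \<times> UNIV" if "hilbert_schmidt c" "hilbert_schmidt r" for c r
  proof (rule abs_summable_summable[OF summable_on_comparison_test])
    have r': "hilbert_schmidt (\<lambda>i j. r j i)" by (rule hilbert_schmidt_transpose) fact
    have "(\<lambda>x. (\<lambda>(i, l). (cmod (c i l))\<^sup>2) x + (\<lambda>(i, l). (cmod (r l i))\<^sup>2) x) summable_on UNIV \<times> UNIV"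
      using that(1) r' unfolding hilbert_schmidt_def by (intro summable_on_add) auto
    thus "(\<lambda>(i, l). (cmod (c i l))\<^sup>2 + (cmod (r l i))\<^sup>2) summable_on UNIV \<times> UNIV"
      by (simp add: case_prod_unfold)
    show "norm (case x of (i, l) \<Rightarrow> c i l * r l i) \<le> (case x of (i, l) \<Rightarrow> (cmod (c i l))\<^sup>2 + (cmod (r l i))\<^sup>2)" for x
    proof -
      have "x * y \<le> x\<^sup>2 + y\<^sup>2" if "x \<ge> 0" "y \<ge> 0" for x y :: real
        using sum_squares_bound[of x y] mult_nonneg_nonneg[OF that] by linarith
      thus ?thesis by (cases x) (simp add: norm_mult)
    qed
  qed auto
  have eq: "(\<Sum>i. \<Sum>l. c i l * r l i) = (\<Sum>\<^sub>\<infinity>i. \<Sum>\<^sub>\<infinity>l. c i l * r l i)" if "hilbert_schmidt c" "hilbert_schmidt r" for c r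
  proof -
    have sum1: "(\<lambda>l. c i l * r l i) summable_on UNIV" for i
      using summable_on_SigmaD1[OF s[OF that], of i] by simp
    have "(\<lambda>i. \<Sum>\<^sub>\<infinity>l. c i l * r l i) summable_on UNIV"
      using summable_on_Sigma_banach[OF s[OF that]] by simp
    from has_sum_imp_sums[OF has_sum_infsum[OF this]] 
    have "(\<Sum>i. \<Sum>\<^sub>\<infinity>l. c i l * r l i) = (\<Sum>\<^sub>\<infinity>i. \<Sum>\<^sub>\<infinity>l. c i l * r l i)" by (simp add: sums_iff)
    moreover have "(\<Sum>\<^sub>\<infinity>l. c i l * r l i) = (\<Sum>l. c i l * r l i)" for i
      using has_sum_imp_sums[OF has_sum_infsum[OF sum1]] by (simp add: sums_iff)
    ultimately show ?thesis by simp
  qed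
  have "(\<Sum>\<^sub>\<infinity>i. \<Sum>\<^sub>\<infinity>l. c i l * r l i) = (\<Sum>\<^sub>\<infinity>l. \<Sum>\<^sub>\<infinity>i. c i l * r l i)"
    by (rule infsum_swap_banach) (rule s[OF c r])
  thus ?thesis unfolding eq[OF c r] eq[OF r c] by (simp only: mult.commute[of "r _ _"])
qed

text \<open>Minors of size 0 and 1 contribute 1 and the trace. Those of size \<open>k\<close>
  contribute at most \<open>s ^ k\<close> in total, since \<open>fact k\<close> cancels against the
  elementary symmetric bound, and the geometric tail from \<open>k = 2\<close> on gives the right
  side.\<close>

lemma norm_fdet_minus_le:
  assumes dom: "dominated m u v" and s: "(\<Sum>j. u j * v j) \<le> s" "s < 1"
  shows "cmod (fdet m - 1 - (\<Sum>j. m j j)) \<le> s\<^sup>2 / (1 - s)"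
proof -
  have w0: "0 \<le> u j * v j" for j by (rule dominated_weight_nonneg[OF dom])
  have ws: "summable (\<lambda>j. u j * v j)" by (rule dominated_weight_summable[OF dom])
  have le: "cmod (m i j) \<le> u i * v j" for i j using dom by (simp add: dominated_def)
  have s0: "0 \<le> s" using suminf_nonneg[OF ws w0] s by linarith
  have sm: "summable (\<lambda>j. m j j)"
    by (rule summable_comparison_test'[OF ws]) (auto simp: le)
  have fin: "cmod (ldet (\<lambda>i j. kron i j + m i j) {..<n} - 1 - (\<Sum>j<n. m j j)) \<le> s\<^sup>2 / (1 - s)" if n: "n \<ge> 1" for n
  proof -
    define S where "S k = (\<Sum>J | J \<subseteq> {..<n} \<and> card J = k. ldet m J)" for k
    have "ldet (\<lambda>i j. kron i j + m i j) {..<n} = (\<Sum>k\<le>n. S k)"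
      by (simp add: ldet_kron_add sum_Pow_card S_def)
    also have "{..n} = {0, 1} \<union> {2..n}" using n by auto
    also have "sum S ({0, 1} \<union> {2..n}) = S 0 + S 1 + sum S {2..n}"
      by (subst sum.union_disjoint) auto
    also have "S 0 = 1"
    proof -
      have "{J. J \<subseteq> {..<n} \<and> card J = 0} = {{}}" by (auto dest: finite_subset)
      thus ?thesis by (simp add: S_def ldet_def)
    qed
    also have "S 1 = (\<Sum>j<n. m j j)"
    proof -
      have "{J. J \<subseteq> {..<n} \<and> card J = 1} = (\<lambda>j. {j}) ` {..<n}" by (auto simp: card_1_singleton_iff)
      thus ?thesis by (simp add: S_def ldet_def sum.reindex)
    qed
    finally have "ldet (\<lambda>i j. kron i j + m i j) {..<n} - 1 - (\<Sum>j<n. m j j) = sum S {2..n}" by simp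
    moreover have "cmod (sum S {2..n}) \<le> (\<Sum>k=2..n. s ^ k)"
    proof (rule sum_norm_le)
      fix k
      have "cmod (S k) \<le> (\<Sum>J | J \<subseteq> {..<n} \<and> card J = k. fact k * (\<Prod>j\<in>J. u j * v j))"
        unfolding S_def
      proof (rule sum_norm_le)
        fix J assume "J \<in> {J. J \<subseteq> {..<n} \<and> card J = k}"
        thus "cmod (ldet m J) \<le> fact k * (\<Prod>j\<in>J. u j * v j)"
          using norm_ldet_le[OF _ le, of J] by (auto dest: finite_subset)
      qed
      also have "\<dots> \<le> (\<Sum>j<n. u j * v j) ^ k"
        unfolding sum_distrib_left[symmetric] by (rule elementary_symmetric_le) (auto simp: w0)
      also have "\<dots> \<le> s ^ k"
        using sum_le_suminf[OF ws, of "{..<n}"] w0 s by (intro power_mono sum_nonneg) auto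
      finally show "cmod (S k) \<le> s ^ k" .
    qed
    moreover have "(\<Sum>k=2..n. s ^ k) \<le> s\<^sup>2 / (1 - s)"
    proof -
      have "(\<Sum>k=2..n. s ^ k) \<le> (\<Sum>k<Suc n. s ^ (k + 2))"
      proof -
        have "(\<Sum>k<Suc n. s ^ (k + 2)) = (\<Sum>k\<in>(\<lambda>k. k + 2) ` {..<Suc n}. s ^ k)"
          by (subst sum.reindex) (auto simp: inj_on_def)
        moreover have "(\<Sum>k=2..n. s ^ k) \<le> (\<Sum>k\<in>(\<lambda>k. k + 2) ` {..<Suc n}. s ^ k)"
        proof (rule sum_mono2)
          show "{2..n} \<subseteq> (\<lambda>k. k + 2) ` {..<Suc n}"
          proof
            fix k assume "k \<in> {2..n}"
            hence "k = (k - 2) + 2" "k - 2 \<in> {..<Suc n}" by auto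
            thus "k \<in> (\<lambda>k. k + 2) ` {..<Suc n}" by blast
          qed
        qed (use s0 in auto)
        ultimately show ?thesis by simp
      qed
      also have "\<dots> \<le> (\<Sum>k. s ^ (k + 2))"
        using s0 s by (intro sum_le_suminf) (auto simp: summable_geometric power_add intro!: summable_mult summable_mult2)
      also have "\<dots> = s\<^sup>2 / (1 - s)"
        using s0 s suminf_mult2[of "\<lambda>k. s ^ k" "s\<^sup>2"]
        unfolding power_add by (simp add: suminf_geometric summable_geometric)
      finally show ?thesis .
    qed
    ultimately show ?thesis by (metis order.trans)
  qed
  have "(\<lambda>n. ldet (\<lambda>i j. kron i j + m i j) {..<n} - 1 - (\<Sum>j<n. m j j)) \<longlonglongrightarrow> fdet m - 1 - (\<Sum>j. m j j)"
    by (rule tendsto_diff[OF tendsto_diff[OF tendsto_ldet_section[OF dom tendsto_const] tendsto_const]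
        summable_LIMSEQ[OF sm]]) (rule le)
  from LIMSEQ_le_const2[OF tendsto_norm[OF this]] show ?thesis using fin by blast
qed

section \<open>The algebra of bounded operators on the sequence space\<close>

lemmas seq_simps [simp] = zero_ell2.rep_eq plus_ell2.rep_eq uminus_ell2.rep_eq minus_ell2.rep_eq
  scaleR_ell2.rep_eq scaleC.rep_eq

lemma ell2_eqI: "(\<And>n. seq x n = seq y n) \<Longrightarrow> x = y"
  by (metis ext seq_inject)

lemma seq_sum [simp]: "seq (sum f A) n = (\<Sum>i\<in>A. seq (f i) n)"
  by (induction A rule: infinite_finite_induct) auto

lemma norm_ell2_square: "(norm x)\<^sup>2 = (\<Sum>n. (cmod (seq x n))\<^sup>2)"
  by (simp add: norm_ell2_def suminf_nonneg summable_seq)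

lemma sum_seq_le: "finite A \<Longrightarrow> (\<Sum>n\<in>A. (cmod (seq x n))\<^sup>2) \<le> (norm x)\<^sup>2"
  unfolding norm_ell2_square by (rule sum_le_suminf[OF summable_seq]) auto

lemma norm_seq_le: "cmod (seq x n) \<le> norm x"
  using sum_seq_le[of "{n}" x] by (simp add: abs_le_square_iff[symmetric])

lemma bounded_linear_seq: "bounded_linear (\<lambda>x. seq x n)"
  by (rule bounded_linear_intro[of _ 1]) (auto simp: norm_seq_le)

lemma ell2_bounded_sums:
  assumes "C \<ge> 0" "\<And>N. (\<Sum>n<N. (cmod (f n))\<^sup>2) \<le> C\<^sup>2"
  shows "summable (\<lambda>n. (cmod (f n))\<^sup>2)" and "seq (Abs_ell2 f) = f" and "norm (Abs_ell2 f) \<le> C"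
proof -
  show s: "summable (\<lambda>n. (cmod (f n))\<^sup>2)" by (rule summableI_nonneg_bounded[OF _ assms(2)]) auto
  thus eq: "seq (Abs_ell2 f) = f" by (simp add: Abs_ell2_inverse)
  have "(norm (Abs_ell2 f))\<^sup>2 \<le> C\<^sup>2"
    unfolding norm_ell2_square eq by (rule suminf_le_const[OF s assms(2)])
  thus "norm (Abs_ell2 f) \<le> C" using assms(1) by (rule power2_le_imp_le)
qed

lemma norm_scaleC: "norm (scaleC c x) = cmod c * norm x"
proof -
  have "(norm (scaleC c x))\<^sup>2 = (cmod c * norm x)\<^sup>2"
    unfolding power_mult_distrib norm_ell2_square
    using suminf_mult[OF summable_seq[of x], of "(cmod c)\<^sup>2"] by (simp add: norm_mult power_mult_distrib)
  thus ?thesis by (simp add: power2_eq_iff_nonneg)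
qed

lemma scaleC_add_right: "scaleC c (x + y) = scaleC c x + scaleC c y"
  and scaleC_add_left: "scaleC (c + d) x = scaleC c x + scaleC d x"
  and scaleC_scaleC: "scaleC c (scaleC d x) = scaleC (c * d) x"
  and scaleC_diff_right: "scaleC c (x - y) = scaleC c x - scaleC c y"
  and scaleC_scaleR: "scaleC c (r *\<^sub>R x) = r *\<^sub>R scaleC c x"
  and scaleC_minus_right: "scaleC c (- x) = - scaleC c x"
  and scaleC_zero_right: "scaleC c 0 = 0"
  and scaleC_zero_left: "scaleC 0 x = 0"
  and scaleC_one: "scaleC 1 x = x"
  and scaleC_of_real: "scaleC (of_real r) x = r *\<^sub>R x"
  by (rule ell2_eqI; simp add: algebra_simps scaleR_conv_of_real)+

lemma bounded_linear_scaleC_right: "bounded_linear (scaleC c)"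
  by (rule bounded_linear_intro[of _ "cmod c"]) (auto simp: scaleC_add_right scaleC_scaleR norm_scaleC)

lemma seq_basis_vec: "seq (basis_vec k) n = (if n = k then 1 else 0)"
proof -
  have "summable (\<lambda>n. (cmod (if n = k then 1 else 0))\<^sup>2)"
    by (rule summable_finite[of "{k}"]) auto
  thus ?thesis unfolding basis_vec_def by (subst Abs_ell2_inverse) auto
qed

lemma norm_basis_vec [simp]: "norm (basis_vec k) = 1"
proof -
  have "(norm (basis_vec k))\<^sup>2 = (\<Sum>n. if n = k then 1 else 0)"
    unfolding norm_ell2_square by (intro arg_cong[of _ _ suminf]) (auto simp: seq_basis_vec)
  also have "\<dots> = 1" by (subst suminf_finite[of "{k}"]) auto
  finally show ?thesis by (simp add: power2_eq_1_iff) (smt (verit) norm_ge_zero)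
qed

lemma basis_expansion: "(\<lambda>k. scaleC (seq x k) (basis_vec k)) sums x"
proof -
  have "(\<lambda>N. (norm (x - (\<Sum>k<N. scaleC (seq x k) (basis_vec k))))\<^sup>2) \<longlonglongrightarrow> 0"
  proof -
    have eq: "(norm (x - (\<Sum>k<N. scaleC (seq x k) (basis_vec k))))\<^sup>2
        = (norm x)\<^sup>2 - (\<Sum>k<N. (cmod (seq x k))\<^sup>2)" for N
    proof -
      have "(norm (x - (\<Sum>k<N. scaleC (seq x k) (basis_vec k))))\<^sup>2 = (\<Sum>n. if n < N then 0 else (cmod (seq x n))\<^sup>2)"
        unfolding norm_ell2_square
      proof (intro arg_cong[of _ _ suminf] ext)
        fix n
        have "(\<Sum>k<N. seq x k * seq (basis_vec k) n) = (\<Sum>k<N. if k = n then seq x n else 0)"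
          by (intro sum.cong) (auto simp: seq_basis_vec)
        also have "\<dots> = (if n < N then seq x n else 0)" by simp
        finally show "(cmod (seq (x - (\<Sum>k<N. scaleC (seq x k) (basis_vec k))) n))\<^sup>2
            = (if n < N then 0 else (cmod (seq x n))\<^sup>2)" by simp
      qed
      also have "\<dots> = (\<Sum>n. (cmod (seq x n))\<^sup>2 - (if n < N then (cmod (seq x n))\<^sup>2 else 0))"
        by (intro arg_cong[of _ _ suminf] ext) auto
      also have "\<dots> = (\<Sum>n. (cmod (seq x n))\<^sup>2) - (\<Sum>n. if n < N then (cmod (seq x n))\<^sup>2 else 0)"
        by (intro suminf_diff[symmetric] summable_seq summable_finite[of "{..<N}"]) auto
      also have "(\<Sum>n. if n < N then (cmod (seq x n))\<^sup>2 else 0) = (\<Sum>k<N. (cmod (seq x k))\<^sup>2)"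
        by (subst suminf_finite[of "{..<N}"]) auto
      finally show ?thesis by (simp add: norm_ell2_square)
    qed
    have "(\<lambda>N. (norm x)\<^sup>2 - (\<Sum>k<N. (cmod (seq x k))\<^sup>2)) \<longlonglongrightarrow> (norm x)\<^sup>2 - (norm x)\<^sup>2"
      by (rule tendsto_diff[OF tendsto_const])
        (use summable_LIMSEQ[OF summable_seq[of x]] in \<open>simp add: norm_ell2_square\<close>)
    thus ?thesis by (simp add: eq)
  qed
  hence "(\<lambda>N. norm (x - (\<Sum>k<N. scaleC (seq x k) (basis_vec k)))) \<longlonglongrightarrow> 0"
    using tendsto_real_sqrt by fastforce
  hence "(\<lambda>N. x - (\<Sum>k<N. scaleC (seq x k) (basis_vec k))) \<longlonglongrightarrow> 0" by (rule tendsto_norm_zero_cancel)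
  hence "(\<lambda>N. x - (x - (\<Sum>k<N. scaleC (seq x k) (basis_vec k)))) \<longlonglongrightarrow> x - 0"
    by (intro tendsto_diff tendsto_const)
  thus ?thesis by (simp add: sums_def)
qed

text \<open>Completeness makes operator norm limits exist, and with them the exponential series. The
  limit is taken coordinatewise; the Cauchy bound survives in every partial sum of squares and hence
  in the norm.\<close>

instance ell2 :: banach
proof
  fix X :: "nat \<Rightarrow> ell2" assume X: "Cauchy X"
  define y where "y j = lim (\<lambda>n. seq (X n) j)" for j
  have y: "(\<lambda>n. seq (X n) j) \<longlonglongrightarrow> y j" for j
    using bounded_linear.Cauchy[OF bounded_linear_seq[of j] X]
    by (simp add: y_def Cauchy_convergent_iff convergent_LIMSEQ_iff)
  have le: "(\<Sum>j<N. (cmod (seq (X m) j - y j))\<^sup>2) \<le> e\<^sup>2"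
    if e: "e > 0" "\<And>m n. m \<ge> M \<Longrightarrow> n \<ge> M \<Longrightarrow> norm (X m - X n) < e" and m: "m \<ge> M" for e M m N
  proof (rule LIMSEQ_le_const2)
    show "(\<lambda>n. \<Sum>j<N. (cmod (seq (X m) j - seq (X n) j))\<^sup>2) \<longlonglongrightarrow> (\<Sum>j<N. (cmod (seq (X m) j - y j))\<^sup>2)"
      by (intro tendsto_intros y)
    have "(\<Sum>j<N. (cmod (seq (X m) j - seq (X n) j))\<^sup>2) \<le> e\<^sup>2" if "n \<ge> M" for n
    proof -
      have "(\<Sum>j<N. (cmod (seq (X m) j - seq (X n) j))\<^sup>2) \<le> (norm (X m - X n))\<^sup>2"
        using sum_seq_le[of "{..<N}" "X m - X n"] by simp
      also have "\<dots> \<le> e\<^sup>2" using e(2)[OF m that] by (intro power_mono) auto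
      finally show ?thesis .
    qed
    thus "\<exists>K. \<forall>n\<ge>K. (\<Sum>j<N. (cmod (seq (X m) j - seq (X n) j))\<^sup>2) \<le> e\<^sup>2" by blast
  qed
  obtain M where M: "\<And>m n. m \<ge> M \<Longrightarrow> n \<ge> M \<Longrightarrow> norm (X m - X n) < 1"
    using X[unfolded Cauchy_iff, rule_format, of 1] by auto
  have "summable (\<lambda>j. (cmod (seq (X M) j - y j))\<^sup>2)"
    by (rule ell2_bounded_sums(1)[of 1]) (use le[OF _ M, of M] in auto)
  hence "summable (\<lambda>j. (cmod (seq (X M) j + - (seq (X M) j - y j)))\<^sup>2)"
    by (intro square_summable_add summable_seq) (simp add: norm_minus_commute)
  hence sy: "seq (Abs_ell2 y) = y" by (simp add: Abs_ell2_inverse)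
  have "X \<longlonglongrightarrow> Abs_ell2 y"
  proof (rule LIMSEQ_I)
    fix r :: real assume r: "r > 0"
    obtain M where M: "\<And>m n. m \<ge> M \<Longrightarrow> n \<ge> M \<Longrightarrow> norm (X m - X n) < r / 2"
      using X[unfolded Cauchy_iff, rule_format, of "r / 2"] r by auto
    have "norm (X m - Abs_ell2 y) < r" if "m \<ge> M" for m
    proof -
      have "norm (Abs_ell2 (seq (X m - Abs_ell2 y))) \<le> r / 2"
        by (rule ell2_bounded_sums(3)) (use le[OF _ M that] r sy in auto)
      thus ?thesis unfolding seq_inverse using r by simp
    qed
    thus "\<exists>M. \<forall>m\<ge>M. norm (X m - Abs_ell2 y) < r" by blast
  qed
  thus "convergent X" by (rule convergentI)
qed

section \<open>Complex-linear operators as a Banach algebra\<close>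

lemma complex_linear_zero: "complex_linear 0"
  and complex_linear_id: "complex_linear id_blinfun"
  and complex_linear_add: "complex_linear A \<Longrightarrow> complex_linear B \<Longrightarrow> complex_linear (A + B)"
  and complex_linear_diff: "complex_linear A \<Longrightarrow> complex_linear B \<Longrightarrow> complex_linear (A - B)"
  and complex_linear_uminus: "complex_linear A \<Longrightarrow> complex_linear (- A)"
  and complex_linear_scaleR: "complex_linear A \<Longrightarrow> complex_linear (r *\<^sub>R A)"
  and complex_linear_compose: "complex_linear A \<Longrightarrow> complex_linear B \<Longrightarrow> complex_linear (A o\<^sub>L B)"
  by (auto simp: complex_linear_def blinfun.add_left blinfun.diff_left blinfun.minus_left blinfun.scaleR_left
    scaleC_add_right scaleC_diff_right scaleC_minus_right scaleC_scaleR scaleC_zero_right)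

text \<open>A type of its own lets the library's \<open>exp\<close>, powers and series apply to
  operators, with composition as multiplication. The class structure is that of a real algebra;
  complex scalars act through \<open>scaleC\<close> on vectors.\<close>

typedef clop = "{A. complex_linear A}"
  morphisms blf Abs_clop
  by (rule exI[of _ 0]) (simp add: complex_linear_zero)

setup_lifting type_definition_clop

lemma complex_linear_blf: "complex_linear (blf A)"
  using blf[of A] by simp

instantiation clop :: real_normed_algebra_1
begin

lift_definition zero_clop :: clop is 0 by (rule complex_linear_zero)
lift_definition one_clop :: clop is id_blinfun by (rule complex_linear_id)
lift_definition plus_clop :: "clop \<Rightarrow> clop \<Rightarrow> clop" is "(+)" by (rule complex_linear_add)
lift_definition minus_clop :: "clop \<Rightarrow> clop \<Rightarrow> clop" is "(-)" by (rule complex_linear_diff)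
lift_definition uminus_clop :: "clop \<Rightarrow> clop" is uminus by (rule complex_linear_uminus)
lift_definition times_clop :: "clop \<Rightarrow> clop \<Rightarrow> clop" is "(o\<^sub>L)" by (rule complex_linear_compose)
lift_definition scaleR_clop :: "real \<Rightarrow> clop \<Rightarrow> clop" is scaleR by (rule complex_linear_scaleR)
lift_definition norm_clop :: "clop \<Rightarrow> real" is norm .

definition dist_clop :: "clop \<Rightarrow> clop \<Rightarrow> real" where
  "dist_clop A B = norm (A - B)"
definition sgn_clop :: "clop \<Rightarrow> clop" where
  "sgn_clop A = inverse (norm A) *\<^sub>R A"
definition uniformity_clop :: "(clop \<times> clop) filter" where
  "uniformity_clop = (INF e\<in>{0 <..}. principal {(A, B). dist A B < e})"
definition open_clop :: "clop set \<Rightarrow> bool" where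
  "open_clop U \<longleftrightarrow> (\<forall>A\<in>U. eventually (\<lambda>(A', B). A' = A \<longrightarrow> B \<in> U) uniformity)"

instance
proof
  fix A B C :: clop and r s :: real
  show "A + B + C = A + (B + C)" by transfer (simp add: add.assoc)
  show "A + B = B + A" by transfer (simp add: add.commute)
  show "0 + A = A" by transfer simp
  show "- A + A = 0" by transfer simp
  show "A - B = A + - B" by transfer simp
  show "r *\<^sub>R (A + B) = r *\<^sub>R A + r *\<^sub>R B" by transfer (simp add: scaleR_add_right)
  show "(r + s) *\<^sub>R A = r *\<^sub>R A + s *\<^sub>R A" by transfer (simp add: scaleR_add_left)
  show "r *\<^sub>R s *\<^sub>R A = (r * s) *\<^sub>R A" by transfer simp
  show "1 *\<^sub>R A = A" by transfer simp
  show "A * B * C = A * (B * C)" by transfer (auto intro!: blinfun_eqI)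
  show "(A + B) * C = A * C + B * C"
    by transfer (auto intro!: blinfun_eqI simp: blinfun.add_left)
  show "A * (B + C) = A * B + A * C"
    by transfer (auto intro!: blinfun_eqI simp: blinfun.add_left blinfun.add_right)
  show "r *\<^sub>R A * B = r *\<^sub>R (A * B)"
    by transfer (auto intro!: blinfun_eqI simp: blinfun.scaleR_left)
  show "A * r *\<^sub>R B = r *\<^sub>R (A * B)"
    by transfer (auto intro!: blinfun_eqI simp: blinfun.scaleR_left blinfun.scaleR_right)
  show "1 * A = A" by transfer (auto intro!: blinfun_eqI)
  show "A * 1 = A" by transfer (auto intro!: blinfun_eqI)
  show "(0 :: clop) \<noteq> 1"
  proof
    assume "(0 :: clop) = 1"
    hence "blinfun_apply 0 (basis_vec 0) = blinfun_apply id_blinfun (basis_vec 0)" by transfer simp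
    hence "basis_vec 0 = 0" by simp
    thus False using norm_basis_vec[of 0] by simp
  qed
  show "dist A B = norm (A - B)" by (rule dist_clop_def)
  show "sgn A = inverse (norm A) *\<^sub>R A" by (rule sgn_clop_def)
  show "uniformity = (INF e\<in>{0 <..}. principal {(A :: clop, B). dist A B < e})"
    by (rule uniformity_clop_def)
  show "open U \<longleftrightarrow> (\<forall>A\<in>U. eventually (\<lambda>(A', B). A' = A \<longrightarrow> B \<in> U) uniformity)" for U :: "clop set"
    by (rule open_clop_def)
  show "norm A = 0 \<longleftrightarrow> A = 0" by transfer simp
  show "norm (A + B) \<le> norm A + norm B" by transfer (rule norm_triangle_ineq)
  show "norm (r *\<^sub>R A) = \<bar>r\<bar> * norm A" by transfer simp
  show "norm (A * B) \<le> norm A * norm B" by transfer (rule norm_blinfun_compose)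
  show "norm (1 :: clop) = 1"
  proof (transfer, rule antisym)
    show "norm (id_blinfun :: ell2 \<Rightarrow>\<^sub>L ell2) \<le> 1" by (rule norm_blinfun_bound) auto
    show "1 \<le> norm (id_blinfun :: ell2 \<Rightarrow>\<^sub>L ell2)"
      using norm_blinfun[of "id_blinfun :: ell2 \<Rightarrow>\<^sub>L ell2" "basis_vec 0"] by simp
  qed
qed

end

instance clop :: banach
proof
  fix X :: "nat \<Rightarrow> clop" assume X: "Cauchy X"
  have nb: "norm (A - B) = norm (blf A - blf B)" for A B by transfer simp
  have "Cauchy (\<lambda>n. blf (X n))" using X unfolding Cauchy_iff nb .
  then obtain L where L: "(\<lambda>n. blf (X n)) \<longlonglongrightarrow> L" by (auto simp: Cauchy_convergent_iff convergent_def)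
  have lim: "(\<lambda>n. blinfun_apply (blf (X n)) x) \<longlonglongrightarrow> blinfun_apply L x" for x
    using L by (intro blinfun.tendsto tendsto_const)
  have "complex_linear L"
    unfolding complex_linear_def
  proof (intro allI)
    fix c x
    have "(\<lambda>n. blinfun_apply (blf (X n)) (scaleC c x)) \<longlonglongrightarrow> scaleC c (blinfun_apply L x)"
      using bounded_linear.tendsto[OF bounded_linear_scaleC_right lim] complex_linear_blf
      by (simp add: complex_linear_def)
    thus "blinfun_apply L (scaleC c x) = scaleC c (blinfun_apply L x)"
      using lim LIMSEQ_unique by blast
  qed
  hence "blf (Abs_clop L) = L" by (simp add: Abs_clop_inverse)
  hence "X \<longlonglongrightarrow> Abs_clop L"
    using L unfolding LIMSEQ_iff nb by simp
  thus "convergent X" by (rule convergentI)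
qed

section \<open>Operators and their matrices\<close>

abbreviation ap :: "clop \<Rightarrow> ell2 \<Rightarrow> ell2" where
  "ap A \<equiv> blinfun_apply (blf A)"

abbreviation ent :: "clop \<Rightarrow> nat \<Rightarrow> nat \<Rightarrow> complex" where
  "ent A \<equiv> entry (blf A)"

lemma ap_simps [simp]:
  "ap 0 x = 0" "ap 1 x = x" "ap (A + B) x = ap A x + ap B x" "ap (A - B) x = ap A x - ap B x"
  "ap (- A) x = - ap A x" "ap (A * B) x = ap A (ap B x)" "ap (r *\<^sub>R A) x = r *\<^sub>R ap A x"
  by (transfer; simp add: blinfun.add_left blinfun.diff_left blinfun.minus_left blinfun.scaleR_left)+

lemma ap_scaleC: "ap A (scaleC c x) = scaleC c (ap A x)"
  using complex_linear_blf[of A] by (simp add: complex_linear_def)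

lemma norm_ap_le: "norm (ap A x) \<le> norm A * norm x"
  by transfer (rule norm_blinfun)

lemma bounded_linear_ap: "bounded_linear (ap A)"
  by (rule blinfun.bounded_linear_right)

lemma norm_clop_bound: "0 \<le> C \<Longrightarrow> (\<And>x. norm (ap A x) \<le> C * norm x) \<Longrightarrow> norm A \<le> C"
  by transfer (rule norm_blinfun_bound)

lemma seq_ap: "(\<lambda>k. ent A j k * seq x k) sums seq (ap A x) j"
proof -
  have "(\<lambda>k. seq (ap A (scaleC (seq x k) (basis_vec k))) j) sums seq (ap A x) j"
    by (intro bounded_linear.sums[OF bounded_linear_seq] bounded_linear.sums[OF bounded_linear_ap] basis_expansion)
  thus ?thesis by (simp add: ap_scaleC entry_def mult.commute)
qed

lemma clop_eqI: assumes "\<And>j k. ent A j k = ent B j k" shows "A = B"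
proof -
  have "ap A x = ap B x" for x
  proof (rule ell2_eqI)
    fix j
    have "(\<lambda>k. ent A j k * seq x k) sums seq (ap B x) j" using seq_ap[of B j x] by (simp add: assms)
    thus "seq (ap A x) j = seq (ap B x) j" by (rule sums_unique2[OF seq_ap])
  qed
  thus ?thesis by transfer (rule blinfun_eqI)
qed

lemma ent_simps [simp]:
  "ent 0 j k = 0" "ent 1 j k = (if j = k then 1 else 0)" "ent (A + B) j k = ent A j k + ent B j k"
  "ent (A - B) j k = ent A j k - ent B j k" "ent (- A) j k = - ent A j k" "ent (r *\<^sub>R A) j k = r *\<^sub>R ent A j k"
  by (simp_all add: entry_def seq_basis_vec)

lemma ent_mult: "(\<lambda>l. ent A j l * ent B l k) sums ent (A * B) j k"
  using seq_ap[of A j "ap B (basis_vec k)"] by (simp add: entry_def)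

lemma norm_ent_le: "cmod (ent A j k) \<le> norm A"
  using norm_seq_le[of "ap A (basis_vec k)" j] norm_ap_le[of A "basis_vec k"]
  by (simp add: entry_def)

lemma bounded_linear_ent: "bounded_linear (\<lambda>A. ent A j k)"
  by (rule bounded_linear_intro[of _ 1]) (auto simp: norm_ent_le)

text \<open>A uniform bound on the finite sections of the bilinear form certifies that an explicitly
  given matrix defines an operator of norm at most \<open>C\<close>. As \<open>y\<close> is not
  conjugated, exchanging \<open>x\<close> and \<open>y\<close> transposes \<open>m\<close>.\<close>

definition bounded_sections :: "(nat \<Rightarrow> nat \<Rightarrow> complex) \<Rightarrow> real \<Rightarrow> bool" where
  "bounded_sections m C \<longleftrightarrow> 0 \<le> C \<and> (\<forall>n x y. cmod (\<Sum>j<n. \<Sum>k<n. m j k * x k * y j) \<le>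
      C * sqrt (\<Sum>k<n. (cmod (x k))\<^sup>2) * sqrt (\<Sum>j<n. (cmod (y j))\<^sup>2))"

lemma bounded_sectionsD:
  "bounded_sections m C \<Longrightarrow> cmod (\<Sum>j<n. \<Sum>k<n. m j k * x k * y j) \<le>
      C * sqrt (\<Sum>k<n. (cmod (x k))\<^sup>2) * sqrt (\<Sum>j<n. (cmod (y j))\<^sup>2)"
  by (simp add: bounded_sections_def)

lemma le_square_if_le_mult_sqrt: "0 \<le> s \<Longrightarrow> s \<le> B * sqrt s \<Longrightarrow> s \<le> B\<^sup>2" for s B :: real
proof (cases "s = 0")
  case False
  assume *: "0 \<le> s" "s \<le> B * sqrt s"
  hence "sqrt s * sqrt s \<le> B * sqrt s" by simp
  hence "sqrt s \<le> B" using False * by (subst (asm) mult_le_cancel_right) auto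
  hence "(sqrt s)\<^sup>2 \<le> B\<^sup>2" using * by (intro power_mono) auto
  thus ?thesis using * by simp
qed auto

text \<open>The form is tested on the conjugated row as \<open>x\<close> and a unit vector as
  \<open>y\<close>, which gives \<open>s \<le> C * sqrt s\<close> for the square sum
  \<open>s\<close> of the row.\<close>

lemma bounded_sections_rows:
  assumes "bounded_sections m C"
  shows "summable (\<lambda>k. (cmod (m j k))\<^sup>2)"
proof (rule summableI_nonneg_bounded)
  fix n
  define N where "N = max n (Suc j)"
  have jN: "j < N" by (simp add: N_def)
  let ?s = "\<Sum>k<N. (cmod (m j k))\<^sup>2"
  have "(\<Sum>i<N. \<Sum>k<N. m i k * cnj (m j k) * (if i = j then 1 else 0)) = (\<Sum>i<N. if i = j then (\<Sum>k<N. m j k * cnj (m j k)) else 0)"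
    by (intro sum.cong) auto
  also have "\<dots> = of_real ?s" using jN by (simp add: complex_norm_square[symmetric])
  finally have "cmod (of_real ?s) \<le> C * sqrt (\<Sum>k<N. (cmod (cnj (m j k)))\<^sup>2) * sqrt (\<Sum>i<N. (cmod (if i = j then 1 else 0))\<^sup>2)"
    using bounded_sectionsD[OF assms, of "\<lambda>k. cnj (m j k)" "\<lambda>i. if i = j then 1 else 0" N] by (simp only:)
  also have "(\<Sum>i<N. (cmod (if i = j then 1 else 0))\<^sup>2) = (\<Sum>i<N. if i = j then 1 else 0)" by (intro sum.cong) auto
  also have "\<dots> = 1" using jN by simp
  finally have "?s \<le> C * sqrt ?s" by (simp only: norm_of_real complex_mod_cnj) (simp add: sum_nonneg)
  hence "?s \<le> C\<^sup>2" by (intro le_square_if_le_mult_sqrt sum_nonneg) auto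
  moreover have "(\<Sum>k<n. (cmod (m j k))\<^sup>2) \<le> ?s" by (rule sum_mono2) (auto simp: N_def)
  ultimately show "(\<Sum>k<n. (cmod (m j k))\<^sup>2) \<le> C\<^sup>2" by linarith
qed auto

text \<open>Duality: with the conjugated image as second vector the form returns the square sum of
  the image. The test vector \<open>z\<close> is cut at \<open>N\<close> while the columns run up to
  \<open>K \<ge> N\<close>, so that \<open>K\<close> can tend to infinity for fixed
  \<open>N\<close>.\<close>

lemma bounded_sections_apply:
  assumes m: "bounded_sections m C"
  shows "summable (\<lambda>k. cmod (m j k * seq x k))"
    and "(\<Sum>j<N. (cmod (\<Sum>k. m j k * seq x k))\<^sup>2) \<le> (C * norm x)\<^sup>2"
proof -
  have C: "C \<ge> 0" using m by (simp add: bounded_sections_def)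
  show s: "summable (\<lambda>k. cmod (m j k * seq x k))" for j
    by (rule Cauchy_Schwarz_series(1)[OF bounded_sections_rows[OF m] summable_seq])
  show "(\<Sum>j<N. (cmod (\<Sum>k. m j k * seq x k))\<^sup>2) \<le> (C * norm x)\<^sup>2"
  proof (rule LIMSEQ_le_const2)
    show "(\<lambda>K. \<Sum>j<N. (cmod (\<Sum>k<K. m j k * seq x k))\<^sup>2) \<longlonglongrightarrow> (\<Sum>j<N. (cmod (\<Sum>k. m j k * seq x k))\<^sup>2)"
      by (intro tendsto_sum tendsto_power tendsto_norm summable_LIMSEQ summable_norm_cancel[OF s])
    have "(\<Sum>j<N. (cmod (\<Sum>k<K. m j k * seq x k))\<^sup>2) \<le> (C * norm x)\<^sup>2" if K: "K \<ge> N" for K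
    proof -
      define z where "z j = (if j < N then \<Sum>k<K. m j k * seq x k else 0)" for j
      have sz: "(\<Sum>j<K. (cmod (z j))\<^sup>2) = (\<Sum>j<N. (cmod (z j))\<^sup>2)"
        using K by (intro sum.mono_neutral_right) (auto simp: z_def)
      have "(\<Sum>j<K. \<Sum>k<K. m j k * seq x k * cnj (z j)) = (\<Sum>j<K. (\<Sum>k<K. m j k * seq x k) * cnj (z j))"
        by (simp add: sum_distrib_right)
      also have "\<dots> = (\<Sum>j<K. of_real ((cmod (z j))\<^sup>2))"
        by (intro sum.cong refl, subst complex_norm_square) (auto simp: z_def)
      finally have "(\<Sum>j<K. \<Sum>k<K. m j k * seq x k * cnj (z j)) = of_real (\<Sum>j<K. (cmod (z j))\<^sup>2)" by simp
      hence "cmod (of_real (\<Sum>j<K. (cmod (z j))\<^sup>2)) \<le> 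
         C * sqrt (\<Sum>k<K. (cmod (seq x k))\<^sup>2) * sqrt (\<Sum>j<K. (cmod (cnj (z j)))\<^sup>2)"
        using bounded_sectionsD[OF m, of "seq x" "\<lambda>j. cnj (z j)" K] by (simp only:)
      also have "\<dots> \<le> C * norm x * sqrt (\<Sum>j<K. (cmod (z j))\<^sup>2)"
        using sum_seq_le[of "{..<K}" x] C
        by (intro mult_mono mult_nonneg_nonneg) (auto intro: real_le_lsqrt sum_nonneg)
      finally have "(\<Sum>j<K. (cmod (z j))\<^sup>2) \<le> C * norm x * sqrt (\<Sum>j<K. (cmod (z j))\<^sup>2)"
        by (simp only: norm_of_real)
      hence "(\<Sum>j<K. (cmod (z j))\<^sup>2) \<le> (C * norm x)\<^sup>2"
        by (intro le_square_if_le_mult_sqrt sum_nonneg) auto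
      thus ?thesis unfolding sz by (simp add: z_def)
    qed
    thus "\<exists>M. \<forall>K\<ge>M. (\<Sum>j<N. (cmod (\<Sum>k<K. m j k * seq x k))\<^sup>2) \<le> (C * norm x)\<^sup>2" by blast
  qed
qed

lemma matrix_op_bounded_sections:
  assumes m: "bounded_sections m C"
  shows "complex_linear (matrix_op m)" "entry (matrix_op m) = m" "norm (matrix_op m) \<le> C"
proof -
  have C: "C \<ge> 0" using m by (simp add: bounded_sections_def)
  let ?f = "\<lambda>x. Abs_ell2 (\<lambda>j. \<Sum>k. m j k * seq x k)"
  have Cx: "0 \<le> C * norm x" for x :: ell2 using C by simp
  note ell = ell2_bounded_sums[OF Cx bounded_sections_apply(2)[OF m]]
  have sm: "summable (\<lambda>k. m j k * seq x k)" for j x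
    by (rule summable_norm_cancel[OF bounded_sections_apply(1)[OF m]])
  have "bounded_linear ?f"
  proof (rule bounded_linear_intro)
    show "?f (x + y) = ?f x + ?f y" for x y
    proof (rule ell2_eqI)
      fix n
      have "seq (?f (x + y)) n = (\<Sum>k. m n k * seq x k + m n k * seq y k)"
        unfolding ell(2) by (simp add: distrib_left)
      thus "seq (?f (x + y)) n = seq (?f x + ?f y) n"
        unfolding seq_simps ell(2) by (simp add: suminf_add[OF sm sm])
    qed
    show "?f (r *\<^sub>R x) = r *\<^sub>R ?f x" for r x
    proof (rule ell2_eqI)
      fix n
      have "seq (?f (r *\<^sub>R x)) n = (\<Sum>k. of_real r * (m n k * seq x k))"
        unfolding ell(2) by (simp add: scaleR_conv_of_real mult_ac)
      thus "seq (?f (r *\<^sub>R x)) n = seq (r *\<^sub>R ?f x) n"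
        unfolding seq_simps ell(2) by (simp add: suminf_mult[OF sm] scaleR_conv_of_real)
    qed
    show "norm (?f x) \<le> norm x * C" for x using ell(3)[of x] by (simp add: mult.commute)
  qed
  hence app: "blinfun_apply (matrix_op m) x = ?f x" for x
    by (simp add: matrix_op_def bounded_linear_Blinfun_apply)
  show "complex_linear (matrix_op m)"
    unfolding complex_linear_def app
  proof (intro allI)
    fix c x show "?f (scaleC c x) = scaleC c (?f x)"
    proof (rule ell2_eqI)
      fix n
      have "seq (?f (scaleC c x)) n = (\<Sum>k. c * (m n k * seq x k))"
        unfolding ell(2) by (simp add: mult_ac)
      thus "seq (?f (scaleC c x)) n = seq (scaleC c (?f x)) n"
        unfolding seq_simps ell(2) by (simp add: suminf_mult[OF sm])
    qed
  qed
  show "norm (matrix_op m) \<le> C"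
    by (rule norm_blinfun_bound) (use C ell(3) in \<open>auto simp: app\<close>)
  show "entry (matrix_op m) = m"
  proof (intro ext)
    fix j k
    have "entry (matrix_op m) j k = (\<Sum>l. m j l * seq (basis_vec k) l)"
      by (simp add: entry_def app ell(2))
    also have "\<dots> = m j k"
      by (subst suminf_finite[of "{k}"]) (auto simp: seq_basis_vec)
    finally show "entry (matrix_op m) j k = m j k" .
  qed
qed

text \<open>The converse direction, from operators to matrices; it is how transposes are shown to
  exist.\<close>

lemma bounded_sections_ent: "bounded_sections (ent A) (norm A)"
  unfolding bounded_sections_def
proof (intro conjI allI)
  fix n and x y :: "nat \<Rightarrow> complex"
  define X where "X = (\<Sum>k<n. scaleC (x k) (basis_vec k))"
  have sX: "seq X k = (if k < n then x k else 0)" for k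
  proof -
    have "seq X k = (\<Sum>l<n. x l * seq (basis_vec l) k)" by (simp add: X_def)
    also have "\<dots> = (\<Sum>l<n. if l = k then x k else 0)" by (intro sum.cong) (auto simp: seq_basis_vec)
    finally show ?thesis by simp
  qed
  have nX: "norm X = sqrt (\<Sum>k<n. (cmod (x k))\<^sup>2)"
  proof -
    have "(norm X)\<^sup>2 = (\<Sum>k<n. (cmod (seq X k))\<^sup>2)"
      unfolding norm_ell2_square by (rule suminf_finite) (auto simp: sX)
    thus ?thesis by (simp add: sX real_sqrt_unique)
  qed
  have eq: "(\<Sum>k<n. ent A j k * x k) = seq (ap A X) j" for j
  proof -
    have "(\<lambda>k. ent A j k * seq X k) sums (\<Sum>k<n. ent A j k * seq X k)"
      by (rule sums_finite) (auto simp: sX)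
    thus ?thesis using seq_ap[of A j X] sums_unique2 by (fastforce simp: sX)
  qed
  have "cmod (\<Sum>j<n. \<Sum>k<n. ent A j k * x k * y j) = cmod (\<Sum>j<n. seq (ap A X) j * y j)"
    by (simp add: eq[symmetric] sum_distrib_right)
  also have "\<dots> \<le> (\<Sum>j<n. \<bar>cmod (seq (ap A X) j)\<bar> * \<bar>cmod (y j)\<bar>)"
    by (rule order.trans[OF norm_sum]) (simp add: norm_mult)
  also have "\<dots> \<le> L2_set (\<lambda>j. cmod (seq (ap A X) j)) {..<n} * L2_set (\<lambda>j. cmod (y j)) {..<n}"
    by (rule L2_set_mult_ineq)
  also have "\<dots> \<le> norm (ap A X) * sqrt (\<Sum>j<n. (cmod (y j))\<^sup>2)"
    unfolding L2_set_def
    by (intro mult_mono) (auto intro!: real_le_lsqrt sum_nonneg sum_seq_le)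
  also have "\<dots> \<le> norm A * norm X * sqrt (\<Sum>j<n. (cmod (y j))\<^sup>2)"
    by (intro mult_right_mono norm_ap_le) (auto intro: sum_nonneg)
  finally show "cmod (\<Sum>j<n. \<Sum>k<n. ent A j k * x k * y j) \<le>
      norm A * sqrt (\<Sum>k<n. (cmod (x k))\<^sup>2) * sqrt (\<Sum>j<n. (cmod (y j))\<^sup>2)"
    by (simp add: nX)
qed auto

definition matrix_clop :: "(nat \<Rightarrow> nat \<Rightarrow> complex) \<Rightarrow> clop" where
  "matrix_clop m = Abs_clop (matrix_op m)"

lemma matrix_clop:
  assumes "bounded_sections m C"
  shows "blf (matrix_clop m) = matrix_op m" "ent (matrix_clop m) = m" "norm (matrix_clop m) \<le> C"
  using matrix_op_bounded_sections[OF assms]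
  by (simp_all add: matrix_clop_def Abs_clop_inverse norm_clop.rep_eq)

text \<open>No conjugation is involved, so this is a complex linear map that reverses products. On
  Toeplitz operators it is the passage from \<open>f\<close> to \<open>flip f\<close>, and it
  derives right-sided facts from left-sided ones.\<close>

definition transp :: "clop \<Rightarrow> clop" where
  "transp A = matrix_clop (\<lambda>j k. ent A k j)"

lemma bounded_sections_transpose:
  assumes "bounded_sections m C"
  shows "bounded_sections (\<lambda>j k. m k j) C"
  unfolding bounded_sections_def
proof (intro conjI allI)
  fix n and x y :: "nat \<Rightarrow> complex"
  have "(\<Sum>j<n. \<Sum>k<n. m k j * x k * y j) = (\<Sum>k<n. \<Sum>j<n. m k j * y j * x k)"
    by (subst sum.swap) (simp add: mult_ac)
  hence "cmod (\<Sum>j<n. \<Sum>k<n. m k j * x k * y j)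
      \<le> C * sqrt (\<Sum>j<n. (cmod (y j))\<^sup>2) * sqrt (\<Sum>k<n. (cmod (x k))\<^sup>2)"
    using bounded_sectionsD[OF assms, of y x n] by (simp only:)
  thus "cmod (\<Sum>j<n. \<Sum>k<n. m k j * x k * y j)
      \<le> C * sqrt (\<Sum>k<n. (cmod (x k))\<^sup>2) * sqrt (\<Sum>j<n. (cmod (y j))\<^sup>2)"
    by (simp add: mult_ac)
qed (use assms in \<open>auto simp: bounded_sections_def\<close>)

lemma ent_transp [simp]: "ent (transp A) j k = ent A k j"
  and norm_transp_le: "norm (transp A) \<le> norm A"
  using matrix_clop[OF bounded_sections_transpose[OF bounded_sections_ent[of A]]]
  by (simp_all add: transp_def)

lemma transp_transp [simp]: "transp (transp A) = A"
  by (rule clop_eqI) simp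

lemma transp_mult: "transp (A * B) = transp B * transp A"
proof (rule clop_eqI)
  fix j k
  have "(\<lambda>l. ent (transp B) j l * ent (transp A) l k) sums ent (A * B) k j"
    using ent_mult[of A k B j] by (simp add: mult.commute)
  from sums_unique2[OF this ent_mult[of "transp B" j "transp A" k]]
  show "ent (transp (A * B)) j k = ent (transp B * transp A) j k" by simp
qed

section \<open>Nuclear operators and their determinants\<close>

text \<open>Bilinear, in contrast to the inner product, and thereby compatible with
  \<open>transp\<close>.\<close>

definition bp :: "ell2 \<Rightarrow> ell2 \<Rightarrow> complex" where
  "bp x y = (\<Sum>n. seq x n * seq y n)"

lemma bp_sums: "(\<lambda>n. seq x n * seq y n) sums bp x y"
  unfolding bp_def
  by (intro summable_sums summable_norm_cancel[OF Cauchy_Schwarz_series(1)] summable_seq)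

lemma norm_bp_le: "cmod (bp x y) \<le> norm x * norm y"
  unfolding bp_def norm_ell2_def by (rule Cauchy_Schwarz_series(3)) (rule summable_seq)+

lemma bp_add: "bp x (y + z) = bp x y + bp x z"
  using sums_add[OF bp_sums[of x y] bp_sums[of x z]] bp_sums[of x "y + z"]
  by (simp add: distrib_left sums_unique2)

lemma bp_scaleC: "bp x (scaleC c y) = c * bp x y"
  using sums_mult[OF bp_sums[of x y], of c] bp_sums[of x "scaleC c y"]
  by (simp add: mult.left_commute sums_unique2)

lemma bounded_linear_bp: "bounded_linear (bp x)"
proof (rule bounded_linear_intro)
  show "bp x (r *\<^sub>R y) = r *\<^sub>R bp x y" for r y
    using bp_scaleC[of x "of_real r" y] by (simp add: scaleC_of_real scaleR_conv_of_real)
  show "cmod (bp x y) \<le> norm y * norm x" for y using norm_bp_le[of x y] by (simp add: mult.commute)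
qed (rule bp_add)

lemma bp_transp: "bp y (ap A x) = bp (ap (transp A) y) x"
proof -
  have "(\<lambda>k. bp y (ap A (scaleC (seq x k) (basis_vec k)))) sums bp y (ap A x)"
    by (intro bounded_linear.sums[OF bounded_linear_bp] bounded_linear.sums[OF bounded_linear_ap] basis_expansion)
  moreover have "bp y (ap A (basis_vec k)) = seq (ap (transp A) y) k" for k
  proof -
    have "(\<lambda>l. ent (transp A) k l * seq y l) sums bp y (ap A (basis_vec k))"
      using bp_sums[of y "ap A (basis_vec k)"] by (simp add: entry_def[symmetric] mult.commute)
    from sums_unique2[OF this seq_ap] show ?thesis .
  qed
  ultimately have "(\<lambda>k. seq (ap (transp A) y) k * seq x k) sums bp y (ap A x)"
    by (simp add: ap_scaleC bp_scaleC mult.commute)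
  from sums_unique2[OF this bp_sums] show ?thesis .
qed

text \<open>A sum of rank one operators of total weight at most \<open>c\<close>. The number
  \<open>c\<close> is any upper bound for the nuclear norm, so estimates compose and no infimum has
  to be handled. Convergence is demanded of the entries, which determine \<open>A\<close>.\<close>

definition nuclear :: "clop \<Rightarrow> real \<Rightarrow> bool" where
  "nuclear A c \<longleftrightarrow> (\<exists>x y :: nat \<Rightarrow> ell2. summable (\<lambda>i. norm (x i) * norm (y i)) \<and>
      (\<Sum>i. norm (x i) * norm (y i)) \<le> c \<and> (\<forall>j k. (\<lambda>i. seq (x i) j * seq (y i) k) sums ent A j k))"

lemma nuclear_nonneg: "nuclear A c \<Longrightarrow> 0 \<le> c"
  unfolding nuclear_def by (meson order.trans suminf_nonneg mult_nonneg_nonneg norm_ge_zero)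

lemma nuclear_mono: "nuclear A c \<Longrightarrow> c \<le> d \<Longrightarrow> nuclear A d"
  unfolding nuclear_def by (meson order.trans)

lemma nuclear_transp: assumes "nuclear A c" shows "nuclear (transp A) c"
proof -
  obtain x y :: "nat \<Rightarrow> ell2" where "summable (\<lambda>i. norm (x i) * norm (y i))"
    "(\<Sum>i. norm (x i) * norm (y i)) \<le> c" "\<And>j k. (\<lambda>i. seq (x i) j * seq (y i) k) sums ent A j k"
    using assms unfolding nuclear_def by blast
  thus ?thesis unfolding nuclear_def
    by (intro exI[of _ y] exI[of _ x]) (simp add: mult.commute)
qed

text \<open>Entrywise convergence does not pass through \<open>X\<close> by itself. For fixed
  \<open>k\<close> the vectors \<open>x i\<close>, weighted by \<open>seq (y i) k\<close>, form an
  absolutely convergent series with the \<open>k\<close>-th column of \<open>A\<close> as its sum,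
  and \<open>X\<close> is continuous.\<close>

lemma nuclear_representation_left:
  fixes x y :: "nat \<Rightarrow> ell2"
  assumes s: "summable (\<lambda>i. norm (x i) * norm (y i))"
    and e: "\<And>j k. (\<lambda>i. seq (x i) j * seq (y i) k) sums ent A j k"
  shows "(\<lambda>i. seq (ap X (x i)) j * seq (y i) k) sums ent (X * A) j k"
proof -
  have sm: "summable (\<lambda>i. scaleC (seq (y i) k) (x i))"
  proof (rule summable_comparison_test'[OF s])
    show "norm (scaleC (seq (y i) k) (x i)) \<le> norm (x i) * norm (y i)" for i
      unfolding norm_scaleC by (subst mult.commute, intro mult_left_mono norm_seq_le) auto
  qed
  have "(\<Sum>i. scaleC (seq (y i) k) (x i)) = ap A (basis_vec k)"
  proof (rule ell2_eqI)
    fix j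
    have "(\<lambda>i. seq (x i) j * seq (y i) k) sums seq (\<Sum>i. scaleC (seq (y i) k) (x i)) j"
      using bounded_linear.sums[OF bounded_linear_seq summable_sums[OF sm], of j] by (simp add: mult.commute)
    from sums_unique2[OF this e] show "seq (\<Sum>i. scaleC (seq (y i) k) (x i)) j = seq (ap A (basis_vec k)) j"
      by (simp add: entry_def)
  qed
  hence "(\<lambda>i. scaleC (seq (y i) k) (x i)) sums ap A (basis_vec k)"
    using summable_sums[OF sm] by simp
  hence "(\<lambda>i. seq (ap X (scaleC (seq (y i) k) (x i))) j) sums seq (ap X (ap A (basis_vec k))) j"
    by (intro bounded_linear.sums[OF bounded_linear_seq] bounded_linear.sums[OF bounded_linear_ap])
  thus ?thesis by (simp add: ap_scaleC entry_def mult.commute)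
qed

lemma nuclear_mult_left:
  assumes "nuclear A c"
  shows "nuclear (X * A) (norm X * c)"
proof -
  obtain x y :: "nat \<Rightarrow> ell2" where xy: "summable (\<lambda>i. norm (x i) * norm (y i))"
    "(\<Sum>i. norm (x i) * norm (y i)) \<le> c" "\<And>j k. (\<lambda>i. seq (x i) j * seq (y i) k) sums ent A j k"
    using assms unfolding nuclear_def by blast
  have le: "norm (ap X (x i)) * norm (y i) \<le> norm X * (norm (x i) * norm (y i))" for i
    using mult_right_mono[OF norm_ap_le[of X "x i"], of "norm (y i)"] by (simp add: mult.assoc)
  have s: "summable (\<lambda>i. norm (ap X (x i)) * norm (y i))"
    by (rule summable_comparison_test'[OF summable_mult[OF xy(1), of "norm X"]]) (use le in auto)
  have "(\<Sum>i. norm (ap X (x i)) * norm (y i)) \<le> (\<Sum>i. norm X * (norm (x i) * norm (y i)))"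
    by (intro suminf_le le s summable_mult xy)
  also have "\<dots> \<le> norm X * c"
    unfolding suminf_mult[OF xy(1)] by (intro mult_left_mono xy) auto
  finally show ?thesis
    unfolding nuclear_def using s nuclear_representation_left[OF xy(1,3), of X]
    by (intro exI[of _ "\<lambda>i. ap X (x i)"] exI[of _ y]) simp
qed

lemma nuclear_mult_right:
  assumes "nuclear A c"
  shows "nuclear (A * X) (norm X * c)"
proof -
  have "nuclear (transp (transp X * transp A)) (norm (transp X) * c)"
    by (intro nuclear_transp nuclear_mult_left assms)
  hence "nuclear (A * X) (norm (transp X) * c)" by (simp add: transp_mult)
  thus ?thesis
    by (rule nuclear_mono) (intro mult_right_mono norm_transp_le nuclear_nonneg[OF assms])
qed

text \<open>The rank one terms of all \<open>A n\<close> form one double family of total weight at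
  most \<open>\<Sum>n. c n\<close>. Absolute summability lets its entries be evaluated row by row,
  and a pairing of indices makes it a sequence.\<close>

lemma nuclear_series:
  assumes A: "\<And>n. nuclear (A n) (c n)" and c: "summable c"
    and B: "\<And>j k. (\<lambda>n. ent (A n) j k) sums ent B j k"
  shows "nuclear B (\<Sum>n. c n)"
proof -
  have "\<exists>x y :: nat \<Rightarrow> ell2. summable (\<lambda>i. norm (x i) * norm (y i)) \<and>
      (\<Sum>i. norm (x i) * norm (y i)) \<le> c n \<and> (\<forall>j k. (\<lambda>i. seq (x i) j * seq (y i) k) sums ent (A n) j k)" for n
    using A[of n] unfolding nuclear_def .
  then obtain x where "\<forall>n. \<exists>y :: nat \<Rightarrow> ell2. summable (\<lambda>i. norm (x n i) * norm (y i)) \<and>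
      (\<Sum>i. norm (x n i) * norm (y i)) \<le> c n \<and> (\<forall>j k. (\<lambda>i. seq (x n i) j * seq (y i) k) sums ent (A n) j k)"
    using choice[of "\<lambda>n x. \<exists>y. summable (\<lambda>i. norm (x i) * norm (y i)) \<and>
      (\<Sum>i. norm (x i) * norm (y i)) \<le> c n \<and> (\<forall>j k. (\<lambda>i. seq (x i) j * seq (y i) k) sums ent (A n) j k)"] by blast
  from choice[OF this] obtain y where "\<forall>n. summable (\<lambda>i. norm (x n i) * norm (y n i)) \<and>
      (\<Sum>i. norm (x n i) * norm (y n i)) \<le> c n \<and> (\<forall>j k. (\<lambda>i. seq (x n i) j * seq (y n i) k) sums ent (A n) j k)"
    by blast
  hence s: "\<And>n. summable (\<lambda>i. norm (x n i) * norm (y n i))"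
    and le: "\<And>n. (\<Sum>i. norm (x n i) * norm (y n i)) \<le> c n"
    and e: "\<And>n j k. (\<lambda>i. seq (x n i) j * seq (y n i) k) sums ent (A n) j k"
    by simp_all
  define g where "g = (\<lambda>n i. norm (x n i) * norm (y n i))"
  have hs: "(g n has_sum (\<Sum>i. g n i)) UNIV" for n
    by (rule sums_nonneg_imp_has_sum) (use summable_sums[OF s] in \<open>auto simp: g_def\<close>)
  have sg: "summable (\<lambda>n. \<Sum>i. g n i)"
  proof (rule summable_comparison_test'[OF c])
    fix n
    have "0 \<le> (\<Sum>i. g n i)" unfolding g_def by (intro suminf_nonneg s) auto
    thus "norm (\<Sum>i. g n i) \<le> c n" using le[of n] by (simp add: g_def)
  qed
  have hsg: "((\<lambda>n. \<Sum>i. g n i) has_sum (\<Sum>n. \<Sum>i. g n i)) UNIV"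
    by (rule sums_nonneg_imp_has_sum[OF summable_sums[OF sg]])
      (auto simp: g_def intro!: suminf_nonneg s)
  have gon: "(\<lambda>(n, i). g n i) summable_on UNIV \<times> UNIV"
    by (rule summable_on_SigmaI[where g = "\<lambda>n. \<Sum>i. g n i"])
      (use hs hsg in \<open>auto simp: g_def summable_on_def\<close>)
  have gsum: "((\<lambda>(n, i). g n i) has_sum (\<Sum>n. \<Sum>i. g n i)) (UNIV \<times> UNIV)"
  proof -
    have "infsum (\<lambda>(n, i). g n i) (UNIV \<times> UNIV) = (\<Sum>\<^sub>\<infinity>n. \<Sum>\<^sub>\<infinity>i. g n i)"
      by (rule infsum_Sigma'_banach[symmetric]) (use gon in simp)
    also have "\<dots> = (\<Sum>n. \<Sum>i. g n i)" using infsumI[OF hs] infsumI[OF hsg] by simp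
    finally show ?thesis using has_sum_infsum[OF gon] by simp
  qed
  \<comment> \<open>The renumbering serves real weights as well as complex entries, hence the
    polymorphic values.\<close>
  have re: "((\<lambda>m. f (fst (prod_decode m)) (snd (prod_decode m))) has_sum S) UNIV"
    if "((\<lambda>(n, i). f n i) has_sum S) (UNIV \<times> UNIV)" for f :: "nat \<Rightarrow> nat \<Rightarrow> 'b :: banach" and S
    using has_sum_reindex_bij_betw[of prod_decode UNIV UNIV "\<lambda>(n, i). f n i" S] that
    by (simp add: case_prod_unfold bij_betw_def inj_prod_decode surj_prod_decode)
  have ent: "((\<lambda>(n, i). seq (x n i) j * seq (y n i) k) has_sum ent B j k) (UNIV \<times> UNIV)" for j k
  proof -
    let ?f = "\<lambda>n i. seq (x n i) j * seq (y n i) k"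
    have fle: "cmod (?f n i) \<le> g n i" for n i
      unfolding norm_mult g_def by (intro mult_mono norm_seq_le) auto
    have fon: "(\<lambda>(n, i). ?f n i) summable_on UNIV \<times> UNIV"
      by (rule abs_summable_summable[OF summable_on_comparison_test[OF gon]]) (use fle in auto)
    have row: "(?f n has_sum ent (A n) j k) UNIV" for n
    proof -
      have "?f n summable_on UNIV" using summable_on_SigmaD1[OF fon, of n] by simp
      note h = has_sum_infsum[OF this]
      show ?thesis using h sums_unique2[OF has_sum_imp_sums[OF h] e] by simp
    qed
    have "(\<lambda>n. \<Sum>\<^sub>\<infinity>i. ?f n i) summable_on UNIV" using summable_on_Sigma_banach[OF fon] by simp
    hence "(\<lambda>n. ent (A n) j k) summable_on UNIV" using infsumI[OF row] by simp
    note h = has_sum_infsum[OF this]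
    have col: "((\<lambda>n. ent (A n) j k) has_sum ent B j k) UNIV"
      using h sums_unique2[OF has_sum_imp_sums[OF h] B] by simp
    have "infsum (\<lambda>(n, i). ?f n i) (UNIV \<times> UNIV) = (\<Sum>\<^sub>\<infinity>n. \<Sum>\<^sub>\<infinity>i. ?f n i)"
      by (rule infsum_Sigma'_banach[symmetric]) (use fon in simp)
    also have "\<dots> = ent B j k" using infsumI[OF row] infsumI[OF col] by simp
    finally show ?thesis using has_sum_infsum[OF fon] by simp
  qed
  show ?thesis
    unfolding nuclear_def
  proof (intro exI conjI allI)
    let ?x = "\<lambda>m. x (fst (prod_decode m)) (snd (prod_decode m))"
    let ?y = "\<lambda>m. y (fst (prod_decode m)) (snd (prod_decode m))"
    have sums: "(\<lambda>m. norm (?x m) * norm (?y m)) sums (\<Sum>n. \<Sum>i. g n i)"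
      using has_sum_imp_sums[OF re[OF gsum]] by (simp add: g_def)
    thus "summable (\<lambda>m. norm (?x m) * norm (?y m))" by (rule sums_summable)
    have "(\<Sum>n. \<Sum>i. g n i) \<le> (\<Sum>n. c n)"
      by (intro suminf_le sg c) (use le in \<open>simp add: g_def\<close>)
    thus "(\<Sum>m. norm (?x m) * norm (?y m)) \<le> (\<Sum>n. c n)" using sums by (simp add: sums_iff)
    show "(\<lambda>m. seq (?x m) j * seq (?y m) k) sums ent B j k" for j k
      using has_sum_imp_sums[OF re[OF ent]] .
  qed
qed

lemma nuclear_zero: "nuclear 0 0"
  unfolding nuclear_def by (intro exI[of _ "\<lambda>_. 0"]) simp

lemma nuclear_add:
  assumes "nuclear A c" "nuclear B d"
  shows "nuclear (A + B) (c + d)"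
proof -
  have "(\<lambda>n. if n = 0 then c else if n = 1 then d else 0) sums (\<Sum>n\<in>{0, 1 :: nat}. if n = 0 then c else if n = 1 then d else 0)"
    by (rule sums_finite) auto
  hence s: "(\<lambda>n :: nat. if n = 0 then c else if n = 1 then d else 0) sums (c + d)" by simp
  have "nuclear (A + B) (\<Sum>n :: nat. if n = 0 then c else if n = 1 then d else 0)"
  proof (rule nuclear_series[where A = "\<lambda>n. if n = 0 then A else if n = 1 then B else 0"])
    show "nuclear (if n = 0 then A else if n = 1 then B else 0) (if n = 0 then c else if n = 1 then d else 0)" for n :: nat
      using assms nuclear_zero by auto
    fix j k
    have "(\<lambda>n. ent (if n = 0 then A else if n = 1 then B else 0) j k) sums
      (\<Sum>n\<in>{0, 1 :: nat}. ent (if n = 0 then A else if n = 1 then B else 0) j k)"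
      by (rule sums_finite) auto
    thus "(\<lambda>n :: nat. ent (if n = 0 then A else if n = 1 then B else 0) j k) sums ent (A + B) j k" by simp
  qed (use s in \<open>simp add: sums_iff\<close>)
  thus ?thesis using s by (simp add: sums_iff)
qed

lemma nuclear_scaleR:
  assumes "nuclear A c"
  shows "nuclear (r *\<^sub>R A) (\<bar>r\<bar> * c)"
  using nuclear_mult_left[OF assms, of "r *\<^sub>R 1"] by simp

lemma nuclear_uminus: "nuclear A c \<Longrightarrow> nuclear (- A) c"
  using nuclear_scaleR[of A c "-1"] by simp

lemma nuclear_diff: "nuclear A c \<Longrightarrow> nuclear B d \<Longrightarrow> nuclear (A - B) (c + d)"
  using nuclear_add[OF _ nuclear_uminus, of A c B d] by simp

lemma hilbert_schmidt_family:
  assumes "summable (\<lambda>i. (norm (x i))\<^sup>2)"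
  shows "hilbert_schmidt (\<lambda>i j. seq (x i) j)"
  using assms by (intro hilbert_schmidtI summable_seq) (simp add: norm_ell2_square)

lemma hilbert_schmidt_suminf_swap:
  assumes "hilbert_schmidt c"
  shows "(\<Sum>i. \<Sum>j. (cmod (c i j))\<^sup>2) = (\<Sum>j. \<Sum>i. (cmod (c i j))\<^sup>2)"
proof -
  \<comment> \<open>The trace of \<open>c\<close> times its adjoint is the sum of all squared
    moduli, so cyclicity of the trace exchanges the two summations.\<close>
  have "hilbert_schmidt (\<lambda>i j. cnj (c j i))"
    using hilbert_schmidt_transpose[OF assms] by (simp add: hilbert_schmidt_def)
  from trace_mult_commute[OF assms this]
  have "(\<Sum>i. \<Sum>j. complex_of_real ((cmod (c i j))\<^sup>2)) = (\<Sum>j. \<Sum>i. complex_of_real ((cmod (c i j))\<^sup>2))"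
    unfolding complex_norm_square by (simp add: mult.commute)
  moreover have "(\<lambda>j. complex_of_real ((cmod (c i j))\<^sup>2)) sums of_real (\<Sum>j. (cmod (c i j))\<^sup>2)" for i
    using hilbert_schmidt_rows(1)[OF assms] by (intro sums_of_real summable_sums)
  moreover have "(\<lambda>i. complex_of_real ((cmod (c i j))\<^sup>2)) sums of_real (\<Sum>i. (cmod (c i j))\<^sup>2)" for j
    using hilbert_schmidt_rows(1)[OF hilbert_schmidt_transpose[OF assms]] by (intro sums_of_real summable_sums)
  moreover have "(\<lambda>i. complex_of_real (\<Sum>j. (cmod (c i j))\<^sup>2)) sums of_real (\<Sum>i. \<Sum>j. (cmod (c i j))\<^sup>2)"
    using hilbert_schmidt_rows(2)[OF assms] by (intro sums_of_real summable_sums)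
  moreover have "(\<lambda>j. complex_of_real (\<Sum>i. (cmod (c i j))\<^sup>2)) sums of_real (\<Sum>j. \<Sum>i. (cmod (c i j))\<^sup>2)"
    using hilbert_schmidt_rows(2)[OF hilbert_schmidt_transpose[OF assms]] by (intro sums_of_real summable_sums)
  ultimately have "complex_of_real (\<Sum>i. \<Sum>j. (cmod (c i j))\<^sup>2) = of_real (\<Sum>j. \<Sum>i. (cmod (c i j))\<^sup>2)"
    by (simp add: sums_iff del: of_real_power)
  thus ?thesis by (simp only: of_real_eq_iff)
qed

text \<open>Moving a scalar from one vector of each pair to the other equalizes their norms. Both
  families become square summable, so that \<open>A\<close> is a product of two Hilbert-Schmidt
  matrices.\<close>

lemma nuclear_balanced:
  assumes "nuclear A c"
  shows "\<exists>x y :: nat \<Rightarrow> ell2.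
    summable (\<lambda>i. (norm (x i))\<^sup>2) \<and> summable (\<lambda>i. (norm (y i))\<^sup>2) \<and>
    (\<Sum>i. (norm (x i))\<^sup>2) \<le> c \<and> (\<Sum>i. (norm (y i))\<^sup>2) \<le> c \<and>
    summable (\<lambda>i. norm (x i) * norm (y i)) \<and>
    (\<forall>j k. (\<lambda>i. seq (x i) j * seq (y i) k) sums ent A j k)"
proof -
  obtain x y :: "nat \<Rightarrow> ell2" where xy: "summable (\<lambda>i. norm (x i) * norm (y i))"
    "(\<Sum>i. norm (x i) * norm (y i)) \<le> c" "\<And>j k. (\<lambda>i. seq (x i) j * seq (y i) k) sums ent A j k"
    using assms unfolding nuclear_def by blast
  define r where "r i = sqrt (norm (y i) / norm (x i))" for i
  define x' where "x' i = r i *\<^sub>R x i" for i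
  define y' where "y' i = inverse (r i) *\<^sub>R y i" for i
  \<comment> \<open>If \<open>x i = 0\<close> or \<open>y i = 0\<close> then \<open>r i = inverse (r i) = 0\<close>, so both rescaled vectors vanish.\<close>
  have r2: "(r i)\<^sup>2 = norm (y i) / norm (x i)" for i by (simp add: r_def)
  have nx: "(norm (x' i))\<^sup>2 = norm (x i) * norm (y i)" for i
    by (simp add: x'_def power_mult_distrib r2) (simp add: power2_eq_square)
  have ny: "(norm (y' i))\<^sup>2 = norm (x i) * norm (y i)" for i
    by (simp add: y'_def power_mult_distrib power_inverse r2) (simp add: power2_eq_square)
  have nxy: "norm (x' i) * norm (y' i) = norm (x i) * norm (y i)" for i
  proof -
    have "norm (x' i) = norm (y' i)"
      by (rule power2_eq_imp_eq) (simp_all only: nx ny norm_ge_zero)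
    thus ?thesis using nx[of i] by (simp add: power2_eq_square)
  qed
  have e: "seq (x' i) j * seq (y' i) k = seq (x i) j * seq (y i) k" for i j k
  proof (cases "x i = 0 \<or> y i = 0")
    case False
    hence "r i \<noteq> 0" by (simp add: r_def)
    thus ?thesis by (simp add: x'_def y'_def scaleR_conv_of_real)
  qed (auto simp: x'_def y'_def)
  show ?thesis by (intro exI[of _ x'] exI[of _ y']) (use xy in \<open>simp add: nx ny nxy e\<close>)
qed

text \<open>For \<open>A = C R\<close> from the balanced representation, \<open>u j\<close> is the
  norm of row \<open>j\<close> of \<open>C\<close> and \<open>v k\<close> that of column
  \<open>k\<close> of \<open>R\<close>. Their square sums equal those of \<open>norm (x i)\<close>
  and \<open>norm (y i)\<close>, so Cauchy-Schwarz keeps the total weight at most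
  \<open>c\<close>.\<close>

lemma nuclear_dominated:
  assumes "nuclear A c"
  obtains u v where "dominated (ent A) u v" "(\<Sum>j. u j * v j) \<le> c"
proof -
  obtain x y :: "nat \<Rightarrow> ell2" where xy:
    "summable (\<lambda>i. (norm (x i))\<^sup>2)" "summable (\<lambda>i. (norm (y i))\<^sup>2)"
    "(\<Sum>i. (norm (x i))\<^sup>2) \<le> c" "(\<Sum>i. (norm (y i))\<^sup>2) \<le> c"
    "summable (\<lambda>i. norm (x i) * norm (y i))"
    "\<And>j k. (\<lambda>i. seq (x i) j * seq (y i) k) sums ent A j k"
    using nuclear_balanced[OF assms] by blast
  define C where "C = (\<lambda>j i. seq (x i) j)"
  define R where "R = (\<lambda>i k. seq (y i) k)"
  have R: "hilbert_schmidt R" unfolding R_def by (rule hilbert_schmidt_family[OF xy(2)])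
  have Ct: "hilbert_schmidt (\<lambda>i j. C j i)" unfolding C_def by (rule hilbert_schmidt_family[OF xy(1)])
  have C: "hilbert_schmidt C" using hilbert_schmidt_transpose[OF Ct] .
  define u where "u = (\<lambda>j. sqrt (\<Sum>i. (cmod (C j i))\<^sup>2))"
  define v where "v = (\<lambda>k. sqrt (\<Sum>i. (cmod (R i k))\<^sup>2))"
  have "ent A = (\<lambda>j k. \<Sum>i. C j i * R i k)"
    using xy(6) by (simp add: C_def R_def sums_iff fun_eq_iff)
  hence dom: "dominated (ent A) u v"
    using hilbert_schmidt_mult(1)[OF C R] by (simp add: u_def v_def)
  have c0: "c \<ge> 0" by (rule nuclear_nonneg[OF assms])
  have rows: "0 \<le> (\<Sum>i. (cmod (C j i))\<^sup>2)" "0 \<le> (\<Sum>i. (cmod (R i j))\<^sup>2)" for j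
    using hilbert_schmidt_rows(1)[OF C] hilbert_schmidt_rows(1)[OF hilbert_schmidt_transpose[OF R]]
    by (auto intro!: suminf_nonneg)
  have "(\<Sum>j. (u j)\<^sup>2) = (\<Sum>j. \<Sum>i. (cmod (C j i))\<^sup>2)"
    using rows by (simp add: u_def)
  also have "\<dots> = (\<Sum>i. (norm (x i))\<^sup>2)"
    unfolding hilbert_schmidt_suminf_swap[OF C] by (simp add: C_def norm_ell2_square)
  finally have u: "(\<Sum>j. (u j)\<^sup>2) \<le> c" using xy by simp
  have "(\<Sum>j. (v j)\<^sup>2) = (\<Sum>j. \<Sum>i. (cmod (R i j))\<^sup>2)"
    using rows by (simp add: v_def)
  also have "\<dots> = (\<Sum>i. (norm (y i))\<^sup>2)"
    unfolding hilbert_schmidt_suminf_swap[OF R, symmetric] by (simp add: R_def norm_ell2_square)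
  finally have v: "(\<Sum>j. (v j)\<^sup>2) \<le> c" using xy by simp
  have "(\<Sum>j. cmod (complex_of_real (u j) * complex_of_real (v j)))
      \<le> sqrt (\<Sum>j. (cmod (complex_of_real (u j)))\<^sup>2) * sqrt (\<Sum>j. (cmod (complex_of_real (v j)))\<^sup>2)"
    using dom by (intro Cauchy_Schwarz_series(2)) (auto simp: dominated_def)
  also have "\<dots> \<le> sqrt c * sqrt c"
    using u v c0 dom by (intro mult_mono real_sqrt_le_mono) (auto intro!: suminf_nonneg simp: dominated_def)
  also have "\<dots> = c" using c0 by simp
  finally have "(\<Sum>j. u j * v j) \<le> c" using dom by (simp add: norm_mult dominated_def)
  with dom show ?thesis by (rule that)
qed

section \<open>Determinant and trace of nuclear operators\<close>

abbreviation det1 :: "clop \<Rightarrow> complex" where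
  "det1 A \<equiv> fdet (ent A)"

abbreviation trc :: "clop \<Rightarrow> complex" where
  "trc A \<equiv> op_trace (blf A)"

lemma det1_mult:
  assumes "nuclear A c" "nuclear B d"
  shows "det1 (A + B + A * B) = det1 A * det1 B"
proof -
  obtain u v where a: "dominated (ent A) u v" using nuclear_dominated[OF assms(1)] by metis
  obtain u' v' where b: "dominated (ent B) u' v'" using nuclear_dominated[OF assms(2)] by metis
  have "ent (A + B + A * B) = (\<lambda>i j. ent A i j + ent B i j + (\<Sum>l. ent A i l * ent B l j))"
    using ent_mult[of A _ B] by (simp add: fun_eq_iff sums_iff)
  thus ?thesis using fdet_mult[OF a b] by simp
qed

text \<open>\<open>X\<close> is merely bounded, so it is attached to a Hilbert-Schmidt factor of
  \<open>A = C R\<close>: \<open>X A = C' R\<close> with \<open>C' = X C\<close>, and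
  \<open>A X = C R'\<close> with \<open>R' = R X\<close>. The last equation holds because
  \<open>R C'\<close> and \<open>R' C\<close> are both \<open>R X C\<close>.\<close>

lemma nuclear_mult_factors:
  assumes "nuclear A c"
  obtains C R C' R' where
    "hilbert_schmidt C" "hilbert_schmidt R" "hilbert_schmidt C'" "hilbert_schmidt R'"
    "ent (X * A) = (\<lambda>j k. \<Sum>i. C' j i * R i k)" "ent (A * X) = (\<lambda>j k. \<Sum>i. C j i * R' i k)"
    "(\<lambda>i k. \<Sum>l. R i l * C' l k) = (\<lambda>i k. \<Sum>l. R' i l * C l k)"
proof -
  obtain x y :: "nat \<Rightarrow> ell2" where xy:
    "summable (\<lambda>i. (norm (x i))\<^sup>2)" "summable (\<lambda>i. (norm (y i))\<^sup>2)"
    "(\<Sum>i. (norm (x i))\<^sup>2) \<le> c" "(\<Sum>i. (norm (y i))\<^sup>2) \<le> c"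
    "summable (\<lambda>i. norm (x i) * norm (y i))"
    "\<And>j k. (\<lambda>i. seq (x i) j * seq (y i) k) sums ent A j k"
    using nuclear_balanced[OF assms] by blast
  have sX: "summable (\<lambda>i. (norm (ap Y (z i)))\<^sup>2)" if "summable (\<lambda>i. (norm (z i))\<^sup>2)" for Y and z :: "nat \<Rightarrow> ell2"
  proof (rule summable_comparison_test'[OF summable_mult[OF that, of "(norm Y)\<^sup>2"]])
    show "norm ((norm (ap Y (z i)))\<^sup>2) \<le> (norm Y)\<^sup>2 * (norm (z i))\<^sup>2" for i
      using power_mono[OF norm_ap_le[of Y "z i"], of 2] by (simp add: power_mult_distrib)
  qed
  let ?C = "\<lambda>j i. seq (x i) j" and ?R = "\<lambda>i k. seq (y i) k"
  let ?C' = "\<lambda>j i. seq (ap X (x i)) j" and ?R' = "\<lambda>i k. seq (ap (transp X) (y i)) k"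
  show ?thesis
  proof (rule that[of ?C ?R ?C' ?R'])
    show "hilbert_schmidt ?R" "hilbert_schmidt ?R'" by (intro hilbert_schmidt_family xy sX)+
    show "hilbert_schmidt ?C"
      using hilbert_schmidt_transpose[OF hilbert_schmidt_family[OF xy(1)]] .
    show "hilbert_schmidt ?C'"
      using hilbert_schmidt_transpose[OF hilbert_schmidt_family[OF sX[OF xy(1)]]] .
    show "ent (X * A) = (\<lambda>j k. \<Sum>i. ?C' j i * ?R i k)"
      using nuclear_representation_left[OF xy(5,6), of X] by (simp add: fun_eq_iff sums_iff)
    have "(\<lambda>i. seq (ap (transp X) (y i)) k * seq (x i) j) sums ent (transp X * transp A) k j" for j k
      by (rule nuclear_representation_left) (use xy(5,6) in \<open>simp_all add: mult.commute\<close>)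
    thus "ent (A * X) = (\<lambda>j k. \<Sum>i. ?C j i * ?R' i k)"
      unfolding transp_mult[symmetric] by (simp add: fun_eq_iff sums_iff mult.commute)
    show "(\<lambda>i k. \<Sum>l. ?R i l * ?C' l k) = (\<lambda>i k. \<Sum>l. ?R' i l * ?C l k)"
      using bp_transp[of _ X] by (simp add: bp_def)
  qed
qed

text \<open>The chain of products is \<open>C' R\<close>, \<open>R C'\<close>, \<open>R' C\<close>,
  \<open>C R'\<close>: the outer steps exchange two Hilbert-Schmidt factors, the middle one is an
  equality of matrices.\<close>

lemma det1_commute:
  assumes "nuclear A c"
  shows "det1 (X * A) = det1 (A * X)"
  using assms
proof (rule nuclear_mult_factors[where X = X])
  fix C R C' R'
  assume "hilbert_schmidt C" "hilbert_schmidt R" "hilbert_schmidt C'" "hilbert_schmidt R'"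
    "ent (X * A) = (\<lambda>j k. \<Sum>i. C' j i * R i k)" "ent (A * X) = (\<lambda>j k. \<Sum>i. C j i * R' i k)"
    "(\<lambda>i k. \<Sum>l. R i l * C' l k) = (\<lambda>i k. \<Sum>l. R' i l * C l k)"
  thus ?thesis using fdet_mult_commute[of C' R] fdet_mult_commute[of C R'] by simp
qed

lemma trc_commute:
  assumes "nuclear A c"
  shows "trc (X * A) = trc (A * X)"
  using assms
proof (rule nuclear_mult_factors[where X = X])
  fix C R C' R'
  assume "hilbert_schmidt C" "hilbert_schmidt R" "hilbert_schmidt C'" "hilbert_schmidt R'"
    "ent (X * A) = (\<lambda>j k. \<Sum>i. C' j i * R i k)" "ent (A * X) = (\<lambda>j k. \<Sum>i. C j i * R' i k)"
    and eq: "(\<lambda>i k. \<Sum>l. R i l * C' l k) = (\<lambda>i k. \<Sum>l. R' i l * C l k)"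
  moreover have "(\<Sum>l. R n l * C' l n) = (\<Sum>l. R' n l * C l n)" for n
    using eq by meson
  ultimately show ?thesis using trace_mult_commute[of C' R] trace_mult_commute[of C R']
    by (simp add: op_trace_def)
qed

lemma trc_bound:
  assumes "nuclear A c"
  shows "summable (\<lambda>n. ent A n n)" "cmod (trc A) \<le> c"
proof -
  obtain u v where dom: "dominated (ent A) u v" and le: "(\<Sum>j. u j * v j) \<le> c"
    by (rule nuclear_dominated[OF assms])
  have s: "summable (\<lambda>j. u j * v j)" by (rule dominated_weight_summable[OF dom])
  have b: "cmod (ent A n n) \<le> u n * v n" for n using dom by (simp add: dominated_def)
  have sn: "summable (\<lambda>n. cmod (ent A n n))" by (rule summable_comparison_test'[OF s]) (simp add: b)
  thus "summable (\<lambda>n. ent A n n)" by (rule summable_norm_cancel)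
  have "cmod (trc A) \<le> (\<Sum>n. cmod (ent A n n))" unfolding op_trace_def by (rule summable_norm[OF sn])
  also have "\<dots> \<le> (\<Sum>j. u j * v j)" by (intro suminf_le b sn s)
  finally show "cmod (trc A) \<le> c" using le by simp
qed

lemma trc_add: "nuclear A c \<Longrightarrow> nuclear B d \<Longrightarrow> trc (A + B) = trc A + trc B"
  by (simp add: op_trace_def suminf_add[OF trc_bound(1) trc_bound(1)])

lemma trc_scaleR: "nuclear A c \<Longrightarrow> trc (r *\<^sub>R A) = of_real r * trc A"
  using suminf_mult[OF trc_bound(1), of A c "of_real r"] by (simp add: op_trace_def scaleR_conv_of_real[where 'a = complex])

lemma trc_diff: "nuclear A c \<Longrightarrow> nuclear B d \<Longrightarrow> trc (A - B) = trc A - trc B"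
  by (simp add: op_trace_def suminf_diff[OF trc_bound(1) trc_bound(1)])

lemma det1_estimate:
  assumes "nuclear A c" "c < 1"
  shows "cmod (det1 A - 1 - trc A) \<le> c\<^sup>2 / (1 - c)"
proof -
  obtain u v where "dominated (ent A) u v" "(\<Sum>j. u j * v j) \<le> c"
    by (rule nuclear_dominated[OF assms(1)])
  from norm_fdet_minus_le[OF this assms(2)] show ?thesis by (simp add: op_trace_def)
qed

section \<open>Trace class operators are nuclear\<close>

definition conj_ell2 :: "ell2 \<Rightarrow> ell2" where
  "conj_ell2 x = Abs_ell2 (\<lambda>n. cnj (seq x n))"

lemma seq_conj_ell2 [simp]: "seq (conj_ell2 x) n = cnj (seq x n)"
  using summable_seq[of x] by (simp add: conj_ell2_def Abs_ell2_inverse)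

lemma norm_conj_ell2 [simp]: "norm (conj_ell2 x) = norm x"
  by (simp add: norm_ell2_def)

lemma inner_eq_Re_bp: "inner x y = Re (bp (conj_ell2 y) x)"
proof -
  have "(\<lambda>n. Re (seq (conj_ell2 y) n * seq x n)) sums Re (bp (conj_ell2 y) x)"
    by (rule sums_Re[OF bp_sums])
  thus ?thesis by (simp add: inner_ell2_def inner_complex_def sums_iff algebra_simps)
qed

text \<open>As \<open>bp\<close> is bilinear, the orthogonal projection onto a unit vector
  \<open>w\<close> is \<open>rank_one w (conj_ell2 w)\<close>.\<close>

definition rank_one :: "ell2 \<Rightarrow> ell2 \<Rightarrow> clop" where
  "rank_one x y = Abs_clop (Blinfun (\<lambda>z. scaleC (bp y z) x))"

lemma ap_rank_one [simp]: "ap (rank_one x y) z = scaleC (bp y z) x"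
proof -
  have "bounded_linear (\<lambda>z. scaleC (bp y z) x)"
  proof (rule bounded_linear_intro)
    show "scaleC (bp y (r *\<^sub>R z)) x = r *\<^sub>R scaleC (bp y z) x" for r z
      by (rule ell2_eqI) (simp add: linear_scale[OF bounded_linear.linear[OF bounded_linear_bp]] scaleR_conv_of_real)
    show "norm (scaleC (bp y z) x) \<le> norm z * (norm y * norm x)" for z
      using mult_right_mono[OF norm_bp_le[of y z], of "norm x"] by (simp add: norm_scaleC mult_ac)
  qed (simp add: bp_add scaleC_add_left)
  hence *: "blinfun_apply (Blinfun (\<lambda>z. scaleC (bp y z) x)) = (\<lambda>z. scaleC (bp y z) x)"
    by (rule bounded_linear_Blinfun_apply)
  hence "complex_linear (Blinfun (\<lambda>z. scaleC (bp y z) x))"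
    by (simp add: complex_linear_def bp_scaleC scaleC_scaleC)
  thus ?thesis by (simp add: rank_one_def Abs_clop_inverse *)
qed

lemma nuclear_rank_one: "nuclear (rank_one x y) (norm x * norm y)"
  unfolding nuclear_def
proof (intro exI conjI allI)
  let ?x = "\<lambda>i :: nat. if i = 0 then x else 0" and ?y = "\<lambda>i :: nat. if i = 0 then y else 0"
  have "(\<lambda>i. norm (?x i) * norm (?y i)) sums (\<Sum>i\<in>{0}. norm (?x i) * norm (?y i))"
    by (rule sums_finite) auto
  thus "summable (\<lambda>i. norm (?x i) * norm (?y i))" "(\<Sum>i. norm (?x i) * norm (?y i)) \<le> norm x * norm y"
    by (simp_all add: sums_iff)
  fix j k
  have "bp y (basis_vec k) = seq y k"
  proof -
    have "(\<lambda>n. seq y n * seq (basis_vec k) n) sums (\<Sum>n\<in>{k}. seq y n * seq (basis_vec k) n)"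
      by (rule sums_finite) (auto simp: seq_basis_vec)
    thus ?thesis using sums_unique2[OF bp_sums] by (force simp: seq_basis_vec)
  qed
  moreover have "(\<lambda>i. seq (?x i) j * seq (?y i) k) sums (\<Sum>i\<in>{0}. seq (?x i) j * seq (?y i) k)"
    by (rule sums_finite) auto
  ultimately show "(\<lambda>i. seq (?x i) j * seq (?y i) k) sums ent (rank_one x y) j k"
    by (simp add: entry_def mult.commute)
qed

lemma rank_le_mono:
  assumes "rank_le m F" "m \<le> n"
  shows "rank_le n F"
proof -
  obtain v :: "nat \<Rightarrow> ell2" where v: "\<And>x. \<exists>c. blinfun_apply F x = (\<Sum>i<m. scaleC (c i) (v i))"
    using assms(1) unfolding rank_le_def by blast
  have "\<exists>c. blinfun_apply F x = (\<Sum>i<n. scaleC (c i) (v i))" for x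
  proof -
    obtain c where c: "blinfun_apply F x = (\<Sum>i<m. scaleC (c i) (v i))" using v by blast
    also have "\<dots> = (\<Sum>i<m. scaleC (if i < m then c i else 0) (v i))" by (intro sum.cong) auto
    also have "\<dots> = (\<Sum>i<n. scaleC (if i < m then c i else 0) (v i))"
      using assms(2) by (intro sum.mono_neutral_left) (auto simp: scaleC_zero_left)
    finally show ?thesis by (intro exI[of _ "\<lambda>i. if i < m then c i else 0"])
  qed
  thus ?thesis unfolding rank_le_def by blast
qed

lemma rank_le_add:
  assumes "rank_le m F" "rank_le n G"
  shows "rank_le (m + n) (F + G)"
proof -
  obtain v w :: "nat \<Rightarrow> ell2" where v: "\<And>x. \<exists>c. blinfun_apply F x = (\<Sum>i<m. scaleC (c i) (v i))"
    and w: "\<And>x. \<exists>c. blinfun_apply G x = (\<Sum>i<n. scaleC (c i) (w i))"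
    using assms unfolding rank_le_def by blast
  have "\<exists>c. blinfun_apply (F + G) x = (\<Sum>i<m + n. scaleC (c i) (if i < m then v i else w (i - m)))" for x
  proof -
    obtain c d where c: "blinfun_apply F x = (\<Sum>i<m. scaleC (c i) (v i))"
      and d: "blinfun_apply G x = (\<Sum>i<n. scaleC (d i) (w i))" using v w by blast
    have "(\<Sum>i<m + n. scaleC (if i < m then c i else d (i - m)) (if i < m then v i else w (i - m)))
       = (\<Sum>i<m. scaleC (c i) (v i)) + (\<Sum>i<n. scaleC (d i) (w i))"
    proof -
      have "{..<m + n} = {..<m} \<union> (\<lambda>i. m + i) ` {..<n}"
      proof (intro equalityI subsetI)
        fix i assume "i \<in> {..<m + n}"
        thus "i \<in> {..<m} \<union> (\<lambda>i. m + i) ` {..<n}"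
          by (cases "i < m") (auto intro!: image_eqI[of _ _ "i - m"])
      qed auto
      moreover have "{..<m} \<inter> (\<lambda>i. m + i) ` {..<n} = {}" by auto
      ultimately show ?thesis by (simp add: sum.union_disjoint sum.reindex)
    qed
    thus ?thesis by (intro exI[of _ "\<lambda>i. if i < m then c i else d (i - m)"]) (simp add: blinfun.add_left c d)
  qed
  thus ?thesis unfolding rank_le_def
    by (intro exI[of _ "\<lambda>i. if i < m then v i else w (i - m)"]) blast
qed

lemma rank_le_uminus: "rank_le n F \<Longrightarrow> rank_le n (- F)"
proof -
  assume "rank_le n F"
  then obtain v :: "nat \<Rightarrow> ell2" where v: "\<And>x. \<exists>c. blinfun_apply F x = (\<Sum>i<n. scaleC (c i) (v i))"
    unfolding rank_le_def by blast
  have "\<exists>c. blinfun_apply (- F) x = (\<Sum>i<n. scaleC (c i) (- v i))" for x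
    using v[of x] by (auto simp: blinfun.minus_left scaleC_minus_right sum_negf)
  thus ?thesis unfolding rank_le_def by (intro exI[of _ "\<lambda>i. - v i"]) blast
qed

lemma rank_le_mult_left: "rank_le n (blf F) \<Longrightarrow> rank_le n (blf (X * F))"
proof -
  assume "rank_le n (blf F)"
  then obtain v :: "nat \<Rightarrow> ell2" where v: "\<And>x. \<exists>c. ap F x = (\<Sum>i<n. scaleC (c i) (v i))"
    unfolding rank_le_def by blast
  have "\<exists>c. ap (X * F) x = (\<Sum>i<n. scaleC (c i) (ap X (v i)))" for x
    using v[of x] by (auto simp: blinfun.sum_right ap_scaleC)
  thus ?thesis unfolding rank_le_def by (intro exI[of _ "\<lambda>i. ap X (v i)"]) blast
qed

lemma rank_le_mult_right: "rank_le n (blf F) \<Longrightarrow> rank_le n (blf (F * X))"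
  unfolding rank_le_def by simp meson

text \<open>One dimension is split off by the orthogonal projection \<open>P\<close> onto the last
  spanning vector: \<open>P * F\<close> costs one \<open>norm F\<close>, while
  \<open>(1 - P) * F\<close> has rank at most \<open>r\<close> and norm at most
  \<open>norm F\<close>. That \<open>1 - P\<close> is a contraction keeps the constant linear in the
  rank.\<close>

lemma nuclear_rank_le: "rank_le r (blf F) \<Longrightarrow> nuclear F (real r * norm F)"
proof (induction r arbitrary: F)
  case 0
  hence "ap F x = 0" for x by (auto simp: rank_le_def)
  hence "F = 0" by (intro clop_eqI) (simp add: entry_def)
  thus ?case using nuclear_zero by simp
next
  case (Suc r)
  obtain v :: "nat \<Rightarrow> ell2" where v: "\<And>x. \<exists>c. ap F x = (\<Sum>i<Suc r. scaleC (c i) (v i))"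
    using Suc.prems unfolding rank_le_def by blast
  show ?case
  proof (cases "v r = 0")
    case True
    hence "\<exists>c. ap F x = (\<Sum>i<r. scaleC (c i) (v i))" for x
      using v[of x] by (simp add: scaleC_zero_right)
    hence "rank_le r (blf F)" unfolding rank_le_def by blast
    from Suc.IH[OF this] show ?thesis by (rule nuclear_mono) (simp add: mult_right_mono)
  next
    case False
    define w where "w = inverse (norm (v r)) *\<^sub>R v r"
    have nw: "norm w = 1" using False by (simp add: w_def)
    define P where "P = rank_one w (conj_ell2 w)"
    have bw: "bp (conj_ell2 w) w = 1"
    proof -
      have "(\<lambda>n. seq (conj_ell2 w) n * seq w n) = (\<lambda>n. complex_of_real ((cmod (seq w n))\<^sup>2))"
        unfolding complex_norm_square by (simp add: mult.commute)
      moreover have "(\<lambda>n. complex_of_real ((cmod (seq w n))\<^sup>2)) sums of_real ((norm w)\<^sup>2)"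
        unfolding norm_ell2_square by (intro sums_of_real summable_sums summable_seq)
      ultimately show ?thesis using sums_unique2[OF bp_sums] nw by fastforce
    qed
    have le: "norm (ap (1 - P) z) \<le> norm z" for z
    proof -
      define u where "u = ap (1 - P) z"
      have "bp (conj_ell2 w) u = bp (conj_ell2 w) z - bp (conj_ell2 w) (scaleC (bp (conj_ell2 w) z) w)"
        by (simp add: u_def P_def linear_diff[OF bounded_linear.linear[OF bounded_linear_bp]])
      hence bu: "bp (conj_ell2 w) u = 0" by (simp add: bp_scaleC bw)
      \<comment> \<open>The type-class inner product is only the real part of the complex one, so
        orthogonality is established against every complex multiple of \<open>w\<close>; these make
        up the range of \<open>P\<close>.\<close>
      have "inner u (scaleC d w) = 0" for d
      proof -
        have "inner (scaleC d w) u = Re (bp (conj_ell2 u) (scaleC d w))" by (rule inner_eq_Re_bp)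
        moreover have "bp (conj_ell2 u) w = cnj (bp (conj_ell2 w) u)"
        proof -
          have "(\<lambda>n. cnj (seq (conj_ell2 w) n * seq u n)) sums cnj (bp (conj_ell2 w) u)"
            using bp_sums by (simp only: sums_cnj)
          thus ?thesis using sums_unique2[OF bp_sums[of "conj_ell2 u" w]] by (simp add: mult.commute)
        qed
        ultimately show ?thesis using bu by (simp add: bp_scaleC inner_commute)
      qed
      hence "(norm (u + ap P z))\<^sup>2 = (norm u)\<^sup>2 + (norm (ap P z))\<^sup>2"
        by (intro norm_add_Pythagorean) (simp add: real_inner_class.orthogonal_def P_def)
      hence "(norm u)\<^sup>2 \<le> (norm z)\<^sup>2" by (simp add: u_def)
      thus ?thesis unfolding u_def by (rule power2_le_imp_le) simp
    qed
    define G where "G = (1 - P) * F"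
    have "norm (1 - P) \<le> 1" by (rule norm_clop_bound) (use le in auto)
    hence nG: "norm G \<le> norm F"
      unfolding G_def using norm_mult_ineq[of "1 - P" F] mult_right_mono[of "norm (1 - P)" 1 "norm F"] by simp
    have "\<exists>c. ap G x = (\<Sum>i<r. scaleC (c i) (ap (1 - P) (v i)))" for x
    proof -
      obtain c where c: "ap F x = (\<Sum>i<Suc r. scaleC (c i) (v i))" using v by blast
      have "ap (1 - P) w = 0" by (simp add: P_def bw scaleC_one)
      moreover have "v r = norm (v r) *\<^sub>R w" using False by (simp add: w_def)
      ultimately have "ap (1 - P) (v r) = 0"
        using blinfun.scaleR_right[of "blf (1 - P)" "norm (v r)" w] by simp
      moreover have "ap G x = (\<Sum>i<r. scaleC (c i) (ap (1 - P) (v i))) + scaleC (c r) (ap (1 - P) (v r))"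
        by (simp only: G_def ap_simps(6) c sum.lessThan_Suc blinfun.add_right blinfun.sum_right ap_scaleC)
      ultimately have "ap G x = (\<Sum>i<r. scaleC (c i) (ap (1 - P) (v i)))"
        by (simp only: scaleC_zero_right add_0_right)
      thus ?thesis by blast
    qed
    hence "rank_le r (blf G)" unfolding rank_le_def by (intro exI[of _ "\<lambda>i. ap (1 - P) (v i)"]) blast
    hence "nuclear G (real r * norm G)" by (rule Suc.IH)
    hence "nuclear G (real r * norm F)" by (rule nuclear_mono) (intro mult_left_mono nG, simp)
    moreover have "nuclear P 1" using nuclear_rank_one[of w "conj_ell2 w"] nw by (simp add: P_def)
    hence "nuclear (P * F) (norm F)" using nuclear_mult_right[of P 1 F] by simp
    ultimately have "nuclear (G + P * F) (real r * norm F + norm F)" by (rule nuclear_add)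
    thus ?thesis by (simp add: G_def algebra_simps)
  qed
qed

section \<open>Approximation numbers and the trace class ideal\<close>

abbreviation tc :: "clop \<Rightarrow> bool" where
  "tc A \<equiv> trace_class (blf A)"

abbreviation sing :: "clop \<Rightarrow> nat \<Rightarrow> real" where
  "sing A \<equiv> singular_number (blf A)"

lemma tc_iff: "tc A \<longleftrightarrow> summable (sing A)"
  by (simp add: trace_class_def complex_linear_blf)

lemma sing_le: "rank_le n (blf F) \<Longrightarrow> sing A n \<le> norm (A - F)"
proof -
  assume "rank_le n (blf F)"
  hence "norm (A - F) \<in> {norm (blf A - F') |F'. complex_linear F' \<and> rank_le n F'}"
    using complex_linear_blf[of F] by (auto simp: norm_clop.rep_eq minus_clop.rep_eq)
  thus ?thesis unfolding singular_number_def
    by (intro cInf_lower) (auto intro!: bdd_belowI[of _ 0])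
qed

lemma rank_le_zero: "rank_le n (blf 0)"
  unfolding rank_le_def by (auto intro!: exI[of _ "\<lambda>_. 0"] simp: scaleC_zero_right zero_clop.rep_eq)

lemma sing_approx:
  assumes "sing A n < e"
  obtains F where "rank_le n (blf F)" "norm (A - F) < e"
proof -
  have "norm (A - 0) \<in> {norm (blf A - F') |F'. complex_linear F' \<and> rank_le n F'}"
    using complex_linear_blf[of 0] rank_le_zero[of n] unfolding norm_clop.rep_eq minus_clop.rep_eq by blast
  hence "{norm (blf A - F') |F'. complex_linear F' \<and> rank_le n F'} \<noteq> {}" by blast
  from cInf_lessD[OF this assms[unfolded singular_number_def]]
  obtain F' where F': "complex_linear F'" "rank_le n F'" "norm (blf A - F') < e" by blast
  hence "blf (Abs_clop F') = F'" by (simp add: Abs_clop_inverse)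
  with F' show ?thesis by (intro that[of "Abs_clop F'"]) (auto simp: norm_clop.rep_eq minus_clop.rep_eq)
qed

lemma sing_nonneg: "0 \<le> sing A n"
proof (rule ccontr)
  assume "\<not> 0 \<le> sing A n"
  then obtain F where "norm (A - F) < 0" using sing_approx[of A n 0] by force
  thus False by simp
qed

lemma sing_antimono: "m \<le> n \<Longrightarrow> sing A n \<le> sing A m"
proof (rule field_le_epsilon)
  fix e :: real assume mn: "m \<le> n" and "e > 0"
  then obtain F where F: "rank_le m (blf F)" "norm (A - F) < sing A m + e"
    using sing_approx[of A m "sing A m + e"] by auto
  have "sing A n \<le> norm (A - F)" by (rule sing_le[OF rank_le_mono[OF F(1) mn]])
  with F(2) show "sing A n \<le> sing A m + e" by simp
qed

lemma sing_add: "sing (A + B) (m + n) \<le> sing A m + sing B n"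
proof (rule field_le_epsilon)
  fix e :: real assume e: "e > 0"
  obtain F where F: "rank_le m (blf F)" "norm (A - F) < sing A m + e / 2"
    using sing_approx[of A m "sing A m + e / 2"] e by auto
  obtain G where G: "rank_le n (blf G)" "norm (B - G) < sing B n + e / 2"
    using sing_approx[of B n "sing B n + e / 2"] e by auto
  have "rank_le (m + n) (blf (F + G))"
    using rank_le_add[OF F(1) G(1)] by (simp add: plus_clop.rep_eq)
  hence "sing (A + B) (m + n) \<le> norm (A + B - (F + G))" by (rule sing_le)
  also have "\<dots> \<le> norm (A - F) + norm (B - G)"
    using norm_triangle_ineq[of "A - F" "B - G"] by (simp add: algebra_simps)
  finally show "sing (A + B) (m + n) \<le> sing A m + sing B n + e" using F(2) G(2) by simp
qed

lemma sing_mult_le: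
  assumes "\<And>F. rank_le n (blf F) \<Longrightarrow> \<exists>G. rank_le n (blf G) \<and> norm (B - G) \<le> K * norm (A - F)" "0 \<le> K"
  shows "sing B n \<le> K * sing A n"
proof (rule field_le_epsilon)
  fix e :: real assume e: "e > 0"
  \<comment> \<open>The denominator \<open>K + 1\<close> covers the case
    \<open>K = 0\<close>.\<close>
  obtain F where F: "rank_le n (blf F)" "norm (A - F) < sing A n + e / (K + 1)"
    using sing_approx[of A n "sing A n + e / (K + 1)"] e assms(2) by auto
  obtain G where G: "rank_le n (blf G)" "norm (B - G) \<le> K * norm (A - F)" using assms(1)[OF F(1)] by blast
  have "sing B n \<le> norm (B - G)" by (rule sing_le[OF G(1)])
  also have "\<dots> \<le> K * (sing A n + e / (K + 1))"
    using G(2) mult_left_mono[OF less_imp_le[OF F(2)] assms(2)] by linarith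
  also have "\<dots> \<le> K * sing A n + e"
    using assms(2) e by (simp add: distrib_left divide_le_eq mult_left_mono)
  finally show "sing B n \<le> K * sing A n + e" .
qed

lemma tc_mult_left: assumes "tc A" shows "tc (X * A)"
  unfolding tc_iff
proof (rule summable_comparison_test'[OF summable_mult[OF assms[unfolded tc_iff], of "norm X"]])
  fix n
  have "sing (X * A) n \<le> norm X * sing A n"
  proof (rule sing_mult_le)
    fix F assume "rank_le n (blf F)"
    moreover have "norm (X * A - X * F) \<le> norm X * norm (A - F)"
      using norm_mult_ineq[of X "A - F"] by (simp add: right_diff_distrib)
    ultimately show "\<exists>G. rank_le n (blf G) \<and> norm (X * A - G) \<le> norm X * norm (A - F)"
      using rank_le_mult_left by blast
  qed simp
  thus "norm (sing (X * A) n) \<le> norm X * sing A n" using sing_nonneg[of "X * A" n] by simp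
qed

lemma tc_mult_right: assumes "tc A" shows "tc (A * X)"
  unfolding tc_iff
proof (rule summable_comparison_test'[OF summable_mult[OF assms[unfolded tc_iff], of "norm X"]])
  fix n
  have "sing (A * X) n \<le> norm X * sing A n"
  proof (rule sing_mult_le)
    fix F assume "rank_le n (blf F)"
    moreover have "norm (A * X - F * X) \<le> norm X * norm (A - F)"
      using norm_mult_ineq[of "A - F" X] by (simp add: left_diff_distrib mult.commute)
    ultimately show "\<exists>G. rank_le n (blf G) \<and> norm (A * X - G) \<le> norm X * norm (A - F)"
      using rank_le_mult_right by blast
  qed simp
  thus "norm (sing (A * X) n) \<le> norm X * sing A n" using sing_nonneg[of "A * X" n] by simp
qed

lemma summable_div2:
  fixes f :: "nat \<Rightarrow> real"
  assumes "summable f" "\<And>n. f n \<ge> 0"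
  shows "summable (\<lambda>n. f (n div 2))"
proof (rule summableI_nonneg_bounded)
  fix n
  have "(\<Sum>i<n. f (i div 2)) \<le> (\<Sum>i<2 * n. f (i div 2))"
    by (rule sum_mono2) (use assms in auto)
  also have "\<dots> = 2 * (\<Sum>i<n. f i)" by (induction n) auto
  also have "\<dots> \<le> 2 * suminf f" using sum_le_suminf[OF assms(1), of "{..<n}"] assms(2) by simp
  finally show "(\<Sum>i<n. f (i div 2)) \<le> 2 * suminf f" .
qed (use assms in auto)

text \<open>Half of the available rank goes to each summand; halving the index at most doubles the
  sum of the approximation numbers.\<close>

lemma tc_add: assumes "tc A" "tc B" shows "tc (A + B)"
  unfolding tc_iff
proof (rule summable_comparison_test')
  show "summable (\<lambda>n. sing A (n div 2) + sing B (n div 2))"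
    using assms unfolding tc_iff by (intro summable_add summable_div2 sing_nonneg)
  fix n
  have "sing (A + B) n \<le> sing (A + B) (n div 2 + n div 2)" by (rule sing_antimono) simp
  also have "\<dots> \<le> sing A (n div 2) + sing B (n div 2)" by (rule sing_add)
  finally show "norm (sing (A + B) n) \<le> sing A (n div 2) + sing B (n div 2)"
    using sing_nonneg[of "A + B" n] by simp
qed

lemma tc_uminus: "tc A \<Longrightarrow> tc (- A)"
  using tc_mult_left[of A "- 1"] by simp

lemma tc_diff: "tc A \<Longrightarrow> tc B \<Longrightarrow> tc (A - B)"
  using tc_add[OF _ tc_uminus, of A B] by simp

text \<open>Approximants \<open>F k\<close> of rank at most \<open>2 ^ k\<close> telescope to
  \<open>A\<close>. Consecutive ones differ by rank at most \<open>3 * 2 ^ k\<close> and in norm by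
  about \<open>2 * sing A (2 ^ k)\<close>, so \<open>nuclear_rank_le\<close> gives terms of size
  \<open>2 ^ k * sing A (2 ^ k)\<close>, summable by Cauchy condensation.\<close>

lemma tc_nuclear: assumes "tc A" obtains c where "nuclear A c"
proof -
  have s: "summable (sing A)" using assms by (simp add: tc_iff)
  have s2: "summable (\<lambda>k. 2 ^ k * sing A (2 ^ k))"
    using s condensation_test[of "sing A"] sing_nonneg sing_antimono[of _ "Suc _"] by (simp add: sing_antimono)
  \<comment> \<open>The slack \<open>(1 / 4) ^ k\<close> stays summable after multiplication by the
    rank \<open>2 ^ k\<close>.\<close>
  have "\<exists>F. rank_le (2 ^ k) (blf F) \<and> norm (A - F) < sing A (2 ^ k) + (1 / 4) ^ k" for k
    using sing_approx[of A "2 ^ k" "sing A (2 ^ k) + (1 / 4) ^ k"] by auto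
  then obtain F where F: "\<And>k. rank_le (2 ^ k) (blf (F k))"
    "\<And>k. norm (A - F k) < sing A (2 ^ k) + (1 / 4) ^ k" by metis
  \<comment> \<open>The factor 6 is 3 from the rank bound \<open>2 ^ Suc k + 2 ^ k\<close> times 2
    from two approximation errors.\<close>
  define c where "c k = 6 * (2 ^ k * sing A (2 ^ k)) + 6 * (1 / 2) ^ k" for k :: nat
  have "nuclear (F (Suc k) - F k) (c k)" for k
  proof -
    have "rank_le (2 ^ Suc k + 2 ^ k) (blf (F (Suc k) - F k))"
      using rank_le_add[OF F(1)[of "Suc k"] rank_le_uminus[OF F(1)[of k]]]
      by (simp add: minus_clop.rep_eq)
    hence "nuclear (F (Suc k) - F k) (real (2 ^ Suc k + 2 ^ k) * norm (F (Suc k) - F k))"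
      by (rule nuclear_rank_le)
    moreover have "real (2 ^ Suc k + 2 ^ k) * norm (F (Suc k) - F k) \<le> c k"
    proof -
      have "norm (F (Suc k) - F k) \<le> norm (A - F k) + norm (A - F (Suc k))"
        using norm_triangle_ineq4[of "A - F k" "A - F (Suc k)"] by simp
      also have "\<dots> \<le> 2 * sing A (2 ^ k) + 2 * (1 / 4) ^ k"
      proof -
        have "(1 / 4 :: real) ^ Suc k \<le> (1 / 4) ^ k" by (rule power_decreasing) auto
        moreover have "sing A (2 ^ Suc k) \<le> sing A (2 ^ k)" by (rule sing_antimono) simp
        ultimately show ?thesis using F(2)[of k] F(2)[of "Suc k"] by linarith
      qed
      finally have "real (2 ^ Suc k + 2 ^ k) * norm (F (Suc k) - F k)
          \<le> (3 * 2 ^ k) * (2 * sing A (2 ^ k) + 2 * (1 / 4) ^ k)"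
        by (intro mult_mono) auto
      also have "\<dots> = 6 * (2 ^ k * sing A (2 ^ k)) + 6 * (2 ^ k * (1 / 4) ^ k)" by (simp add: algebra_simps)
      also have "(2 :: real) ^ k * (1 / 4) ^ k = (1 / 2) ^ k" by (simp flip: power_mult_distrib)
      finally show ?thesis by (simp add: c_def)
    qed
    ultimately show ?thesis by (rule nuclear_mono)
  qed
  moreover have "summable c"
    unfolding c_def by (intro summable_add summable_mult s2 summable_geometric) auto
  moreover have "(\<lambda>k. ent (F (Suc k) - F k) i j) sums ent (A - F 0) i j" for i j
  proof (rule bounded_linear.sums[OF bounded_linear_ent])
    have "(\<lambda>k. sing A (2 ^ k) + (1 / 4) ^ k) \<longlonglongrightarrow> 0 + 0"
    proof (intro tendsto_add)
      show "(\<lambda>k. sing A (2 ^ k)) \<longlonglongrightarrow> 0"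
        using LIMSEQ_subseq_LIMSEQ[OF summable_LIMSEQ_zero[OF s], of "\<lambda>k. 2 ^ k"]
        by (simp add: o_def strict_mono_def)
      show "(\<lambda>k. (1 / 4 :: real) ^ k) \<longlonglongrightarrow> 0" by (rule LIMSEQ_realpow_zero) auto
    qed
    hence "(\<lambda>k. F k - A) \<longlonglongrightarrow> 0"
      by (intro Lim_null_comparison[of "\<lambda>k. F k - A" "\<lambda>k. sing A (2 ^ k) + (1 / 4) ^ k"] always_eventually allI)
        (use F(2) in \<open>auto simp: norm_minus_commute intro: less_imp_le\<close>)
    hence "F \<longlonglongrightarrow> A" by (simp add: LIM_zero_iff)
    thus "(\<lambda>k. F (Suc k) - F k) sums (A - F 0)" by (rule telescope_sums)
  qed
  ultimately have "nuclear (A - F 0) (\<Sum>k. c k)" by (rule nuclear_series)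
  from nuclear_add[OF this nuclear_rank_le[OF F(1)[of 0]]] show ?thesis by (intro that) simp
qed

section \<open>Exponentials modulo nuclear operators\<close>

lemma nuclear_sums:
  assumes "f sums F" "\<And>k. nuclear (f k) (a k)" "a sums s"
  shows "nuclear F s"
proof -
  have "nuclear F (\<Sum>k. a k)"
    using assms by (intro nuclear_series[of f] bounded_linear.sums[OF bounded_linear_ent]) (auto simp: sums_iff)
  thus ?thesis using assms(3) by (simp add: sums_iff)
qed

lemma exp_tail2_sums:
  fixes X :: "'a :: {real_normed_algebra_1, banach}"
  shows "(\<lambda>k. X ^ (k + 2) /\<^sub>R fact (k + 2)) sums (exp X - 1 - X)"
  using sums_split_initial_segment[OF exp_converges[of X], of 2]
  by (simp add: numeral_2_eq_2 algebra_simps)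

lemma exp_tail1_sums: "(\<lambda>k. x ^ Suc k / fact (Suc k)) sums (exp x - 1)" for x :: real
  using sums_split_initial_segment[OF exp_converges[of x], of 1] by (simp add: divide_inverse mult.commute)

lemma exp_minus_one_le: "exp x - 1 \<le> x * exp x" for x :: real
proof -
  have "(1 - x) * exp x \<le> exp (- x) * exp x"
    using exp_ge_add_one_self[of "- x"] by (intro mult_right_mono) auto
  also have "exp (- x) * exp x = 1" by (simp flip: exp_add)
  finally show ?thesis by (simp add: algebra_simps)
qed

lemma norm_exp_minus_one_le: "norm (exp X - 1) \<le> exp (norm X) - 1"
  for X :: "'a :: {real_normed_algebra_1, banach}"
proof -
  have s: "(\<lambda>k. X ^ Suc k /\<^sub>R fact (Suc k)) sums (exp X - 1)"
    using sums_split_initial_segment[OF exp_converges[of X], of 1] by simp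
  have le: "norm (X ^ Suc k /\<^sub>R fact (Suc k)) \<le> norm X ^ Suc k / fact (Suc k)" for k
    using norm_power_ineq[of X "Suc k"] by (simp add: divide_inverse mult.commute)
  have "norm (\<Sum>k. X ^ Suc k /\<^sub>R fact (Suc k)) \<le> (\<Sum>k. norm X ^ Suc k / fact (Suc k))"
    using le sums_summable[OF exp_tail1_sums[of "norm X"]] by (rule norm_suminf_le)
  thus ?thesis using s exp_tail1_sums[of "norm X"] by (simp add: sums_iff)
qed

lemma exp_conjugate:
  fixes P Q X :: "'a :: {real_normed_algebra_1, banach}"
  assumes "P * Q = 1" "Q * P = 1"
  shows "exp (P * X * Q) = P * exp X * Q"
proof -
  have pow: "(P * X * Q) ^ k = P * X ^ k * Q" for k
  proof (induction k)
    case (Suc k)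
    have "(P * X * Q) ^ Suc k = P * X * (Q * P) * X ^ k * Q" by (simp only: power_Suc Suc) (simp only: mult.assoc)
    thus ?case by (simp add: assms mult.assoc)
  qed (simp add: assms)
  have "(\<lambda>k. P * (X ^ k /\<^sub>R fact k) * Q) sums (P * exp X * Q)"
    by (intro sums_mult sums_mult2 exp_converges)
  moreover have "(\<lambda>k. P * (X ^ k /\<^sub>R fact k) * Q) sums exp (P * X * Q)"
    using exp_converges[of "P * X * Q"] by (simp add: pow)
  ultimately show ?thesis by (rule sums_unique2[symmetric])
qed

lemma exp_scaleR_add: "exp ((s + h) *\<^sub>R X) = exp (s *\<^sub>R X) * exp (h *\<^sub>R X)"
  for X :: "'a :: {real_normed_algebra_1, banach}"
  by (simp add: scaleR_add_left exp_add_commuting)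

lemma exp_minus_mult: "exp (- X) * exp X = 1" "exp X * exp (- X) = 1"
  for X :: "'a :: {real_normed_algebra_1, banach}"
  using exp_add_commuting[of "- X" X] exp_add_commuting[of X "- X"] by simp_all

section \<open>Powers and exponentials up to nuclear remainders\<close>

lemma norm_power_le: "norm X \<le> r \<Longrightarrow> norm (X ^ k) \<le> r ^ k" for X :: clop
  using norm_power_ineq[of X k] power_mono[of "norm X" r k] by simp

lemma nuclear_mult_left_le: "nuclear A c \<Longrightarrow> norm X \<le> r \<Longrightarrow> nuclear (X * A) (r * c)"
  using nuclear_mono[OF nuclear_mult_left] mult_right_mono nuclear_nonneg by blast

lemma nuclear_mult_right_le: "nuclear A c \<Longrightarrow> norm X \<le> r \<Longrightarrow> nuclear (A * X) (r * c)"
  using nuclear_mono[OF nuclear_mult_right] mult_right_mono nuclear_nonneg by blast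

text \<open>One factor is exchanged at a time, so the weight is the derivative of
  \<open>r ^ Suc k\<close>; \<open>X\<close> and \<open>Y\<close> themselves enter through their
  operator norms.\<close>

lemma nuclear_power_diff:
  assumes N: "nuclear (Y - X) d" and X: "norm X \<le> r" and Y: "norm Y \<le> r"
  shows "nuclear (Y ^ Suc k - X ^ Suc k) (real (Suc k) * r ^ k * d)"
proof (induction k)
  case (Suc k)
  have "Y ^ Suc (Suc k) - X ^ Suc (Suc k) = Y * (Y ^ Suc k - X ^ Suc k) + (Y - X) * X ^ Suc k"
    by (simp add: algebra_simps)
  moreover have "nuclear (Y * (Y ^ Suc k - X ^ Suc k)) (r * (real (Suc k) * r ^ k * d))"
    by (rule nuclear_mult_left_le[OF Suc Y])
  moreover have "nuclear ((Y - X) * X ^ Suc k) (r ^ Suc k * d)"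
    by (rule nuclear_mult_right_le[OF N norm_power_le[OF X]])
  ultimately have "nuclear (Y ^ Suc (Suc k) - X ^ Suc (Suc k)) (r * (real (Suc k) * r ^ k * d) + r ^ Suc k * d)"
    by (metis nuclear_add)
  thus ?case by (rule nuclear_mono) (simp add: algebra_simps)
qed (use N in simp)

lemma exp_tail_weights_sums: "(\<lambda>k. (real (Suc (Suc k)) * r ^ Suc k * d) / fact (k + 2)) sums ((exp r - 1) * d)"
proof -
  have "(\<lambda>k. r ^ Suc k / fact (Suc k) * d) sums ((exp r - 1) * d)"
    by (rule sums_mult2[OF exp_tail1_sums])
  moreover have eq: "(real (Suc (Suc k)) * r ^ Suc k * d) / fact (k + 2) = r ^ Suc k / fact (Suc k) * d" for k
  proof -
    have "(fact (k + 2) :: real) = real (Suc (Suc k)) * fact (Suc k)" by (simp only: add_2_eq_Suc' fact_Suc of_nat_mult)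
    moreover have "(a * x * d) / (a * F) = x / F * d" if "a \<noteq> 0" for a x F :: real using that by simp
    ultimately show ?thesis by (metis of_nat_neq_0)
  qed
  ultimately show ?thesis by (simp only: eq)
qed

text \<open>The linear term is subtracted so that the constant is \<open>exp r - 1\<close>, of first
  order in \<open>r\<close>. Scaling \<open>X\<close> and \<open>Y\<close> by \<open>h\<close> then
  leaves an error of second order in \<open>h\<close>.\<close>

lemma nuclear_exp_diff:
  assumes N: "nuclear (Y - X) d" and X: "norm X \<le> r" and Y: "norm Y \<le> r"
  shows "nuclear (exp Y - exp X - (Y - X)) ((exp r - 1) * d)"
proof (rule nuclear_sums)
  have "(\<lambda>k. Y ^ (k + 2) /\<^sub>R fact (k + 2) - X ^ (k + 2) /\<^sub>R fact (k + 2)) sums ((exp Y - 1 - Y) - (exp X - 1 - X))"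
    by (intro sums_diff exp_tail2_sums)
  thus "(\<lambda>k. (Y ^ (k + 2) - X ^ (k + 2)) /\<^sub>R fact (k + 2)) sums (exp Y - exp X - (Y - X))"
    by (simp add: scaleR_diff_right algebra_simps)
  show "(\<lambda>k. (real (Suc (Suc k)) * r ^ Suc k * d) / fact (k + 2)) sums ((exp r - 1) * d)"
    by (rule exp_tail_weights_sums)
  show "nuclear ((Y ^ (k + 2) - X ^ (k + 2)) /\<^sub>R fact (k + 2)) ((real (Suc (Suc k)) * r ^ Suc k * d) / fact (k + 2))" for k
    using nuclear_scaleR[OF nuclear_power_diff[OF N X Y, of "Suc k"], of "inverse (fact (k + 2))"]
    by (simp add: divide_inverse mult.commute)
qed

lemma nuclear_power_commutator:
  assumes C: "nuclear (X * U - U * X) c" and X: "norm X \<le> r"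
  shows "nuclear (X ^ Suc k * U - U * X ^ Suc k) (real (Suc k) * r ^ k * c)"
proof (induction k)
  case (Suc k)
  have "X ^ Suc (Suc k) * U - U * X ^ Suc (Suc k)
      = X * (X ^ Suc k * U - U * X ^ Suc k) + (X * U - U * X) * X ^ Suc k"
    by (simp add: algebra_simps)
  moreover have "nuclear (X * (X ^ Suc k * U - U * X ^ Suc k)) (r * (real (Suc k) * r ^ k * c))"
    by (rule nuclear_mult_left_le[OF Suc X])
  moreover have "nuclear ((X * U - U * X) * X ^ Suc k) (r ^ Suc k * c)"
    by (rule nuclear_mult_right_le[OF C norm_power_le[OF X]])
  ultimately have "nuclear (X ^ Suc (Suc k) * U - U * X ^ Suc (Suc k)) (r * (real (Suc k) * r ^ k * c) + r ^ Suc k * c)"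
    by (metis nuclear_add)
  thus ?case by (rule nuclear_mono) (simp add: algebra_simps)
qed (use C in simp)

text \<open>The commutator with \<open>U\<close> is a derivation, so the recursion and the weights
  are those of differences of powers; the subtracted linear term again makes the constant small with
  \<open>r\<close>.\<close>

lemma nuclear_exp_commutator:
  assumes C: "nuclear (X * U - U * X) c" and X: "norm X \<le> r"
  shows "nuclear (exp X * U - U * exp X - (X * U - U * X)) ((exp r - 1) * c)"
proof (rule nuclear_sums)
  have "(\<lambda>k. (X ^ (k + 2) /\<^sub>R fact (k + 2)) * U - U * (X ^ (k + 2) /\<^sub>R fact (k + 2))) sums ((exp X - 1 - X) * U - U * (exp X - 1 - X))"
    by (intro sums_diff sums_mult sums_mult2 exp_tail2_sums)
  thus "(\<lambda>k. (X ^ (k + 2) * U - U * X ^ (k + 2)) /\<^sub>R fact (k + 2)) sums (exp X * U - U * exp X - (X * U - U * X))"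
    by (simp add: algebra_simps)
  show "(\<lambda>k. (real (Suc (Suc k)) * r ^ Suc k * c) / fact (k + 2)) sums ((exp r - 1) * c)"
    by (rule exp_tail_weights_sums)
  show "nuclear ((X ^ (k + 2) * U - U * X ^ (k + 2)) /\<^sub>R fact (k + 2)) ((real (Suc (Suc k)) * r ^ Suc k * c) / fact (k + 2))" for k
    using nuclear_scaleR[OF nuclear_power_commutator[OF C X, of "Suc k"], of "inverse (fact (k + 2))"]
    by (simp add: divide_inverse mult.commute)
qed

text \<open>\<open>(U + L) ^ k\<close> in normal order, with every \<open>U\<close> to the left of
  every \<open>L\<close>: the binomial sum of \<open>U ^ i * L ^ (k - i)\<close>. Its exponential
  generating function is \<open>exp U * exp L\<close>.\<close>

primrec ordered_power :: "'a :: ring_1 \<Rightarrow> 'a \<Rightarrow> nat \<Rightarrow> 'a" where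
  "ordered_power U L 0 = 1"
| "ordered_power U L (Suc k) = U * ordered_power U L k + ordered_power U L k * L"

lemma exp_mult_exp_sums:
  fixes U L :: "'a :: {real_normed_algebra_1, banach}"
  shows "(\<lambda>k. ordered_power U L k /\<^sub>R fact k) sums (exp U * exp L)"
proof -
  let ?S = "\<lambda>X n. X ^ n /\<^sub>R fact n :: 'a"
  have S_Suc: "?S X (Suc n) = (X * ?S X n) /\<^sub>R real (Suc n)" "?S X (Suc n) = (?S X n * X) /\<^sub>R real (Suc n)" for X n
    by (simp_all add: power_commutes mult.commute)
  have T: "(\<Sum>i\<le>n. ?S U i * ?S L (n - i)) = ordered_power U L n /\<^sub>R fact n" for n
  proof (induction n)
    case (Suc n)
    \<comment> \<open>\<open>Suc n\<close> is written as \<open>i + (Suc n - i)\<close>: the first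
      part takes one \<open>U\<close> out on the left, the second one \<open>L\<close> out on the
      right, which is the recursion of \<open>ordered_power\<close>.\<close>
    have eq: "real (Suc n) *\<^sub>R (\<Sum>i\<le>Suc n. ?S U i * ?S L (Suc n - i))
        = U * (\<Sum>i\<le>n. ?S U i * ?S L (n - i)) + (\<Sum>i\<le>n. ?S U i * ?S L (n - i)) * L"
    proof -
      have "real (Suc n) *\<^sub>R (\<Sum>i\<le>Suc n. ?S U i * ?S L (Suc n - i))
         = (\<Sum>i\<le>Suc n. real i *\<^sub>R (?S U i * ?S L (Suc n - i)) + real (Suc n - i) *\<^sub>R (?S U i * ?S L (Suc n - i)))"
        unfolding scaleR_sum_right
        by (intro sum.cong refl) (simp only: scaleR_add_left[symmetric] of_nat_add[symmetric], simp)
      also have "\<dots> = (\<Sum>i\<le>Suc n. real i *\<^sub>R (?S U i * ?S L (Suc n - i)))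
          + (\<Sum>i\<le>Suc n. real (Suc n - i) *\<^sub>R (?S U i * ?S L (Suc n - i)))"
        by (rule sum.distrib)
      also have "(\<Sum>i\<le>Suc n. real i *\<^sub>R (?S U i * ?S L (Suc n - i))) = (\<Sum>i\<le>n. real (Suc i) *\<^sub>R (?S U (Suc i) * ?S L (n - i)))"
        by (subst sum.atMost_Suc_shift) simp
      also have "\<dots> = U * (\<Sum>i\<le>n. ?S U i * ?S L (n - i))"
        unfolding S_Suc(1) sum_distrib_left by (intro sum.cong) (auto simp: mult.assoc)
      also have "(\<Sum>i\<le>Suc n. real (Suc n - i) *\<^sub>R (?S U i * ?S L (Suc n - i)))
          = (\<Sum>i\<le>n. real (Suc n - i) *\<^sub>R (?S U i * ?S L (Suc n - i)))"
        by simp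
      also have "\<dots> = (\<Sum>i\<le>n. real (Suc (n - i)) *\<^sub>R (?S U i * ?S L (Suc (n - i))))"
        by (intro sum.cong) (auto simp: Suc_diff_le)
      also have "\<dots> = (\<Sum>i\<le>n. ?S U i * ?S L (n - i)) * L"
        unfolding S_Suc(2) sum_distrib_right by (intro sum.cong) (auto simp: mult.assoc)
      finally show ?thesis .
    qed
    have "(\<Sum>i\<le>Suc n. ?S U i * ?S L (Suc n - i)) = inverse (real (Suc n)) *\<^sub>R (real (Suc n) *\<^sub>R (\<Sum>i\<le>Suc n. ?S U i * ?S L (Suc n - i)))"
      by (simp del: sum.atMost_Suc)
    also have "\<dots> = ordered_power U L (Suc n) /\<^sub>R fact (Suc n)"
      unfolding eq Suc.IH by (simp add: scaleR_add_right mult.commute)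
    finally show ?case .
  qed simp
  have "(\<lambda>n. \<Sum>i\<le>n. ?S U i * ?S L (n - i)) sums (exp U * exp L)"
    using Cauchy_product_sums[OF summable_norm_exp[of U] summable_norm_exp[of L]]
    by (simp only: exp_def)
  thus ?thesis by (simp only: T)
qed

lemma norm_ordered_power_le:
  fixes U L :: clop
  assumes "norm U \<le> r" "norm L \<le> r"
  shows "norm (ordered_power U L k) \<le> (2 * r) ^ k"
proof (induction k)
  case (Suc k)
  have r: "0 \<le> r" using assms(1) norm_ge_zero order.trans by blast
  have "norm (ordered_power U L (Suc k)) \<le> norm U * norm (ordered_power U L k) + norm (ordered_power U L k) * norm L"
    by (simp, intro order.trans[OF norm_triangle_ineq] add_mono norm_mult_ineq)
  also have "\<dots> \<le> r * (2 * r) ^ k + (2 * r) ^ k * r"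
    using Suc assms r by (intro add_mono mult_mono) auto
  also have "\<dots> = (2 * r) ^ Suc k" by (simp only: power_Suc) (simp add: algebra_simps)
  finally show ?case .
qed simp

text \<open>With \<open>S\<close> the ordered power,
  \<open>[U S + S L, L] = U [S, L] + [U, L] S + [S, L] L\<close>; the middle term is the new
  commutator.\<close>

lemma nuclear_ordered_power_commutator:
  assumes C: "nuclear (U * L - L * U) c" and U: "norm U \<le> r" and L: "norm L \<le> r"
  shows "nuclear (ordered_power U L (Suc k) * L - L * ordered_power U L (Suc k)) (real (Suc k) * (2 * r) ^ k * c)"
proof (induction k)
  case (Suc k)
  let ?S = "ordered_power U L (Suc k)"
  have "ordered_power U L (Suc (Suc k)) * L - L * ordered_power U L (Suc (Suc k))
      = U * (?S * L - L * ?S) + (U * L - L * U) * ?S + (?S * L - L * ?S) * L"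
    by (simp only: ordered_power.simps(2)[of U L "Suc k"]) (simp only: algebra_simps)
  moreover have "nuclear (U * (?S * L - L * ?S) + (U * L - L * U) * ?S + (?S * L - L * ?S) * L)
     (r * (real (Suc k) * (2 * r) ^ k * c) + (2 * r) ^ Suc k * c + r * (real (Suc k) * (2 * r) ^ k * c))"
    by (intro nuclear_add nuclear_mult_left_le nuclear_mult_right_le Suc U L C norm_ordered_power_le)
  ultimately show ?case by (auto elim!: nuclear_mono simp: algebra_simps)
next
  case 0
  have "ordered_power U L (Suc 0) * L - L * ordered_power U L (Suc 0) = U * L - L * U"
    by (simp add: algebra_simps)
  thus ?case using C by simp
qed

text \<open>\<open>U S + S L = (U + L) S + [S, L]\<close>, so passing from power
  \<open>k + 2\<close> to the next one adds a commutator of weight \<open>k + 2\<close>; Pascal's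
  rule sums these weights to the binomial coefficient.\<close>

lemma nuclear_ordered_power_diff:
  assumes C: "nuclear (U * L - L * U) c" and U: "norm U \<le> r" and L: "norm L \<le> r"
  shows "nuclear (ordered_power U L (k + 2) - (U + L) ^ (k + 2)) (real (k + 2 choose 2) * (2 * r) ^ k * c)"
proof (induction k)
  case 0
  have "ordered_power U L (0 + 2) - (U + L) ^ (0 + 2) = U * L - L * U"
    by (simp add: numeral_2_eq_2 algebra_simps)
  moreover have "(0 + 2 :: nat) choose 2 = 1" by (simp add: numeral_2_eq_2)
  ultimately show ?case using C by (simp del: add_2_eq_Suc')
next
  case (Suc k)
  let ?S = "ordered_power U L (k + 2)"
  have "ordered_power U L (Suc k + 2) - (U + L) ^ (Suc k + 2) = (U + L) * (?S - (U + L) ^ (k + 2)) + (?S * L - L * ?S)"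
    by (simp only: add_Suc ordered_power.simps(2)[of U L "k + 2"] power_Suc[of _ "k + 2"]) (simp only: algebra_simps)
  moreover have "norm (U + L) \<le> 2 * r" using norm_triangle_ineq[of U L] U L by simp
  hence "nuclear ((U + L) * (?S - (U + L) ^ (k + 2)) + (?S * L - L * ?S))
     (2 * r * (real (k + 2 choose 2) * (2 * r) ^ k * c) + real (Suc (Suc k)) * (2 * r) ^ Suc k * c)"
    using nuclear_ordered_power_commutator[OF C U L, of "Suc k"]
    by (intro nuclear_add nuclear_mult_left_le Suc) simp_all
  moreover have "real (Suc k + 2 choose 2) = real (k + 2 choose 2) + real (Suc (Suc k))"
    by (simp add: numeral_2_eq_2)
  ultimately show ?case by (auto elim!: nuclear_mono simp: algebra_simps)
qed

text \<open>The weights satisfy \<open>(k + 2 choose 2) / fact (k + 2) = 1 / (2 * fact k)\<close>,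
  so the bounds sum to an exponential series. The result is linear in \<open>c\<close>, hence
  quadratic when \<open>U\<close> and \<open>L\<close> are scaled.\<close>

lemma nuclear_exp_mult_diff:
  assumes C: "nuclear (U * L - L * U) c" and U: "norm U \<le> r" and L: "norm L \<le> r"
  shows "nuclear (exp U * exp L - exp (U + L)) (exp (2 * r) * (c / 2))"
proof (rule nuclear_sums)
  have "(\<lambda>k. ordered_power U L (k + 2) /\<^sub>R fact (k + 2)) sums (exp U * exp L - 1 - (U + L))"
    using sums_split_initial_segment[OF exp_mult_exp_sums[of U L], of 2]
    by (simp add: numeral_2_eq_2 algebra_simps)
  from sums_diff[OF this exp_tail2_sums[of "U + L"]]
  show "(\<lambda>k. (ordered_power U L (k + 2) - (U + L) ^ (k + 2)) /\<^sub>R fact (k + 2)) sums (exp U * exp L - exp (U + L))"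
    by (simp add: scaleR_diff_right)
  show "(\<lambda>k. (2 * r) ^ k /\<^sub>R fact k * (c / 2)) sums (exp (2 * r) * (c / 2))"
    by (intro sums_mult2 exp_converges)
  fix k
  have "2 * fact k * (k + 2 choose 2) = (fact (k + 2) :: nat)"
    using binomial_fact_lemma[of 2 "k + 2"] by (simp del: add_2_eq_Suc' add: fact_2)
  from arg_cong[OF this, of real] have f: "fact (k + 2) = 2 * fact k * real (k + 2 choose 2)"
    by (simp only: of_nat_mult of_nat_fact of_nat_numeral)
  have "inverse (2 * F * b) * (b * x * c) = inverse F * x * (c / 2)" if "b \<noteq> 0" for F b x :: real
    using that by (simp add: field_simps)
  from this[of "real (k + 2 choose 2)" "fact k" "(2 * r) ^ k"]
  have e: "inverse (fact (k + 2)) * (real (k + 2 choose 2) * (2 * r) ^ k * c) = (2 * r) ^ k /\<^sub>R fact k * (c / 2)"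
    unfolding f by (simp add: binomial_eq_0_iff del: add_2_eq_Suc')
  have a: "\<bar>inverse (fact (k + 2))\<bar> = (inverse (fact (k + 2)) :: real)" by (simp del: add_2_eq_Suc')
  show "nuclear ((ordered_power U L (k + 2) - (U + L) ^ (k + 2)) /\<^sub>R fact (k + 2)) ((2 * r) ^ k /\<^sub>R fact k * (c / 2))"
    using nuclear_scaleR[OF nuclear_ordered_power_diff[OF C U L, of k], of "inverse (fact (k + 2))"]
    unfolding a e .
qed

text \<open>\<open>exp (- U) * exp (- L)\<close> inverts \<open>exp L * exp U\<close>, so
  \<open>exp B\<close> is compared with \<open>exp L * exp U\<close>, by way of
  \<open>exp (L + U)\<close>. Each term of the bound carries \<open>c\<close> or the product
  \<open>(exp (2 * r) - 1) * d\<close>, both of second order when \<open>U\<close>,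
  \<open>L\<close>, \<open>B\<close> are scaled by \<open>h\<close>.\<close>

lemma nuclear_exp_triple:
  assumes D: "nuclear (B - U - L) d" and C: "nuclear (L * U - U * L) c"
    and U: "norm U \<le> r" and L: "norm L \<le> r" and B: "norm B \<le> 2 * r"
  shows "nuclear (exp (- U) * exp (- L) * exp B - 1 - (B - U - L))
     (exp (2 * r) * ((exp (2 * r) - 1) * d + exp (2 * r) * (c / 2)) + (exp (2 * r) - 1) * d)"
proof -
  have r: "0 \<le> r" using U norm_ge_zero order.trans by blast
  have LU: "norm (L + U) \<le> 2 * r" using norm_triangle_ineq[of L U] U L by simp
  have "nuclear (exp B - exp (L + U) - (B - (L + U))) ((exp (2 * r) - 1) * d)"
    by (rule nuclear_exp_diff) (use D LU B in \<open>simp_all add: algebra_simps\<close>)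
  from nuclear_diff[OF this nuclear_exp_mult_diff[OF C L U]]
  have 1: "nuclear (exp B - exp L * exp U - (B - U - L)) ((exp (2 * r) - 1) * d + exp (2 * r) * (c / 2))"
    by (simp add: algebra_simps)
  have eU: "norm (exp (- U)) \<le> exp r" and eL: "norm (exp (- L)) \<le> exp r"
    using norm_exp[of "- U"] norm_exp[of "- L"] U L by (simp_all add: order.trans)
  have dU: "norm (exp (- U) - 1) \<le> exp r - 1" and dL: "norm (exp (- L) - 1) \<le> exp r - 1"
    using norm_exp_minus_one_le[of "- U"] norm_exp_minus_one_le[of "- L"] U L by (simp_all add: order.trans)
  have e2: "exp r * exp r = exp (2 * r)" by (simp flip: exp_add)
  have n1: "norm (exp (- U) * exp (- L)) \<le> exp (2 * r)"
    unfolding e2[symmetric] by (rule order.trans[OF norm_mult_ineq]) (intro mult_mono eU eL, auto)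
  have "exp (- U) * exp (- L) - 1 = (exp (- U) - 1) * exp (- L) + (exp (- L) - 1)"
    by (simp add: algebra_simps)
  hence "norm (exp (- U) * exp (- L) - 1) \<le> norm (exp (- U) - 1) * norm (exp (- L)) + norm (exp (- L) - 1)"
    by (metis add_right_mono norm_mult_ineq norm_triangle_le)
  also have "\<dots> \<le> (exp r - 1) * exp r + (exp r - 1)"
    using r by (intro add_mono mult_mono dU dL eL) auto
  finally have n2: "norm (exp (- U) * exp (- L) - 1) \<le> exp (2 * r) - 1"
    unfolding e2[symmetric] by (simp add: algebra_simps)
  have "exp (- U) * exp (- L) * (exp L * exp U) = exp (- U) * (exp (- L) * exp L) * exp U"
    by (simp only: mult.assoc)
  hence inv: "exp (- U) * exp (- L) * (exp L * exp U) = 1" by (simp add: exp_minus_mult)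
  have "exp (- U) * exp (- L) * exp B - 1 - (B - U - L)
      = exp (- U) * exp (- L) * (exp B - exp L * exp U - (B - U - L))
        + (exp (- U) * exp (- L) - 1) * (B - U - L)"
    unfolding right_diff_distrib[of "exp (- U) * exp (- L)"] inv by (simp add: algebra_simps)
  moreover have "nuclear \<dots> (exp (2 * r) * ((exp (2 * r) - 1) * d + exp (2 * r) * (c / 2)) + (exp (2 * r) - 1) * d)"
    by (intro nuclear_add nuclear_mult_left_le 1 D n1 n2)
  ultimately show ?thesis by simp
qed

lemma nuclear_exp_triple_quadratic:
  assumes D: "nuclear (B - U - L) d" and C: "nuclear (L * U - U * L) c"
  obtains K where "0 \<le> K" "\<And>h. \<bar>h\<bar> \<le> 1 \<Longrightarrow>
    nuclear (exp (- (h *\<^sub>R U)) * exp (- (h *\<^sub>R L)) * exp (h *\<^sub>R B) - 1 - h *\<^sub>R (B - U - L)) (K * h\<^sup>2)"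
proof -
  define r where "r = norm U + norm L + norm B"
  define e where "e = exp (2 * r)"
  \<comment> \<open>For \<open>\<bar>h\<bar> \<le> 1\<close>, \<open>e\<close> bounds
    \<open>exp (2 * \<bar>h\<bar> * r)\<close> and \<open>2 * \<bar>h\<bar> * r * e\<close> bounds
    \<open>exp (2 * \<bar>h\<bar> * r) - 1\<close>. With these in the constant of
    \<open>nuclear_exp_triple\<close>, taking out the square of \<open>h\<close> leaves
    \<open>K\<close>.\<close>
  define K where "K = e * (2 * r * e * d + e * (c / 2)) + 2 * r * e * d"
  have r: "0 \<le> r" by (simp add: r_def)
  have d0: "0 \<le> d" and c0: "0 \<le> c" using D C by (auto dest: nuclear_nonneg)
  have e1: "1 \<le> e" using r by (simp add: e_def)
  have K: "0 \<le> K" using r d0 c0 e1 by (auto simp: K_def intro!: add_nonneg_nonneg mult_nonneg_nonneg)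
  have "nuclear (exp (- (h *\<^sub>R U)) * exp (- (h *\<^sub>R L)) * exp (h *\<^sub>R B) - 1 - h *\<^sub>R (B - U - L)) (K * h\<^sup>2)"
    if h: "\<bar>h\<bar> \<le> 1" for h
  proof -
    let ?r = "\<bar>h\<bar> * r" and ?d = "\<bar>h\<bar> * d" and ?c = "\<bar>h\<bar> * \<bar>h\<bar> * c"
    have nD: "nuclear (h *\<^sub>R B - h *\<^sub>R U - h *\<^sub>R L) ?d"
      using nuclear_scaleR[OF D, of h] by (simp add: scaleR_diff_right)
    have nC: "nuclear ((h *\<^sub>R L) * (h *\<^sub>R U) - (h *\<^sub>R U) * (h *\<^sub>R L)) ?c"
      using nuclear_scaleR[OF C, of "h * h"] by (simp only: scaleR_diff_right abs_mult) simp
    have n: "norm (h *\<^sub>R U) \<le> ?r" "norm (h *\<^sub>R L) \<le> ?r" "norm (h *\<^sub>R B) \<le> 2 * ?r"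
      by (auto simp: r_def distrib_left mult.assoc intro!: mult_left_mono)
    have e: "exp (2 * ?r) \<le> e"
      unfolding e_def using h r by (simp add: mult_left_le_one_le)
    have em: "exp (2 * ?r) - 1 \<le> \<bar>h\<bar> * (2 * r * e)"
    proof -
      have "exp (2 * ?r) - 1 \<le> (2 * ?r) * exp (2 * ?r)" by (rule exp_minus_one_le)
      also have "\<dots> \<le> (2 * ?r) * e" using e r by (intro mult_left_mono) auto
      finally show ?thesis by (simp add: mult_ac)
    qed
    have em0: "0 \<le> exp (2 * ?r) - 1" using r by simp
    have "exp (2 * ?r) * ((exp (2 * ?r) - 1) * ?d + exp (2 * ?r) * (?c / 2)) + (exp (2 * ?r) - 1) * ?d
        \<le> e * (\<bar>h\<bar> * (2 * r * e) * ?d + e * (?c / 2)) + \<bar>h\<bar> * (2 * r * e) * ?d"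
      using e em em0 d0 c0 e1 r by (intro add_mono mult_mono add_nonneg_nonneg mult_nonneg_nonneg) auto
    also have "\<dots> = K * h\<^sup>2"
    proof -
      have "e * (g * (2 * r * e) * (g * d) + e * (g * g * c / 2)) + g * (2 * r * e) * (g * d) = K * (g * g)" for g
        by (simp add: K_def algebra_simps)
      from this[of "\<bar>h\<bar>"] show ?thesis by (simp only: power2_eq_square abs_mult_self_eq)
    qed
    finally show ?thesis
      using nuclear_exp_triple[OF nD nC n] by (auto elim!: nuclear_mono simp: scaleR_diff_right)
  qed
  with K show ?thesis by (rule that)
qed

text \<open>\<open>U\<close> is merely bounded; its conjugate differs from it by a nuclear operator
  because \<open>exp (h L)\<close> commutes with \<open>U\<close> up to a nuclear one.\<close>

lemma nuclear_exp_conjugation_quadratic: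
  assumes C: "nuclear (L * U - U * L) c"
  obtains K where "0 \<le> K" "\<And>h. \<bar>h\<bar> \<le> 1 \<Longrightarrow>
    nuclear (exp (h *\<^sub>R L) * U * exp (- (h *\<^sub>R L)) - U - h *\<^sub>R (L * U - U * L)) (K * h\<^sup>2)"
proof -
  define r where "r = norm L"
  define e where "e = exp r"
  define K where "K = e * (r * e * c) + r * e * c"
  have r: "0 \<le> r" by (simp add: r_def)
  have c0: "0 \<le> c" using C by (auto dest: nuclear_nonneg)
  have e1: "1 \<le> e" using r by (simp add: e_def)
  have K: "0 \<le> K" using r c0 e1 by (auto simp: K_def intro!: add_nonneg_nonneg mult_nonneg_nonneg)
  have "nuclear (exp (h *\<^sub>R L) * U * exp (- (h *\<^sub>R L)) - U - h *\<^sub>R (L * U - U * L)) (K * h\<^sup>2)"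
    if h: "\<bar>h\<bar> \<le> 1" for h
  proof -
    let ?X = "h *\<^sub>R L" and ?r = "\<bar>h\<bar> * r" and ?c = "\<bar>h\<bar> * c"
    have nC: "nuclear (?X * U - U * ?X) ?c"
      using nuclear_scaleR[OF C, of h] by (simp add: scaleR_diff_right)
    have n: "norm ?X \<le> ?r" by (simp add: r_def)
    have nm: "norm (- ?X) \<le> r" using h mult_right_mono[OF h, of "norm L"] by (simp add: r_def)
    have e: "norm (exp (- ?X)) \<le> e"
      using norm_exp[of "- ?X"] nm unfolding e_def by (meson exp_le_cancel_iff order.trans)
    have er: "exp ?r \<le> e"
      unfolding e_def using h r by (simp add: mult_left_le_one_le)
    have em: "exp ?r - 1 \<le> \<bar>h\<bar> * (r * e)"
    proof -
      have "exp ?r - 1 \<le> ?r * exp ?r" by (rule exp_minus_one_le)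
      also have "\<dots> \<le> ?r * e" using er r by (intro mult_left_mono) auto
      finally show ?thesis by (simp add: mult_ac)
    qed
    have dm: "norm (exp (- ?X) - 1) \<le> exp ?r - 1"
      using norm_exp_minus_one_le[of "- ?X"] by (simp add: r_def)
    have "exp ?X * U * exp (- ?X) - U - (?X * U - U * ?X)
       = (exp ?X * U - U * exp ?X - (?X * U - U * ?X)) * exp (- ?X) + (?X * U - U * ?X) * (exp (- ?X) - 1)
         + U * (exp ?X * exp (- ?X)) - U"
      by (simp add: algebra_simps)
    also have "\<dots> = (exp ?X * U - U * exp ?X - (?X * U - U * ?X)) * exp (- ?X) + (?X * U - U * ?X) * (exp (- ?X) - 1)"
      by (simp add: exp_minus_mult)
    finally have eq: "exp ?X * U * exp (- ?X) - U - (?X * U - U * ?X) = \<dots>" .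
    have nu: "nuclear (exp ?X * U * exp (- ?X) - U - (?X * U - U * ?X)) (e * ((exp ?r - 1) * ?c) + (exp ?r - 1) * ?c)"
      unfolding eq by (intro nuclear_add nuclear_mult_right_le nuclear_exp_commutator nC n e dm)
    moreover have "e * ((exp ?r - 1) * ?c) + (exp ?r - 1) * ?c \<le> e * (\<bar>h\<bar> * (r * e) * ?c) + \<bar>h\<bar> * (r * e) * ?c"
      using em c0 e1 r by (intro add_mono mult_mono mult_nonneg_nonneg) auto
    moreover have "e * (\<bar>h\<bar> * (r * e) * ?c) + \<bar>h\<bar> * (r * e) * ?c = K * h\<^sup>2"
    proof -
      have "e * (g * (r * e) * (g * c)) + g * (r * e) * (g * c) = K * (g * g)" for g
        by (simp add: K_def algebra_simps)
      from this[of "\<bar>h\<bar>"] show ?thesis by (simp only: power2_eq_square abs_mult_self_eq)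
    qed
    ultimately have "nuclear (exp ?X * U * exp (- ?X) - U - (?X * U - U * ?X)) (K * h\<^sup>2)"
      by (intro nuclear_mono[OF nu]) linarith
    thus ?thesis by (simp add: scaleR_diff_right)
  qed
  with K show ?thesis by (rule that)
qed

section \<open>Differentiating traces and determinants\<close>

lemma has_vector_derivative_if_quadratic:
  fixes f :: "real \<Rightarrow> 'a :: real_normed_vector"
  assumes e: "0 < e" and le: "\<And>h. \<bar>h\<bar> \<le> e \<Longrightarrow> norm (f (s + h) - f s - h *\<^sub>R v) \<le> K * h\<^sup>2"
  shows "(f has_vector_derivative v) (at s)"
  unfolding has_vector_derivative_def has_derivative_at
proof (intro conjI bounded_linear_scaleR_left)
  show "(\<lambda>h. norm (f (s + h) - f s - h *\<^sub>R v) / norm h) \<midarrow>0\<rightarrow> 0"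
  proof (rule Lim_null_comparison)
    show "\<forall>\<^sub>F h in at 0. norm (norm (f (s + h) - f s - h *\<^sub>R v) / norm h) \<le> K * \<bar>h\<bar>"
      unfolding eventually_at
    proof (intro exI[of _ e] conjI e ballI impI)
      fix h :: real assume "h \<noteq> 0 \<and> dist h 0 < e"
      hence h: "h \<noteq> 0" "\<bar>h\<bar> \<le> e" by auto
      have "norm (f (s + h) - f s - h *\<^sub>R v) \<le> K * \<bar>h\<bar> * \<bar>h\<bar>"
        using le[OF h(2)] by (simp add: power2_eq_square mult.assoc)
      thus "norm (norm (f (s + h) - f s - h *\<^sub>R v) / norm h) \<le> K * \<bar>h\<bar>"
        using h(1) by (simp add: divide_le_eq)
    qed
    have "((\<lambda>h. K * \<bar>h\<bar>) \<longlongrightarrow> K * \<bar>0 :: real\<bar>) (at 0)" by (intro tendsto_intros)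
    thus "((\<lambda>h. K * \<bar>h\<bar>) \<longlongrightarrow> 0) (at (0 :: real))" by simp
  qed
qed

lemma const_if_zero_vector_derivative:
  fixes f :: "real \<Rightarrow> 'a :: real_normed_vector"
  assumes "\<And>s. (f has_vector_derivative 0) (at s)"
  shows "f s = f t"
proof -
  have "(f has_derivative (\<lambda>_. 0)) (at x within UNIV)" for x
    using assms[of x] by (simp add: has_vector_derivative_def)
  from has_derivative_zero_constant[OF convex_UNIV this] show ?thesis by auto
qed

lemma nuclear_conjugation_diff:
  assumes C: "nuclear (L * U - U * L) c"
  obtains c' where "nuclear (exp (s *\<^sub>R L) * U * exp (- (s *\<^sub>R L)) - U) c'"
proof -
  let ?X = "s *\<^sub>R L"
  have C': "nuclear (?X * U - U * ?X) (\<bar>s\<bar> * c)"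
    using nuclear_scaleR[OF C, of s] by (simp add: scaleR_diff_right)
  have "nuclear (exp ?X * U - U * exp ?X) ((exp (norm ?X) - 1) * (\<bar>s\<bar> * c) + \<bar>s\<bar> * c)"
    using nuclear_add[OF nuclear_exp_commutator[OF C' order.refl] C'] by simp
  from nuclear_mult_right[OF this, of "exp (- ?X)"]
  have "nuclear (exp ?X * U * exp (- ?X) - U)
    (norm (exp (- ?X)) * ((exp (norm ?X) - 1) * (\<bar>s\<bar> * c) + \<bar>s\<bar> * c))"
    by (simp add: left_diff_distrib mult.assoc exp_minus_mult)
  thus ?thesis by (rule that)
qed

lemma trc_conjugate:
  assumes "nuclear N c" "Q * P = 1"
  shows "trc (P * N * Q) = trc N"
  using trc_commute[OF nuclear_mult_right[OF assms(1)], of P Q] assms(2) by (simp add: mult.assoc)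

lemma det1_conjugate:
  assumes "nuclear N c" "Q * P = 1"
  shows "det1 (P * N * Q) = det1 N"
  using det1_commute[OF nuclear_mult_right[OF assms(1)], of P Q] assms(2) by (simp add: mult.assoc)

text \<open>The trace \<open>g s\<close> of \<open>V s - U\<close> is additive in \<open>s\<close>,
  because the increment from \<open>s\<close> to \<open>s + h\<close> is \<open>V h - U\<close>
  conjugated by \<open>exp (s L)\<close>. With derivative \<open>\<gamma>\<close> at 0 it must be
  \<open>s * \<gamma>\<close>. For nuclear \<open>U\<close> it would vanish by cyclicity; the trace
  of the commutator measures this failure.\<close>

lemma trc_conjugation_diff:
  assumes C: "nuclear (L * U - U * L) c"
  shows "trc (exp (s *\<^sub>R L) * U * exp (- (s *\<^sub>R L)) - U) = of_real s * trc (L * U - U * L)"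
proof -
  define \<gamma> where "\<gamma> = trc (L * U - U * L)"
  define V where "V s = exp (s *\<^sub>R L) * U * exp (- (s *\<^sub>R L))" for s
  define g where "g s = trc (V s - U)" for s
  obtain K where K: "\<And>h. \<bar>h\<bar> \<le> 1 \<Longrightarrow> nuclear (V h - U - h *\<^sub>R (L * U - U * L)) (K * h\<^sup>2)"
    unfolding V_def by (rule nuclear_exp_conjugation_quadratic[OF C]) blast
  have nV: "\<exists>c. nuclear (V s - U) c" for s
    unfolding V_def by (rule nuclear_conjugation_diff[OF C]) blast
  have add: "g (s + h) = g s + g h" for s h
  proof -
    obtain c1 c2 where n: "nuclear (V s - U) c1" "nuclear (V h - U) c2" using nV by meson
    have "exp (- ((s + h) *\<^sub>R L)) = exp (- (h *\<^sub>R L)) * exp (- (s *\<^sub>R L))"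
      using exp_scaleR_add[of h s "- L"] by (simp add: add.commute)
    hence "V (s + h) = exp (s *\<^sub>R L) * V h * exp (- (s *\<^sub>R L))"
      by (simp add: V_def exp_scaleR_add mult.assoc)
    hence "V (s + h) - U = exp (s *\<^sub>R L) * (V h - U) * exp (- (s *\<^sub>R L)) + (V s - U)"
      by (simp add: V_def algebra_simps)
    moreover have "nuclear (exp (s *\<^sub>R L) * (V h - U) * exp (- (s *\<^sub>R L)))
        (norm (exp (- (s *\<^sub>R L))) * (norm (exp (s *\<^sub>R L)) * c2))"
      by (intro nuclear_mult_right nuclear_mult_left n)
    ultimately have "g (s + h) = trc (exp (s *\<^sub>R L) * (V h - U) * exp (- (s *\<^sub>R L))) + trc (V s - U)"
      unfolding g_def using trc_add n(1) by metis
    thus ?thesis by (simp add: g_def trc_conjugate[OF n(2)] exp_minus_mult)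
  qed
  have "((\<lambda>s. g s - s *\<^sub>R \<gamma>) has_vector_derivative 0) (at s)" for s
  proof (rule has_vector_derivative_if_quadratic[of 1])
    fix h :: real assume h: "\<bar>h\<bar> \<le> 1"
    obtain c2 where n: "nuclear (V h - U) c2" using nV by blast
    have "trc (V h - U - h *\<^sub>R (L * U - U * L)) = g h - of_real h * \<gamma>"
      unfolding g_def \<gamma>_def by (simp only: trc_diff[OF n nuclear_scaleR[OF C]] trc_scaleR[OF C])
    hence "cmod (g h - of_real h * \<gamma>) \<le> K * h\<^sup>2" using trc_bound(2)[OF K[OF h]] by simp
    thus "cmod (g (s + h) - (s + h) *\<^sub>R \<gamma> - (g s - s *\<^sub>R \<gamma>) - h *\<^sub>R 0) \<le> K * h\<^sup>2"
      by (simp add: add scaleR_conv_of_real algebra_simps)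
  qed simp
  hence "g s - s *\<^sub>R \<gamma> = g 0 - 0 *\<^sub>R \<gamma>" by (rule const_if_zero_vector_derivative)
  moreover have "g 0 = 0" using add[of 0 0] by simp
  ultimately show ?thesis by (simp add: g_def V_def \<gamma>_def scaleR_conv_of_real)
qed

lemma norm_triangle_sub_le: "norm (x - z) \<le> norm (x - y) + norm (y - z)"
  for x y z :: "'a :: real_normed_vector"
  using norm_triangle_ineq[of "x - y" "y - z"] by simp

text \<open>Since the square of \<open>h\<close> is at most \<open>\<bar>h\<bar>\<close>,
  \<open>A\<close> has nuclear bound \<open>\<bar>h\<bar> * (d + K)\<close>; the smallness condition
  keeps the geometric denominator in \<open>det1_estimate\<close> at least
  \<open>1 / 2\<close>.\<close>

lemma det1_quadratic:
  assumes N: "nuclear N d" and A: "nuclear (A - h *\<^sub>R N) (K * h\<^sup>2)" "0 \<le> K" "\<bar>h\<bar> \<le> 1"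
    and small: "\<bar>h\<bar> * (d + K) \<le> 1 / 2"
  shows "cmod (det1 A - 1 - of_real h * trc N) \<le> (2 * (d + K)\<^sup>2 + K) * h\<^sup>2"
proof -
  have d: "0 \<le> d" by (rule nuclear_nonneg[OF N])
  have hh: "h\<^sup>2 \<le> \<bar>h\<bar>" using mult_left_mono[OF A(3), of "\<bar>h\<bar>"] by (simp add: power2_eq_square)
  have "nuclear ((A - h *\<^sub>R N) + h *\<^sub>R N) (K * h\<^sup>2 + \<bar>h\<bar> * d)"
    by (intro nuclear_add A nuclear_scaleR N)
  moreover have "K * h\<^sup>2 + \<bar>h\<bar> * d \<le> \<bar>h\<bar> * (d + K)"
    using mult_left_mono[OF hh A(2)] by (simp add: algebra_simps)
  ultimately have nA: "nuclear A (\<bar>h\<bar> * (d + K))" by (auto elim: nuclear_mono)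
  have "cmod (det1 A - 1 - trc A) \<le> (\<bar>h\<bar> * (d + K))\<^sup>2 / (1 - \<bar>h\<bar> * (d + K))"
    by (rule det1_estimate[OF nA]) (use small in simp)
  also have "\<dots> \<le> (\<bar>h\<bar> * (d + K))\<^sup>2 / (1 / 2)"
    using small by (intro divide_left_mono) auto
  finally have 1: "cmod (det1 A - 1 - trc A) \<le> 2 * (d + K)\<^sup>2 * h\<^sup>2" by (simp add: power_mult_distrib mult_ac)
  have "trc (A - h *\<^sub>R N) = trc A - of_real h * trc N"
    by (simp only: trc_diff[OF nA nuclear_scaleR[OF N]] trc_scaleR[OF N])
  hence 2: "cmod (trc A - of_real h * trc N) \<le> K * h\<^sup>2" using trc_bound(2)[OF A(1)] by simp
  have "cmod (det1 A - 1 - of_real h * trc N) \<le> cmod (det1 A - 1 - trc A) + cmod (trc A - of_real h * trc N)"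
    by (rule norm_triangle_sub_le)
  with 1 2 show ?thesis by (simp add: distrib_right)
qed

text \<open>The determinant \<open>f s\<close> for \<open>s U\<close>, \<open>s L\<close>,
  \<open>s B\<close> solves \<open>f' = (\<tau> - s \<gamma>) f\<close>: a step from
  \<open>s\<close> to \<open>s + h\<close> multiplies it by a determinant of the same type, in which
  \<open>U\<close> is replaced by \<open>V = exp (s L) U exp (- s L)\<close>, and whose first order
  term is the trace of \<open>B - V - L\<close>.\<close>

theorem det1_exp_triple:
  assumes D: "nuclear (B - U - L) d" and C: "nuclear (L * U - U * L) c"
  shows "det1 (exp (- U) * exp (- L) * exp B - 1) = exp (trc (B - U - L) - trc (L * U - U * L) / 2)"
proof -
  define \<tau> where "\<tau> = trc (B - U - L)"
  define \<gamma> where "\<gamma> = trc (L * U - U * L)"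
  define F where "F s = exp (- (s *\<^sub>R U)) * exp (- (s *\<^sub>R L)) * exp (s *\<^sub>R B)" for s :: real
  define f where "f s = det1 (F s - 1)" for s
  have nF: "\<exists>c. nuclear (F s - 1) c" for s
  proof -
    have D': "nuclear (s *\<^sub>R B - s *\<^sub>R U - s *\<^sub>R L) (\<bar>s\<bar> * d)"
      using nuclear_scaleR[OF D, of s] by (simp add: scaleR_diff_right)
    have C': "nuclear ((s *\<^sub>R L) * (s *\<^sub>R U) - (s *\<^sub>R U) * (s *\<^sub>R L)) (\<bar>s * s\<bar> * c)"
      using nuclear_scaleR[OF C, of "s * s"] by (simp add: scaleR_diff_right)
    let ?r = "norm (s *\<^sub>R U) + norm (s *\<^sub>R L) + norm (s *\<^sub>R B)"
    have "norm (s *\<^sub>R U) \<le> ?r" "norm (s *\<^sub>R L) \<le> ?r" "norm (s *\<^sub>R B) \<le> 2 * ?r" by simp_all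
    from nuclear_add[OF nuclear_exp_triple[OF D' C' this] D'] show ?thesis
      unfolding F_def by (auto simp: algebra_simps)
  qed
  have deriv: "(f has_vector_derivative (f s * (\<tau> - of_real s * \<gamma>))) (at s)" for s
  proof -
    define P where "P = exp (s *\<^sub>R L)"
    define Q where "Q = exp (- (s *\<^sub>R L))"
    have PQ: "P * Q = 1" "Q * P = 1" by (simp_all add: P_def Q_def exp_minus_mult)
    have PL: "P * L = L * P" "Q * L = L * Q"
      using exp_times_scaleR_commute[of s L] exp_times_scaleR_commute[of "- s" L] by (simp_all add: P_def Q_def)
    define V where "V = P * U * Q"
    obtain c' where V: "nuclear (V - U) c'"
      unfolding V_def P_def Q_def by (rule nuclear_conjugation_diff[OF C])
    have eq: "(B - U - L) - (V - U) = B - V - L" by simp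
    note D' = nuclear_diff[OF D V, unfolded eq]
    have tD: "trc (B - V - L) = \<tau> - of_real s * \<gamma>"
    proof -
      have "trc (B - V - L) = \<tau> - trc (V - U)"
        unfolding \<tau>_def by (rule trc_diff[OF D V, unfolded eq])
      thus ?thesis unfolding V_def P_def Q_def \<gamma>_def by (simp only: trc_conjugation_diff[OF C])
    qed
    \<comment> \<open>\<open>P\<close> and \<open>Q\<close> commute with \<open>L\<close>, so the
      commutator of \<open>L\<close> with \<open>V\<close> is the conjugate of the old one and stays
      nuclear.\<close>
    have "L * V - V * L = P * (L * U - U * L) * Q"
    proof -
      have "L * V = P * (L * U) * Q" unfolding V_def using PL(1) by (metis mult.assoc)
      moreover have "V * L = P * (U * L) * Q" unfolding V_def using PL(2) by (metis mult.assoc)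
      ultimately show ?thesis by (simp add: algebra_simps)
    qed
    hence C': "nuclear (L * V - V * L) (norm Q * (norm P * c))"
      by (simp only:) (intro nuclear_mult_right nuclear_mult_left C)
    define E where "E h = exp (- (h *\<^sub>R V)) * exp (- (h *\<^sub>R L)) * exp (h *\<^sub>R B)" for h :: real
    obtain K where K: "0 \<le> K" "\<And>h. \<bar>h\<bar> \<le> 1 \<Longrightarrow> nuclear (E h - 1 - h *\<^sub>R (B - V - L)) (K * h\<^sup>2)"
      unfolding E_def by (rule nuclear_exp_triple_quadratic[OF D' C']) blast
    \<comment> \<open>\<open>F (s + h)\<close> is \<open>F s\<close> times \<open>E h\<close>
      conjugated by \<open>exp (s B)\<close>. The conjugation inside \<open>V\<close> carries
      \<open>exp (- h U)\<close> past \<open>exp (- s L)\<close>, and the determinant ignores the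
      outer conjugation.\<close>
    have step: "f (s + h) = f s * det1 (E h - 1)" if h: "\<bar>h\<bar> \<le> 1" for h
    proof -
      have nE: "nuclear (E h - 1) (K * h\<^sup>2 + \<bar>h\<bar> * (d + c'))"
        using nuclear_add[OF K(2)[OF h] nuclear_scaleR[OF D', of h]] by simp
      define X where "X = exp (s *\<^sub>R B)"
      define Y where "Y = exp (- (s *\<^sub>R B))"
      have XY: "X * Y = 1" "Y * X = 1" by (simp_all add: X_def Y_def exp_minus_mult)
      have "exp (- (h *\<^sub>R V)) = P * exp (- (h *\<^sub>R U)) * Q"
        using exp_conjugate[OF PQ, of "- (h *\<^sub>R U)"] by (simp add: V_def)
      hence E: "E h = P * exp (- (h *\<^sub>R U)) * Q * exp (- (h *\<^sub>R L)) * exp (h *\<^sub>R B)"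
        by (simp add: E_def)
      have "F s * (Y * E h * X) = exp (- (s *\<^sub>R U)) * Q * (X * Y) * E h * X"
        by (simp add: F_def Q_def X_def mult.assoc)
      also have "\<dots> = exp (- (s *\<^sub>R U)) * (Q * P) * exp (- (h *\<^sub>R U)) * Q * exp (- (h *\<^sub>R L)) * exp (h *\<^sub>R B) * X"
        by (simp only: XY E mult_1_right mult.assoc)
      also have "\<dots> = (exp (- (s *\<^sub>R U)) * exp (- (h *\<^sub>R U))) * (Q * exp (- (h *\<^sub>R L))) * (exp (h *\<^sub>R B) * X)"
        by (simp only: PQ mult_1_right mult.assoc)
      also have "exp (- (s *\<^sub>R U)) * exp (- (h *\<^sub>R U)) = exp (- ((s + h) *\<^sub>R U))"
        using exp_scaleR_add[of s h "- U"] by simp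
      also have "Q * exp (- (h *\<^sub>R L)) = exp (- ((s + h) *\<^sub>R L))"
        using exp_scaleR_add[of s h "- L"] by (simp add: Q_def)
      also have "exp (h *\<^sub>R B) * X = exp ((s + h) *\<^sub>R B)"
        using exp_scaleR_add[of h s B] by (simp add: X_def add.commute)
      finally have Fsh: "F (s + h) = F s * (Y * E h * X)" by (simp add: F_def)
      have "Y * (E h - 1) * X = Y * E h * X - 1" using XY by (simp add: algebra_simps)
      hence "F (s + h) - 1 = (F s - 1) + Y * (E h - 1) * X + (F s - 1) * (Y * (E h - 1) * X)"
        unfolding Fsh by (simp add: algebra_simps)
      moreover have "nuclear (Y * (E h - 1) * X) (norm X * (norm Y * (K * h\<^sup>2 + \<bar>h\<bar> * (d + c'))))"
        by (intro nuclear_mult_right nuclear_mult_left nE)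
      moreover obtain cF where "nuclear (F s - 1) cF" using nF by blast
      ultimately have "f (s + h) = f s * det1 (Y * (E h - 1) * X)"
        unfolding f_def using det1_mult by metis
      thus ?thesis by (simp add: det1_conjugate[OF nE XY(1)])
    qed
    define M where "M = d + c' + K"
    have M: "0 \<le> M" using nuclear_nonneg[OF D'] K by (simp add: M_def)
    \<comment> \<open>Small enough that \<open>\<bar>h\<bar> \<le> e\<close> yields both
      \<open>\<bar>h\<bar> \<le> 1\<close> and the smallness condition of
      \<open>det1_quadratic\<close>.\<close>
    define e where "e = 1 / (2 * M + 2)"
    have e: "0 < e" "e \<le> 1" "e * M \<le> 1 / 2" using M by (auto simp: e_def divide_simps)
    show ?thesis
    proof (rule has_vector_derivative_if_quadratic[OF e(1)])
      fix h :: real assume h: "\<bar>h\<bar> \<le> e"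
      have h1: "\<bar>h\<bar> \<le> 1" using h e by simp
      have hM: "\<bar>h\<bar> * (d + c' + K) \<le> 1 / 2"
        using mult_right_mono[OF h M] e(3) by (simp add: M_def)
      have "cmod (det1 (E h - 1) - 1 - of_real h * trc (B - V - L)) \<le> (2 * M\<^sup>2 + K) * h\<^sup>2"
        unfolding M_def using K h1 hM by (intro det1_quadratic[OF D']) auto
      hence "cmod (f s) * cmod (det1 (E h - 1) - 1 - of_real h * (\<tau> - of_real s * \<gamma>)) \<le> cmod (f s) * ((2 * M\<^sup>2 + K) * h\<^sup>2)"
        unfolding tD by (intro mult_left_mono) auto
      moreover have "f (s + h) - f s - h *\<^sub>R (f s * (\<tau> - of_real s * \<gamma>)) =
          f s * (det1 (E h - 1) - 1 - of_real h * (\<tau> - of_real s * \<gamma>))"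
        unfolding step[OF h1] by (simp add: scaleR_conv_of_real algebra_simps)
      ultimately show "cmod (f (s + h) - f s - h *\<^sub>R (f s * (\<tau> - of_real s * \<gamma>))) \<le> (cmod (f s) * (2 * M\<^sup>2 + K)) * h\<^sup>2"
        by (simp only: norm_mult mult.assoc)
    qed
  qed
  \<comment> \<open>The reciprocal of the expected solution: \<open>f s * q s\<close> has derivative
    zero, which solves the differential equation and involves no division by
    \<open>f\<close>.\<close>
  define q where "q s = exp (- (of_real s * \<tau> - of_real (s\<^sup>2 / 2) * \<gamma>))" for s :: real
  have "(q has_vector_derivative (- (\<tau> - of_real s * \<gamma>) * q s)) (at s)" for s
  proof -
    have "((\<lambda>z. exp (- (z * \<tau> - z\<^sup>2 / 2 * \<gamma>))) has_field_derivative
        (- (\<tau> - of_real s * \<gamma>) * exp (- (of_real s * \<tau> - (of_real s)\<^sup>2 / 2 * \<gamma>)))) (at (of_real s))"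
      by (auto intro!: derivative_eq_intros)
    from has_vector_derivative_real_field[OF this] show ?thesis
      unfolding q_def by simp
  qed
  hence "((\<lambda>s. f s * q s) has_vector_derivative 0) (at s)" for s
    using has_vector_derivative_mult[OF deriv[of s], of q "- (\<tau> - of_real s * \<gamma>) * q s"]
    by (simp add: algebra_simps)
  hence "f 1 * q 1 = f 0 * q 0" by (rule const_if_zero_vector_derivative)
  moreover have "q 0 = 1" by (simp add: q_def)
  moreover have "f 0 = 1"
  proof -
    have "f 0 = det1 0" by (simp add: f_def F_def)
    thus ?thesis by (subst (asm) fdet_finite_rows[of 0]) (auto simp: ldet_def)
  qed
  moreover have "q 1 = inverse (exp (\<tau> - \<gamma> / 2))" by (simp add: q_def flip: exp_minus)
  ultimately have "f 1 = exp (\<tau> - \<gamma> / 2)" by (simp add: field_simps)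
  thus ?thesis by (simp add: f_def F_def \<tau>_def \<gamma>_def)
qed

section \<open>Finite sections\<close>

definition clop_P :: "nat \<Rightarrow> clop" where
  "clop_P N = Abs_clop (P_proj N)"

lemma P_proj: "seq (blinfun_apply (P_proj N) x) n = (if n < N then seq x n else 0)"
  and blf_clop_P: "blf (clop_P N) = P_proj N"
proof -
  let ?f = "\<lambda>x. Abs_ell2 (\<lambda>n. if n < N then seq x n else 0)"
  have le: "(\<Sum>n<m. (cmod (if n < N then seq x n else 0))\<^sup>2) \<le> (norm x)\<^sup>2" for x m
  proof -
    have "(\<Sum>n<m. (cmod (if n < N then seq x n else 0))\<^sup>2) \<le> (\<Sum>n<m. (cmod (seq x n))\<^sup>2)"
      by (intro sum_mono) auto
    also have "\<dots> \<le> (norm x)\<^sup>2" by (rule sum_seq_le) simp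
    finally show ?thesis .
  qed
  note s = ell2_bounded_sums[OF norm_ge_zero le]
  have "bounded_linear ?f"
    by (rule bounded_linear_intro[of _ 1]) (auto intro!: ell2_eqI s(3) simp: s(2))
  hence ap: "blinfun_apply (P_proj N) = ?f"
    by (simp add: P_proj_def bounded_linear_Blinfun_apply)
  thus *: "seq (blinfun_apply (P_proj N) x) n = (if n < N then seq x n else 0)" for x n by (simp add: s(2))
  have "complex_linear (P_proj N)"
    unfolding complex_linear_def by (intro allI ell2_eqI) (simp add: *)
  thus "blf (clop_P N) = P_proj N" by (simp add: clop_P_def Abs_clop_inverse)
qed

lemma seq_ap_clop_P [simp]: "seq (ap (clop_P N) x) n = (if n < N then seq x n else 0)"
  by (simp add: blf_clop_P P_proj)

lemma clop_P_idem: "clop_P N * clop_P N = clop_P N"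
  by (rule clop_eqI) (simp add: entry_def)

lemma blf_clop_Q: "blf (1 - clop_P N) = Q_proj N"
  by (simp add: minus_clop.rep_eq one_clop.rep_eq blf_clop_P Q_proj_def)

lemma ent_clop_P_left: "ent (clop_P N * A) j k = (if j < N then ent A j k else 0)"
  by (simp add: entry_def)

lemma ent_clop_P_right: "ent (A * clop_P N) j k = (if k < N then ent A j k else 0)"
proof -
  have "ap (clop_P N) (basis_vec k) = (if k < N then basis_vec k else 0)"
    by (rule ell2_eqI) (simp add: seq_basis_vec)
  thus ?thesis by (simp add: entry_def blinfun.zero_right)
qed

lemma det_section_eq_ldet: "det_section N (blf A) = ldet (ent A) {..<N}"
proof -
  have "P_proj N o\<^sub>L blf A o\<^sub>L P_proj N = blf (clop_P N * A * clop_P N)"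
    by (simp add: times_clop.rep_eq blf_clop_P)
  hence "det_section N (blf A) = ldet (ent (clop_P N * A * clop_P N)) {..<N}"
    by (simp add: det_section_def det_mat_eq_ldet)
  also have "\<dots> = ldet (ent A) {..<N}"
    by (rule ldet_cong) (simp add: ent_clop_P_left ent_clop_P_right)
  finally show ?thesis .
qed

text \<open>The compressed perturbation vanishes beyond the first \<open>N\<close> rows. This brings
  finite sections into the calculus of \<open>det1\<close>.\<close>

lemma det1_section: "det1 (clop_P N * A * clop_P N) = ldet (ent (1 + A)) {..<N}"
proof -
  have "det1 (clop_P N * A * clop_P N) = ldet (\<lambda>i j. kron i j + ent (clop_P N * A * clop_P N) i j) {..<N}"
    by (rule fdet_finite_rows) (simp add: ent_clop_P_right ent_clop_P_left)
  also have "\<dots> = ldet (ent (1 + A)) {..<N}"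
    by (rule ldet_cong) (simp add: ent_clop_P_right ent_clop_P_left)
  finally show ?thesis .
qed

text \<open>Jacobi's identity, from \<open>A * (P + A' * Q) = A * P + Q\<close> and \<open>det (1 + X Y) = det (1 + Y X)\<close>.\<close>

lemma Jacobi_section:
  assumes inv: "A * A' = 1" and A: "nuclear (A - 1) c" and A': "nuclear (A' - 1) c'"
  shows "ldet (ent A) {..<N} = det1 (A - 1) * det1 ((1 - clop_P N) * (A' - 1) * (1 - clop_P N))"
proof -
  define P where "P = clop_P N"
  define Q where "Q = 1 - P"
  have P: "P * P = P" unfolding P_def by (rule clop_P_idem)
  have Q: "Q * Q = Q" unfolding Q_def using P by (simp add: algebra_simps)
  have n1: "nuclear ((A - 1) * P) (norm P * c)" by (intro nuclear_mult_right A)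
  have n2: "nuclear ((A' - 1) * Q) (norm Q * c')" by (intro nuclear_mult_right A')
  have "(A - 1) + (A' - 1) * Q + (A - 1) * ((A' - 1) * Q) = (A - 1) + (A * A' - A) * Q"
    by (simp add: algebra_simps)
  also have "\<dots> = (A - 1) * P" unfolding inv Q_def by (simp add: algebra_simps)
  finally have "det1 ((A - 1) * P) = det1 (A - 1) * det1 ((A' - 1) * Q)"
    using det1_mult[OF A n2] by simp
  moreover have "det1 ((A - 1) * P) = det1 (P * (A - 1) * P)"
    using det1_commute[OF n1, of P] P by (simp add: mult.assoc)
  moreover have "det1 ((A' - 1) * Q) = det1 (Q * (A' - 1) * Q)"
    using det1_commute[OF n2, of Q] Q by (simp add: mult.assoc)
  moreover have "det1 (P * (A - 1) * P) = ldet (ent A) {..<N}"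
    unfolding P_def det1_section by simp
  ultimately show ?thesis by (simp add: Q_def P_def)
qed

section \<open>Triangular operators\<close>

lemma ent_mult_lower:
  assumes "\<And>j k. j < k \<Longrightarrow> ent A j k = 0" "j < N"
  shows "ent (A * B) j k = (\<Sum>l<N. ent A j l * ent B l k)"
proof -
  have "(\<lambda>l. ent A j l * ent B l k) sums (\<Sum>l<N. ent A j l * ent B l k)"
    by (rule sums_finite) (use assms in auto)
  from sums_unique2[OF ent_mult this] show ?thesis .
qed

lemma ent_mult_upper:
  assumes "\<And>j k. k < j \<Longrightarrow> ent B j k = 0" "k < N"
  shows "ent (A * B) j k = (\<Sum>l<N. ent A j l * ent B l k)"
proof -
  have "(\<lambda>l. ent A j l * ent B l k) sums (\<Sum>l<N. ent A j l * ent B l k)"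
    by (rule sums_finite) (use assms in auto)
  from sums_unique2[OF ent_mult this] show ?thesis .
qed

lemma ldet_lower:
  assumes "\<And>i j. i < j \<Longrightarrow> m i j = 0" "\<And>i. m i i = z"
  shows "ldet m {..<N} = z ^ N"
proof -
  let ?A = "Matrix.mat N N (\<lambda>(i, j). m i j)"
  have "Determinant.det ?A = prod_list (diag_mat ?A)"
    by (rule det_lower_triangular[of N]) (use assms in auto)
  also have "diag_mat ?A = replicate N z"
    by (rule nth_equalityI) (use assms in \<open>auto simp: diag_mat_def\<close>)
  finally show ?thesis by (simp add: det_mat_eq_ldet)
qed

lemma ldet_upper:
  assumes "\<And>i j. j < i \<Longrightarrow> m i j = 0" "\<And>i. m i i = z"
  shows "ldet m {..<N} = z ^ N"
proof -
  let ?A = "Matrix.mat N N (\<lambda>(i, j). m i j)"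
  have "Determinant.det ?A = prod_list (diag_mat ?A)"
    by (rule det_upper_triangular[of _ N]) (use assms in auto)
  also have "diag_mat ?A = replicate N z"
    by (rule nth_equalityI) (use assms in \<open>auto simp: diag_mat_def\<close>)
  finally show ?thesis by (simp add: det_mat_eq_ldet)
qed

text \<open>With a lower triangular factor on the left and an upper triangular one on the right the
  inner sums stop at \<open>N\<close>, so the section of the product is the product of the sections.
  Each triangular factor contributes \<open>z ^ N\<close>.\<close>

lemma ldet_section_triangular:
  assumes L: "\<And>j k. j < k \<Longrightarrow> ent L j k = 0" "\<And>j. ent L j j = z"
    and U: "\<And>j k. k < j \<Longrightarrow> ent U j k = 0" "\<And>j. ent U j j = z"
  shows "ldet (ent (L * A * U)) {..<N} = z ^ (2 * N) * ldet (ent A) {..<N}"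
proof -
  have "ldet (ent (L * A * U)) {..<N} = ldet (\<lambda>j k. \<Sum>l<N. ent (L * A) j l * ent U l k) {..<N}"
    by (rule ldet_cong) (simp add: ent_mult_upper[OF U(1)])
  also have "\<dots> = ldet (ent (L * A)) {..<N} * ldet (ent U) {..<N}" by (rule ldet_mult)
  also have "ldet (ent (L * A)) {..<N} = ldet (\<lambda>j k. \<Sum>l<N. ent L j l * ent A l k) {..<N}"
    by (rule ldet_cong) (simp add: ent_mult_lower[OF L(1)])
  also have "\<dots> = ldet (ent L) {..<N} * ldet (ent A) {..<N}" by (rule ldet_mult)
  also have "ldet (ent L) {..<N} = z ^ N" by (rule ldet_lower) (use L in auto)
  also have "ldet (ent U) {..<N} = z ^ N" by (rule ldet_upper) (use U in auto)
  finally show ?thesis by (simp add: mult_2 power_add)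
qed

lemma exp_lower:
  assumes L: "\<And>j k. j < k \<Longrightarrow> ent L j k = 0" "\<And>j. ent L j j = z"
  shows "j < k \<Longrightarrow> ent (exp L) j k = 0" "ent (exp L) j j = exp z"
proof -
  have pow: "(\<forall>j k. j < k \<longrightarrow> ent (L ^ n) j k = 0) \<and> (\<forall>j. ent (L ^ n) j j = z ^ n)" for n
  proof (induction n)
    case (Suc n)
    have "ent (L ^ Suc n) j k = 0" if "j < k" for j k
      using ent_mult_lower[OF L(1), where N = "Suc j" and B = "L ^ n"] Suc that by (auto intro!: sum.neutral)
    moreover have "ent (L ^ Suc n) j j = z ^ Suc n" for j
      using ent_mult_lower[OF L(1), where N = "Suc j" and B = "L ^ n"] Suc L(2) by simp
    ultimately show ?case by blast
  qed auto
  have "(\<lambda>n. ent (L ^ n /\<^sub>R fact n) j k) sums ent (exp L) j k" for j k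
    by (intro bounded_linear.sums[OF bounded_linear_ent] exp_converges)
  hence s: "(\<lambda>n. ent (L ^ n) j k /\<^sub>R fact n) sums ent (exp L) j k" for j k by simp
  show "ent (exp L) j k = 0" if "j < k"
    using s[of j k] pow that by (simp add: sums_iff)
  show "ent (exp L) j j = exp z"
    using s[of j j] pow exp_converges[of z] by (simp add: sums_iff)
qed

lemma transp_one: "transp 1 = 1"
  by (rule clop_eqI) auto

lemma bounded_linear_transp: "bounded_linear transp"
  by (rule bounded_linear_intro[of _ 1]) (auto intro!: clop_eqI simp: norm_transp_le)

text \<open>Carries facts about exponentials of lower triangular operators over to upper triangular
  ones.\<close>

lemma exp_transp: "exp (transp L) = transp (exp L)"
proof -
  have pow: "transp (L ^ n) = transp L ^ n" for n
    by (induction n) (simp_all add: transp_one transp_mult power_commutes)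
  have "(\<lambda>n. transp (L ^ n /\<^sub>R fact n)) sums transp (exp L)"
    by (intro bounded_linear.sums[OF bounded_linear_transp] exp_converges)
  moreover have "transp (L ^ n /\<^sub>R fact n) = transp L ^ n /\<^sub>R fact n" for n
    using linear_scale[OF bounded_linear.linear[OF bounded_linear_transp]] by (simp add: pow)
  ultimately show ?thesis using exp_converges[of "transp L"] sums_unique2 by fastforce
qed

section \<open>Toeplitz and Hankel operators\<close>

abbreviation arc :: "real measure" where
  "arc \<equiv> lebesgue_on {-pi..pi}"

lemma integrable_continuous_arc:
  fixes g :: "real \<Rightarrow> 'a :: euclidean_space"
  shows "continuous_on {-pi..pi} g \<Longrightarrow> integrable arc g"
  by (rule continuous_imp_integrable_real)

lemma integral_exp_arc:
  "(LINT \<theta>|arc. exp (\<i> * of_int n * of_real \<theta>)) = (if n = 0 then 2 * of_real pi else 0)"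
proof (cases "n = 0")
  case True
  thus ?thesis by (simp add: measure_restrict_space scaleR_conv_of_real)
next
  case False
  let ?F = "\<lambda>z. exp (\<i> * of_int n * z) / (\<i> * of_int n)"
  have "((\<lambda>\<theta>. exp (\<i> * of_int n * of_real \<theta>)) has_integral (?F (of_real pi) - ?F (of_real (- pi)))) {-pi..pi}"
  proof (rule fundamental_theorem_of_calculus)
    fix \<theta> :: real
    have "(?F has_field_derivative exp (\<i> * of_int n * of_real \<theta>)) (at (of_real \<theta>))"
      using False by (auto intro!: derivative_eq_intros)
    thus "((\<lambda>\<theta>. ?F (of_real \<theta>)) has_vector_derivative exp (\<i> * of_int n * of_real \<theta>)) (at \<theta> within {-pi..pi})"
      by (rule has_vector_derivative_real_field[THEN has_vector_derivative_at_within])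
  qed simp
  moreover have "?F (of_real pi) = ?F (of_real (- pi))"
  proof -
    have "exp (\<i> * of_int n * of_real pi) = exp (\<i> * of_int n * of_real (- pi) + of_int n * (of_real (2 * pi) * \<i>))"
      by (simp add: algebra_simps)
    also have "\<dots> = exp (\<i> * of_int n * of_real (- pi))"
      unfolding exp_add using exp_integer_2pi[of "of_int n"] by (simp add: mult_ac)
    finally show ?thesis by simp
  qed
  moreover have "(LINT \<theta>|arc. exp (\<i> * of_int n * of_real \<theta>)) = integral {-pi..pi} (\<lambda>\<theta>. exp (\<i> * of_int n * of_real \<theta>))"
    by (intro lebesgue_integral_eq_integral integrable_continuous_arc continuous_intros) auto
  ultimately show ?thesis using False by (simp add: integral_unique)
qed

text \<open>The essential bound is an explicit argument because it becomes the bound on the operator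
  norm.\<close>

definition circle_bounded :: "(complex \<Rightarrow> complex) \<Rightarrow> real \<Rightarrow> bool" where
  "circle_bounded a C \<longleftrightarrow> 0 \<le> C \<and> (\<lambda>\<theta>. a (cis \<theta>)) \<in> borel_measurable arc \<and>
     (AE \<theta> in arc. cmod (a (cis \<theta>)) \<le> C)"

lemma integrable_circle_bounded:
  assumes a: "circle_bounded a C" and g: "continuous_on {-pi..pi} g"
  shows "integrable arc (\<lambda>\<theta>. a (cis \<theta>) * g \<theta>)"
proof (rule Bochner_Integration.integrable_bound)
  show "integrable arc (\<lambda>\<theta>. C * cmod (g \<theta>))"
    by (intro integrable_continuous_arc continuous_intros g)
  have "g \<in> borel_measurable arc"
    using integrable_continuous_arc[OF g] by (rule borel_measurable_integrable)
  thus "(\<lambda>\<theta>. a (cis \<theta>) * g \<theta>) \<in> borel_measurable arc"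
    using a unfolding circle_bounded_def by (intro borel_measurable_times) auto
  have C: "0 \<le> C" using a by (simp add: circle_bounded_def)
  have "AE \<theta> in arc. cmod (a (cis \<theta>)) \<le> C" using a by (simp add: circle_bounded_def)
  thus "AE \<theta> in arc. norm (a (cis \<theta>) * g \<theta>) \<le> norm (C * cmod (g \<theta>))"
  proof (eventually_elim)
    case (elim \<theta>)
    thus ?case using C by (simp add: norm_mult mult_right_mono)
  qed
qed

text \<open>Orthogonality of the exponentials, with \<open>f\<close> injective to keep the
  frequencies distinct. The frequencies are general because Toeplitz and Hankel forms need different
  ones.\<close>

lemma integral_norm_trig_square:
  fixes x :: "nat \<Rightarrow> complex" and f :: "nat \<Rightarrow> int"
  assumes "inj f"
  shows "(LINT \<theta>|arc. (cmod (\<Sum>k<n. x k * exp (- (\<i> * of_int (f k) * of_real \<theta>))))\<^sup>2) = 2 * pi * (\<Sum>k<n. (cmod (x k))\<^sup>2)"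
proof -
  let ?p = "\<lambda>\<theta> :: real. \<Sum>k<n. x k * exp (- (\<i> * of_int (f k) * of_real \<theta>))"
  have sq: "of_real ((cmod (?p \<theta>))\<^sup>2) = (\<Sum>k<n. \<Sum>l<n. x k * cnj (x l) * exp (\<i> * of_int (f l - f k) * of_real \<theta>))" for \<theta>
  proof -
    have "of_real ((cmod (?p \<theta>))\<^sup>2) = ?p \<theta> * (\<Sum>l<n. cnj (x l) * exp (\<i> * of_int (f l) * of_real \<theta>))"
      unfolding complex_norm_square by (simp add: exp_cnj)
    also have "\<dots> = (\<Sum>k<n. \<Sum>l<n. x k * exp (- (\<i> * of_int (f k) * of_real \<theta>)) * (cnj (x l) * exp (\<i> * of_int (f l) * of_real \<theta>)))"
      by (simp add: sum_product)
    also have "\<dots> = (\<Sum>k<n. \<Sum>l<n. x k * cnj (x l) * exp (\<i> * of_int (f l - f k) * of_real \<theta>))"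
    proof (intro sum.cong refl)
      fix k l
      have "exp (\<i> * of_int (f l - f k) * of_real \<theta>) = exp (- (\<i> * of_int (f k) * of_real \<theta>)) * exp (\<i> * of_int (f l) * of_real \<theta>)"
        by (simp add: exp_add[symmetric] algebra_simps)
      thus "x k * exp (- (\<i> * of_int (f k) * of_real \<theta>)) * (cnj (x l) * exp (\<i> * of_int (f l) * of_real \<theta>)) =
          x k * cnj (x l) * exp (\<i> * of_int (f l - f k) * of_real \<theta>)" by simp
    qed
    finally show ?thesis .
  qed
  have "complex_of_real (LINT \<theta>|arc. (cmod (?p \<theta>))\<^sup>2) = (LINT \<theta>|arc. of_real ((cmod (?p \<theta>))\<^sup>2))"
    by (rule integral_complex_of_real[symmetric])
  also have "\<dots> = (LINT \<theta>|arc. (\<Sum>k<n. \<Sum>l<n. x k * cnj (x l) * exp (\<i> * of_int (f l - f k) * of_real \<theta>)))"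
    unfolding sq ..
  also have "\<dots> = (\<Sum>k<n. \<Sum>l<n. (LINT \<theta>|arc. x k * cnj (x l) * exp (\<i> * of_int (f l - f k) * of_real \<theta>)))"
    by (subst Bochner_Integration.integral_sum, intro integrable_continuous_arc continuous_intros)
      (intro sum.cong refl Bochner_Integration.integral_sum integrable_continuous_arc continuous_intros)
  also have "\<dots> = (\<Sum>k<n. \<Sum>l<n. if l = k then 2 * of_real pi * of_real ((cmod (x k))\<^sup>2) else 0)"
  proof (intro sum.cong refl)
    fix k l
    have "(LINT \<theta>|arc. x k * cnj (x l) * exp (\<i> * of_int (f l - f k) * of_real \<theta>))
        = x k * cnj (x l) * (LINT \<theta>|arc. exp (\<i> * of_int (f l - f k) * of_real \<theta>))"
      by (rule integral_mult_right_zero)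
    also have "\<dots> = (if l = k then 2 * of_real pi * of_real ((cmod (x k))\<^sup>2) else 0)"
      unfolding integral_exp_arc complex_norm_square using injD[OF assms] by auto
    finally show "(LINT \<theta>|arc. x k * cnj (x l) * exp (\<i> * of_int (f l - f k) * of_real \<theta>)) = \<dots>" .
  qed
  also have "\<dots> = (\<Sum>k<n. 2 * of_real pi * of_real ((cmod (x k))\<^sup>2))"
  proof (intro sum.cong refl)
    fix k assume "k \<in> {..<n}"
    thus "(\<Sum>l<n. if l = k then 2 * of_real pi * of_real ((cmod (x k))\<^sup>2) else 0)
        = 2 * of_real pi * complex_of_real ((cmod (x k))\<^sup>2)"
      by (subst sum.delta) auto
  qed
  also have "\<dots> = of_real (2 * pi * (\<Sum>k<n. (cmod (x k))\<^sup>2))"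
    by (simp add: sum_distrib_left)
  finally show ?thesis by (simp only: of_real_eq_iff)
qed

text \<open>The form is the mean of \<open>a p q\<close> for trigonometric polynomials
  \<open>p\<close> and \<open>q\<close> with coefficients \<open>x\<close> and \<open>y\<close>. The
  indices \<open>e j + f k\<close> cover Toeplitz matrices (\<open>f k = - k\<close>) and Hankel
  matrices (\<open>e j = j + 1\<close>, \<open>f k = k\<close>) at once.\<close>

lemma fourier_form_bound:
  fixes x y :: "nat \<Rightarrow> complex" and e f :: "nat \<Rightarrow> int"
  assumes a: "circle_bounded a C" and e: "inj e" and f: "inj f"
  shows "cmod (\<Sum>j<n. \<Sum>k<n. fourier a (e j + f k) * x k * y j) \<le>
     C * sqrt (\<Sum>k<n. (cmod (x k))\<^sup>2) * sqrt (\<Sum>j<n. (cmod (y j))\<^sup>2)"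
proof -
  define X where "X = sqrt (\<Sum>k<n. (cmod (x k))\<^sup>2)"
  define Y where "Y = sqrt (\<Sum>j<n. (cmod (y j))\<^sup>2)"
  have X2: "X\<^sup>2 = (\<Sum>k<n. (cmod (x k))\<^sup>2)" and Y2: "Y\<^sup>2 = (\<Sum>j<n. (cmod (y j))\<^sup>2)"
    and X0: "0 \<le> X" and Y0: "0 \<le> Y" by (simp_all add: X_def Y_def sum_nonneg)
  have C: "0 \<le> C" using a by (simp add: circle_bounded_def)
  show ?thesis
  proof (cases "X = 0 \<or> Y = 0")
    case True
    have z: "(\<Sum>k<n. (cmod (z k))\<^sup>2) = 0 \<longleftrightarrow> (\<forall>k<n. z k = 0)" for z :: "nat \<Rightarrow> complex"
      by (subst sum_nonneg_eq_0_iff) auto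
    have zero: "(0 :: real)\<^sup>2 = 0" by simp
    from True have "(\<forall>k<n. x k = 0) \<or> (\<forall>j<n. y j = 0)"
      using X2 Y2 zero z by metis
    hence "(\<Sum>j<n. \<Sum>k<n. fourier a (e j + f k) * x k * y j) = 0" by (auto intro!: sum.neutral)
    thus ?thesis using C by (simp add: sum_nonneg)
  next
    case False
    hence X: "0 < X" and Y: "0 < Y" using X0 Y0 by auto
    define p where "p \<theta> = (\<Sum>k<n. x k * exp (- (\<i> * of_int (f k) * of_real \<theta>)))" for \<theta> :: real
    define q where "q \<theta> = (\<Sum>j<n. y j * exp (- (\<i> * of_int (e j) * of_real \<theta>)))" for \<theta> :: real
    have cp: "continuous_on {-pi..pi} p" and cq: "continuous_on {-pi..pi} q"
      unfolding p_def q_def by (intro continuous_intros)+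
    have prod: "(\<Sum>j<n. \<Sum>k<n. exp (- (\<i> * of_int (e j + f k) * of_real \<theta>)) * x k * y j) = p \<theta> * q \<theta>" for \<theta>
    proof -
      have "p \<theta> * q \<theta> = (\<Sum>j<n. \<Sum>k<n. (x k * exp (- (\<i> * of_int (f k) * of_real \<theta>))) * (y j * exp (- (\<i> * of_int (e j) * of_real \<theta>))))"
        unfolding p_def q_def sum_product by (rule sum.swap)
      also have "\<dots> = (\<Sum>j<n. \<Sum>k<n. exp (- (\<i> * of_int (e j + f k) * of_real \<theta>)) * x k * y j)"
      proof (intro sum.cong refl)
        fix j k
        have "exp (- (\<i> * of_int (e j + f k) * of_real \<theta>)) = exp (- (\<i> * of_int (f k) * of_real \<theta>)) * exp (- (\<i> * of_int (e j) * of_real \<theta>))"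
          by (simp add: exp_add[symmetric] algebra_simps)
        thus "(x k * exp (- (\<i> * of_int (f k) * of_real \<theta>))) * (y j * exp (- (\<i> * of_int (e j) * of_real \<theta>))) =
            exp (- (\<i> * of_int (e j + f k) * of_real \<theta>)) * x k * y j" by simp
      qed
      finally show ?thesis by simp
    qed
    let ?I = "\<lambda>j k. LINT \<theta>|arc. a (cis \<theta>) * exp (- (\<i> * of_int (e j + f k) * of_real \<theta>))"
    have int: "integrable arc (\<lambda>\<theta>. a (cis \<theta>) * exp (- (\<i> * of_int (e j + f k) * of_real \<theta>)))" for j k
      by (intro integrable_circle_bounded[OF a] continuous_intros)
    have "(LINT \<theta>|arc. a (cis \<theta>) * (p \<theta> * q \<theta>)) =
        (LINT \<theta>|arc. (\<Sum>j<n. \<Sum>k<n. a (cis \<theta>) * exp (- (\<i> * of_int (e j + f k) * of_real \<theta>)) * x k * y j))"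
      unfolding prod[symmetric] by (simp add: sum_distrib_left mult.assoc)
    also have "\<dots> = (\<Sum>j<n. \<Sum>k<n. ?I j k * x k * y j)"
      by (simp add: Bochner_Integration.integral_sum int del: of_int_add)
    finally have "(\<Sum>j<n. \<Sum>k<n. fourier a (e j + f k) * x k * y j) = 1 / of_real (2 * pi) * (LINT \<theta>|arc. a (cis \<theta>) * (p \<theta> * q \<theta>))"
      by (simp add: fourier_def sum_distrib_left mult.assoc del: of_int_add)
    hence "cmod (\<Sum>j<n. \<Sum>k<n. fourier a (e j + f k) * x k * y j) = 1 / (2 * pi) * cmod (LINT \<theta>|arc. a (cis \<theta>) * (p \<theta> * q \<theta>))"
      by (simp add: norm_mult norm_divide)
    also have "\<dots> \<le> 1 / (2 * pi) * (LINT \<theta>|arc. C / 2 * (Y / X * (cmod (p \<theta>))\<^sup>2 + X / Y * (cmod (q \<theta>))\<^sup>2))"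
    proof (intro mult_left_mono order.trans[OF integral_norm_bound] integral_mono_AE)
      show "integrable arc (\<lambda>\<theta>. cmod (a (cis \<theta>) * (p \<theta> * q \<theta>)))"
        by (intro integrable_norm integrable_circle_bounded[OF a] continuous_intros cp cq)
      show "integrable arc (\<lambda>\<theta>. C / 2 * (Y / X * (cmod (p \<theta>))\<^sup>2 + X / Y * (cmod (q \<theta>))\<^sup>2))"
        by (intro integrable_continuous_arc continuous_intros cp cq)
      have "AE \<theta> in arc. cmod (a (cis \<theta>)) \<le> C" using a by (simp add: circle_bounded_def)
      thus "AE \<theta> in arc. cmod (a (cis \<theta>) * (p \<theta> * q \<theta>)) \<le> C / 2 * (Y / X * (cmod (p \<theta>))\<^sup>2 + X / Y * (cmod (q \<theta>))\<^sup>2)"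
      proof eventually_elim
        case (elim \<theta>)
        \<comment> \<open>The weights \<open>Y / X\<close> and \<open>X / Y\<close> make both
          squares integrate to \<open>2 * pi * X * Y\<close>, so this pointwise inequality takes the
          place of Cauchy-Schwarz for integrals and loses nothing in the constant.\<close>
        have amgm: "s * t \<le> 1 / 2 * (Y / X * s\<^sup>2 + X / Y * t\<^sup>2)" for s t :: real
        proof -
          have "0 \<le> (Y * s - X * t)\<^sup>2 / (2 * X * Y)" using X Y by (intro divide_nonneg_pos) auto
          also have "\<dots> = 1 / 2 * (Y / X * s\<^sup>2 + X / Y * t\<^sup>2) - s * t"
            using X Y by (simp add: power2_eq_square field_simps)
          finally show ?thesis by simp
        qed
        have "cmod (a (cis \<theta>) * (p \<theta> * q \<theta>)) \<le> C * (cmod (p \<theta>) * cmod (q \<theta>))"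
          using elim by (simp add: norm_mult mult_right_mono)
        also have "\<dots> \<le> C * (1 / 2 * (Y / X * (cmod (p \<theta>))\<^sup>2 + X / Y * (cmod (q \<theta>))\<^sup>2))"
          by (intro mult_left_mono amgm C)
        finally show ?case by simp
      qed
    qed auto
    also have "(LINT \<theta>|arc. C / 2 * (Y / X * (cmod (p \<theta>))\<^sup>2 + X / Y * (cmod (q \<theta>))\<^sup>2))
       = C / 2 * (Y / X * (2 * pi * X\<^sup>2) + X / Y * (2 * pi * Y\<^sup>2))"
    proof -
      have ip: "integrable arc (\<lambda>\<theta>. (cmod (p \<theta>))\<^sup>2)" "integrable arc (\<lambda>\<theta>. (cmod (q \<theta>))\<^sup>2)"
        by (intro integrable_continuous_arc continuous_intros cp cq)+
      have "(LINT \<theta>|arc. (cmod (p \<theta>))\<^sup>2) = 2 * pi * X\<^sup>2" "(LINT \<theta>|arc. (cmod (q \<theta>))\<^sup>2) = 2 * pi * Y\<^sup>2"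
        unfolding p_def q_def X2 Y2 by (intro integral_norm_trig_square e f)+
      thus ?thesis using ip by simp
    qed
    also have "1 / (2 * pi) * (C / 2 * (Y / X * (2 * pi * X\<^sup>2) + X / Y * (2 * pi * Y\<^sup>2))) = C * X * Y"
      using X Y by (simp add: power2_eq_square field_simps)
    finally show ?thesis by (simp add: X_def Y_def)
  qed
qed

definition Tz :: "(complex \<Rightarrow> complex) \<Rightarrow> clop" where
  "Tz a = matrix_clop (\<lambda>j k. fourier a (int j - int k))"

definition Hz :: "(complex \<Rightarrow> complex) \<Rightarrow> clop" where
  "Hz a = matrix_clop (\<lambda>j k. fourier a (int j + int k + 1))"

lemma Toeplitz_clop:
  assumes "circle_bounded a C"
  shows "blf (Tz a) = toeplitz a" "ent (Tz a) j k = fourier a (int j - int k)" "norm (Tz a) \<le> C"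
proof -
  have "bounded_sections (\<lambda>j k. fourier a (int j - int k)) C"
    unfolding bounded_sections_def
    using assms fourier_form_bound[OF assms, of "\<lambda>j. int j" "\<lambda>k. - int k"]
    by (auto simp: circle_bounded_def inj_def)
  from matrix_clop[OF this]
  show "blf (Tz a) = toeplitz a" "ent (Tz a) j k = fourier a (int j - int k)" "norm (Tz a) \<le> C"
    by (simp_all add: Tz_def toeplitz_def)
qed

lemma Hankel_clop:
  assumes "circle_bounded a C"
  shows "blf (Hz a) = hankel a" "ent (Hz a) j k = fourier a (int j + int k + 1)"
proof -
  have "bounded_sections (\<lambda>j k. fourier a (int j + int k + 1)) C"
    unfolding bounded_sections_def
    using assms fourier_form_bound[OF assms, of "\<lambda>j. int j + 1" "\<lambda>k. int k"]
    by (auto simp: circle_bounded_def inj_def algebra_simps)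
  from matrix_clop[OF this]
  show "blf (Hz a) = hankel a" "ent (Hz a) j k = fourier a (int j + int k + 1)"
    by (simp_all add: Hz_def hankel_def)
qed

lemma fourier_add:
  assumes "circle_bounded f C" "circle_bounded g D"
  shows "fourier (\<lambda>t. f t + g t) n = fourier f n + fourier g n"
proof -
  have "integrable arc (\<lambda>\<theta>. f (cis \<theta>) * exp (- (\<i> * of_int n * of_real \<theta>)))"
    "integrable arc (\<lambda>\<theta>. g (cis \<theta>) * exp (- (\<i> * of_int n * of_real \<theta>)))"
    by (intro integrable_circle_bounded[OF assms(1)] integrable_circle_bounded[OF assms(2)] continuous_intros)+
  thus ?thesis by (simp add: fourier_def distrib_right distrib_left Bochner_Integration.integral_add)
qed

lemma fourier_scale: "fourier (\<lambda>t. c * f t) n = c * fourier f n"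
  by (simp add: fourier_def mult.assoc)

lemma fourier_flip: "fourier (flip a) n = fourier a (- n)"
proof -
  have "(LINT \<theta>|arc. flip a (cis \<theta>) * exp (- (\<i> * of_int n * of_real \<theta>)))
      = (LINT \<theta>|lebesgue_on {-pi..- (- pi)}. (\<lambda>\<theta>. a (cis \<theta>) * exp (- (\<i> * of_int (- n) * of_real \<theta>))) (- \<theta>))"
    by (simp add: flip_def cis_inverse)
  also have "\<dots> = (LINT \<theta>|lebesgue_on {-pi..pi}. a (cis \<theta>) * exp (- (\<i> * of_int (- n) * of_real \<theta>)))"
    by (rule integral_reflect_real)
  finally show ?thesis by (simp add: fourier_def)
qed

lemma fourier_zero_eq: "G_exp b = exp (fourier b 0)"
  by (simp add: G_exp_def fourier_def)

lemma fourier_one: "fourier (\<lambda>t. 1) n = (if n = 0 then 1 else 0)"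
  using integral_exp_arc[of "- n"] by (simp add: fourier_def)

section \<open>Compatible pairs\<close>

text \<open>Along a diagonal the entries are constant, while their majorant
  \<open>u (n + j) * v (n + k)\<close> tends to 0.\<close>

lemma nuclear_Toeplitz_zero:
  assumes Z: "nuclear Z c" and shift: "\<And>j k. ent Z (Suc j) (Suc k) = ent Z j k"
  shows "Z = 0"
proof (rule clop_eqI)
  fix j k
  obtain u v where dom: "dominated (ent Z) u v" by (rule nuclear_dominated[OF Z])
  have eq: "ent Z (n + j) (n + k) = ent Z j k" for n by (induction n) (auto simp: shift)
  have zero: "(\<lambda>n. w (n + i)) \<longlonglongrightarrow> 0" if "summable (\<lambda>i. (w i)\<^sup>2)" for w :: "nat \<Rightarrow> real" and i
  proof -
    have "(\<lambda>n. (w n)\<^sup>2) \<longlonglongrightarrow> 0" by (rule summable_LIMSEQ_zero[OF that])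
    hence "(\<lambda>n. sqrt ((w n)\<^sup>2)) \<longlonglongrightarrow> sqrt 0" by (rule tendsto_real_sqrt)
    hence "w \<longlonglongrightarrow> 0" by (simp add: tendsto_rabs_zero_iff)
    thus ?thesis by (rule LIMSEQ_ignore_initial_segment)
  qed
  have "(\<lambda>n. u (n + j) * v (n + k)) \<longlonglongrightarrow> 0 * 0"
    using dom by (intro tendsto_mult zero) (auto simp: dominated_def)
  moreover have "cmod (ent Z j k) \<le> u (n + j) * v (n + k)" for n
    using dom unfolding dominated_def by (metis eq)
  ultimately have "cmod (ent Z j k) \<le> 0"
    by (intro LIMSEQ_le_const[where X = "\<lambda>n. u (n + j) * v (n + k)"]) auto
  thus "ent Z j k = ent 0 j k" by simp
qed

lemma flip_flip [simp]: "flip (flip f) = f"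
  by (simp add: flip_def fun_eq_iff)

lemma eq_circle_refl: "eq_circle f f"
  by (simp add: eq_circle_def)

section \<open>Exponentials in the function algebra\<close>

context circle_banach_algebra
begin

lemma uminus_mem: "f \<in> S \<Longrightarrow> (\<lambda>t. - f t) \<in> S"
  using scale_mem[of f "-1"] by simp

lemma diff_mem: "f \<in> S \<Longrightarrow> g \<in> S \<Longrightarrow> (\<lambda>t. f t - g t) \<in> S"
  using add_mem[OF _ uminus_mem, of f g] by simp

lemma nrm_diff_commute: "f \<in> S \<Longrightarrow> g \<in> S \<Longrightarrow> nrm (\<lambda>t. f t - g t) = nrm (\<lambda>t. g t - f t)"
  using nrm_scale[OF diff_mem, of g f "-1"] by simp

lemma power_mem: "f \<in> S \<Longrightarrow> (\<lambda>t. f t ^ k) \<in> S"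
  by (induction k) (auto intro: one_mem mult_mem)

text \<open>The factor \<open>nrm (\<lambda>t. 1)\<close> accounts for \<open>k = 0\<close>; the
  unit may have a norm different from 1.\<close>

lemma nrm_power: "f \<in> S \<Longrightarrow> nrm (\<lambda>t. f t ^ k) \<le> nrm (\<lambda>t. 1) * nrm f ^ k"
proof (induction k)
  case (Suc k)
  have "nrm (\<lambda>t. f t ^ Suc k) \<le> nrm f * nrm (\<lambda>t. f t ^ k)"
    using nrm_mult[of f "\<lambda>t. f t ^ k"] Suc.prems power_mem by simp
  also have "\<dots> \<le> nrm f * (nrm (\<lambda>t. 1) * nrm f ^ k)"
    by (intro mult_left_mono Suc.IH Suc.prems nrm_nonneg)
  finally show ?case by (simp add: mult_ac)
qed simp

lemma zero_mem: "(\<lambda>t. 0) \<in> S"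
  using scale_mem[OF one_mem, of 0] by simp

lemma nrm_zero_fun: "nrm (\<lambda>t. 0) = 0"
  using nrm_zero[OF zero_mem] eq_circle_refl by simp

lemma sum_mem: "finite A \<Longrightarrow> (\<And>k. k \<in> A \<Longrightarrow> f k \<in> S) \<Longrightarrow> (\<lambda>t. \<Sum>k\<in>A. f k t) \<in> S"
  by (induction A rule: finite_induct) (auto intro: zero_mem add_mem)

lemma nrm_sum: "finite A \<Longrightarrow> (\<And>k. k \<in> A \<Longrightarrow> f k \<in> S) \<Longrightarrow> nrm (\<lambda>t. \<Sum>k\<in>A. f k t) \<le> (\<Sum>k\<in>A. nrm (f k))"
proof (induction A rule: finite_induct)
  case (insert a A)
  have "nrm (\<lambda>t. f a t + (\<Sum>k\<in>A. f k t)) \<le> nrm (f a) + nrm (\<lambda>t. \<Sum>k\<in>A. f k t)"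
    using insert by (intro nrm_add sum_mem) auto
  thus ?case using insert by force
qed (simp add: nrm_zero_fun)

lemma circle_bounded_S:
  obtains C where "0 \<le> C" "\<And>f. f \<in> S \<Longrightarrow> circle_bounded f (C * nrm f)"
proof -
  obtain C where C: "\<And>f. f \<in> S \<Longrightarrow> AE \<theta> in arc. cmod (f (cis \<theta>)) \<le> C * nrm f"
    using embedding by blast
  \<comment> \<open>\<open>embedding\<close> fixes no sign for its constant, hence the maximum with
    0.\<close>
  have "circle_bounded f (max C 0 * nrm f)" if f: "f \<in> S" for f
    unfolding circle_bounded_def
  proof (intro conjI measurable f)
    show "0 \<le> max C 0 * nrm f" using nrm_nonneg[OF f] by simp
    have "C * nrm f \<le> max C 0 * nrm f" using nrm_nonneg[OF f] by (intro mult_right_mono) auto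
    with C[OF f] show "AE \<theta> in arc. cmod (f (cis \<theta>)) \<le> max C 0 * nrm f"
      by (auto elim: eventually_mono)
  qed
  thus ?thesis by (intro that[of "max C 0"]) auto
qed

definition exp_section :: "(complex \<Rightarrow> complex) \<Rightarrow> nat \<Rightarrow> complex \<Rightarrow> complex" where
  "exp_section f n = (\<lambda>t. \<Sum>k<n. of_real (inverse (fact k)) * f t ^ k)"

lemma exp_section_mem: "f \<in> S \<Longrightarrow> exp_section f n \<in> S"
  unfolding exp_section_def by (intro sum_mem scale_mem power_mem) auto

text \<open>The partial sums are Cauchy in \<open>nrm\<close> and have a limit \<open>g\<close> in
  the algebra. By the embedding they converge to \<open>g\<close> off a null set, where they also
  converge to \<open>exp (f t)\<close>; closure under almost everywhere equality identifies the
  two.\<close>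

lemma exp_S:
  assumes f: "f \<in> S"
  shows "(\<lambda>t. exp (f t)) \<in> S" and "(\<lambda>n. nrm (\<lambda>t. exp_section f n t - exp (f t))) \<longlonglongrightarrow> 0"
proof -
  define \<beta> where "\<beta> k = nrm (\<lambda>t. 1) * (nrm f ^ k /\<^sub>R fact k)" for k
  have s: "summable \<beta>" unfolding \<beta>_def by (intro summable_mult summable_exp_generic)
  have le: "nrm (\<lambda>t. exp_section f m t - exp_section f n t) \<le> sum \<beta> {n..<m}" if "n \<le> m" for m n
  proof -
    have "exp_section f m t - exp_section f n t = (\<Sum>k=n..<m. of_real (inverse (fact k)) * f t ^ k)" for t
      unfolding exp_section_def using that by (simp add: sum_diff_nat_ivl[of 0 n m, symmetric] atLeast0LessThan[symmetric])
    hence "nrm (\<lambda>t. exp_section f m t - exp_section f n t) = nrm (\<lambda>t. \<Sum>k=n..<m. of_real (inverse (fact k)) * f t ^ k)"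
      by simp
    also have "\<dots> \<le> (\<Sum>k=n..<m. nrm (\<lambda>t. of_real (inverse (fact k)) * f t ^ k))"
      by (intro nrm_sum scale_mem power_mem f) auto
    also have "\<dots> \<le> sum \<beta> {n..<m}"
    proof (rule sum_mono)
      fix k
      have "nrm (\<lambda>t. of_real (inverse (fact k)) * f t ^ k) = inverse (fact k) * nrm (\<lambda>t. f t ^ k)"
        by (subst nrm_scale) (auto intro: power_mem f simp: norm_inverse)
      also have "\<dots> \<le> \<beta> k" using mult_left_mono[OF nrm_power[OF f, of k], of "inverse (fact k)"]
        by (simp add: \<beta>_def mult_ac)
      finally show "nrm (\<lambda>t. of_real (inverse (fact k)) * f t ^ k) \<le> \<beta> k" .
    qed
    finally show ?thesis .
  qed
  have "\<exists>N. \<forall>m\<ge>N. \<forall>n\<ge>N. nrm (\<lambda>t. exp_section f m t - exp_section f n t) < e" if e: "e > 0" for e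
  proof -
    obtain N where N: "\<And>m n. m \<ge> N \<Longrightarrow> norm (sum \<beta> {m..<n}) < e"
      using s[unfolded summable_Cauchy, rule_format, OF e] by blast
    have "nrm (\<lambda>t. exp_section f m t - exp_section f n t) < e" if "m \<ge> N" "n \<ge> N" for m n
    proof (cases "n \<le> m")
      case True
      thus ?thesis using le[OF True] N[OF that(2), of m] by simp
    next
      case False
      hence "nrm (\<lambda>t. exp_section f n t - exp_section f m t) < e"
        using le[of m n] N[OF that(1), of n] by simp
      thus ?thesis using nrm_diff_commute[OF exp_section_mem[OF f] exp_section_mem[OF f]] by metis
    qed
    thus ?thesis by blast
  qed
  from complete[OF exp_section_mem[OF f] this]
  obtain g where g: "g \<in> S" "(\<lambda>n. nrm (\<lambda>t. exp_section f n t - g t)) \<longlonglongrightarrow> 0" by blast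
  obtain C where C: "\<And>f. f \<in> S \<Longrightarrow> circle_bounded f (C * nrm f)" by (rule circle_bounded_S) blast
  have "AE \<theta> in arc. cmod (exp_section f n (cis \<theta>) - g (cis \<theta>)) \<le> C * nrm (\<lambda>t. exp_section f n t - g t)" for n
    using C[OF diff_mem[OF exp_section_mem[OF f] g(1)], of n] by (simp add: circle_bounded_def)
  hence "AE \<theta> in arc. \<forall>n. cmod (exp_section f n (cis \<theta>) - g (cis \<theta>)) \<le> C * nrm (\<lambda>t. exp_section f n t - g t)"
    by (simp add: AE_all_countable)
  hence eq: "eq_circle g (\<lambda>t. exp (f t))"
    unfolding eq_circle_def
  proof eventually_elim
    case (elim \<theta>)
    have "(\<lambda>n. C * nrm (\<lambda>t. exp_section f n t - g t)) \<longlonglongrightarrow> C * 0"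
      by (intro tendsto_mult tendsto_const g)
    hence "(\<lambda>n. exp_section f n (cis \<theta>) - g (cis \<theta>)) \<longlonglongrightarrow> 0"
      by (intro Lim_null_comparison[OF always_eventually[OF elim]]) simp
    hence "(\<lambda>n. exp_section f n (cis \<theta>)) \<longlonglongrightarrow> g (cis \<theta>)" by (simp add: LIM_zero_iff)
    moreover have "(\<lambda>n. exp_section f n (cis \<theta>)) \<longlonglongrightarrow> exp (f (cis \<theta>))"
      using exp_converges[of "f (cis \<theta>)"] by (simp add: exp_section_def sums_def scaleR_conv_of_real)
    ultimately show ?case by (rule LIMSEQ_unique)
  qed
  thus mem: "(\<lambda>t. exp (f t)) \<in> S" using ae_closed g(1) by blast
  have "nrm (\<lambda>t. exp_section f n t - exp (f t)) = nrm (\<lambda>t. exp_section f n t - g t)" for n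
  proof -
    have "eq_circle (\<lambda>t. exp_section f n t - g t) (\<lambda>t. exp_section f n t - exp (f t))"
      using eq unfolding eq_circle_def by (auto elim: eventually_mono)
    thus ?thesis using ae_closed[OF diff_mem[OF exp_section_mem[OF f] g(1)]] by blast
  qed
  thus "(\<lambda>n. nrm (\<lambda>t. exp_section f n t - exp (f t))) \<longlonglongrightarrow> 0" using g(2) by simp
qed

text \<open>\<open>\<Phi>\<close> is asked to respect the powers of this one \<open>f\<close> and no
  other products, which suits \<open>Tz\<close> and \<open>Mc\<close>: they are known to be
  multiplicative for special factors only.\<close>

lemma exp_homomorphism:
  fixes \<Phi> :: "(complex \<Rightarrow> complex) \<Rightarrow> clop"
  assumes f: "f \<in> S"
    and add: "\<And>g h. g \<in> S \<Longrightarrow> h \<in> S \<Longrightarrow> \<Phi> (\<lambda>t. g t + h t) = \<Phi> g + \<Phi> h"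
    and scale: "\<And>r g. g \<in> S \<Longrightarrow> \<Phi> (\<lambda>t. of_real r * g t) = r *\<^sub>R \<Phi> g"
    and bound: "\<And>g. g \<in> S \<Longrightarrow> norm (\<Phi> g) \<le> C * nrm g"
    and pow: "\<And>k. \<Phi> (\<lambda>t. f t ^ k) = X ^ k"
  shows "\<Phi> (\<lambda>t. exp (f t)) = exp X"
proof -
  have diff: "\<Phi> (\<lambda>t. g t - h t) = \<Phi> g - \<Phi> h" if "g \<in> S" "h \<in> S" for g h
    using add[OF that(1) scale_mem[OF that(2)], of "of_real (- 1)"] scale[OF that(2), of "-1"] by simp
  have zero: "\<Phi> (\<lambda>t. 0) = 0" using scale[OF one_mem, of 0] by simp
  have sec: "\<Phi> (exp_section f n) = (\<Sum>k<n. X ^ k /\<^sub>R fact k)" for n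
  proof (induction n)
    case (Suc n)
    have "exp_section f (Suc n) = (\<lambda>t. exp_section f n t + of_real (inverse (fact n)) * f t ^ n)"
      by (simp add: exp_section_def)
    hence "\<Phi> (exp_section f (Suc n)) = \<Phi> (exp_section f n) + \<Phi> (\<lambda>t. of_real (inverse (fact n)) * f t ^ n)"
      using add[OF exp_section_mem[OF f] scale_mem[OF power_mem[OF f]]] by simp
    also have "\<Phi> (\<lambda>t. of_real (inverse (fact n)) * f t ^ n) = X ^ n /\<^sub>R fact n"
      unfolding scale[OF power_mem[OF f]] pow ..
    finally show ?case using Suc by simp
  qed (simp add: exp_section_def zero)
  have "(\<lambda>n. C * nrm (\<lambda>t. exp_section f n t - exp (f t))) \<longlonglongrightarrow> 0"
    by (intro tendsto_mult_right_zero exp_S(2)[OF f])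
  moreover have "norm (\<Phi> (exp_section f n) - \<Phi> (\<lambda>t. exp (f t))) \<le> C * nrm (\<lambda>t. exp_section f n t - exp (f t))" for n
    using bound[OF diff_mem[OF exp_section_mem[OF f] exp_S(1)[OF f]], of n]
      diff[OF exp_section_mem[OF f] exp_S(1)[OF f]] by simp
  ultimately have "(\<lambda>n. \<Phi> (exp_section f n) - \<Phi> (\<lambda>t. exp (f t))) \<longlonglongrightarrow> 0"
    by (rule Lim_null_comparison[OF always_eventually[OF allI], rotated])
  hence "(\<lambda>n. \<Sum>k<n. X ^ k /\<^sub>R fact k) \<longlonglongrightarrow> \<Phi> (\<lambda>t. exp (f t))" by (simp add: LIM_zero_iff sec)
  moreover have "(\<lambda>n. \<Sum>k<n. X ^ k /\<^sub>R fact k) \<longlonglongrightarrow> exp X"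
    using exp_converges[of X] by (simp add: sums_def)
  ultimately show ?thesis by (rule LIMSEQ_unique)
qed

lemma Tz_S:
  assumes "f \<in> S"
  shows "blf (Tz f) = toeplitz f" "ent (Tz f) j k = fourier f (int j - int k)"
  using circle_bounded_S Toeplitz_clop(1,2) assms by metis+

lemma Hz_S:
  assumes "f \<in> S"
  shows "blf (Hz f) = hankel f" "ent (Hz f) j k = fourier f (int j + int k + 1)"
  using circle_bounded_S Hankel_clop assms by metis+

lemma fourier_add_S: "f \<in> S \<Longrightarrow> g \<in> S \<Longrightarrow> fourier (\<lambda>t. f t + g t) n = fourier f n + fourier g n"
  using circle_bounded_S fourier_add by metis

lemma Tz_add: "f \<in> S \<Longrightarrow> g \<in> S \<Longrightarrow> Tz (\<lambda>t. f t + g t) = Tz f + Tz g"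
  by (rule clop_eqI) (simp add: Tz_S(2) add_mem fourier_add_S)

lemma Tz_scaleR: "f \<in> S \<Longrightarrow> Tz (\<lambda>t. of_real r * f t) = r *\<^sub>R Tz f"
  by (rule clop_eqI) (simp add: Tz_S(2) scale_mem fourier_scale scaleR_conv_of_real[where 'a = complex])

lemma Tz_uminus: "f \<in> S \<Longrightarrow> Tz (\<lambda>t. - f t) = - Tz f"
  using Tz_scaleR[of f "-1"] by simp

lemma Tz_bounded:
  obtains C where "\<And>f. f \<in> S \<Longrightarrow> norm (Tz f) \<le> C * nrm f"
proof -
  obtain C where "\<And>f. f \<in> S \<Longrightarrow> circle_bounded f (C * nrm f)" by (rule circle_bounded_S) blast
  thus ?thesis using that[of C] Toeplitz_clop(3) by blast
qed

lemma Tz_one: "Tz (\<lambda>t. 1) = 1"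
  by (rule clop_eqI) (simp add: Tz_S(2) one_mem fourier_one)

lemma Tz_exp:
  assumes "f \<in> S" "\<And>k. Tz (\<lambda>t. f t ^ k) = Tz f ^ k"
  shows "Tz (\<lambda>t. exp (f t)) = exp (Tz f)"
proof -
  obtain C where "\<And>f. f \<in> S \<Longrightarrow> norm (Tz f) \<le> C * nrm f" by (rule Tz_bounded) blast
  thus ?thesis using assms by (intro exp_homomorphism[where C = C] Tz_add Tz_scaleR)
qed

end

section \<open>Consequences of the axioms for M\<close>

context compatible_pair
begin

definition Mc :: "(complex \<Rightarrow> complex) \<Rightarrow> clop" where
  "Mc f = Abs_clop (M f)"

lemma blf_Mc: "f \<in> S \<Longrightarrow> blf (Mc f) = M f"
  by (simp add: Mc_def Abs_clop_inverse M_complex_linear)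

lemma clop_eq_iff: "A = B \<longleftrightarrow> blf A = blf B"
  by (simp add: blf_inject)

lemma Mc_add: "f \<in> S \<Longrightarrow> g \<in> S \<Longrightarrow> Mc (\<lambda>t. f t + g t) = Mc f + Mc g"
  by (simp add: clop_eq_iff blf_Mc add_mem M_add plus_clop.rep_eq)

lemma Mc_scaleR: "f \<in> S \<Longrightarrow> Mc (\<lambda>t. of_real r * f t) = r *\<^sub>R Mc f"
  by (simp add: clop_eq_iff blf_Mc scale_mem scaleR_clop.rep_eq)
    (auto intro!: blinfun_eqI simp: M_scale blinfun.scaleR_left scaleC_of_real)

lemma Mc_one: "Mc (\<lambda>t. 1) = 1"
  by (simp add: clop_eq_iff blf_Mc one_mem M_one one_clop.rep_eq)

lemma Mc_mult:
  assumes "a \<in> S_minus S" "b \<in> S" "c \<in> S_even S"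
  shows "Mc (\<lambda>t. a t * b t * c t) = Tz a * Mc b * Mc c"
proof -
  have m: "a \<in> S" "c \<in> S" using assms by (auto simp: S_minus_def S_even_def)
  show ?thesis
    using assms m by (simp add: clop_eq_iff blf_Mc mult_mem M_mult times_clop.rep_eq Tz_S(1))
qed

lemma tc_Mc_diff: "f \<in> S \<Longrightarrow> tc (Mc f - Tz f)"
  using M_trace_class by (auto simp: minus_clop.rep_eq blf_Mc Tz_S(1))

lemma one_even: "(\<lambda>t. 1) \<in> S_even S"
  by (simp add: S_even_def one_mem flip_def eq_circle_def)

lemma one_minus: "(\<lambda>t. 1) \<in> S_minus S"
  by (simp add: S_minus_def one_mem fourier_one)

lemma Mc_mult_minus: "a \<in> S_minus S \<Longrightarrow> b \<in> S \<Longrightarrow> Mc (\<lambda>t. a t * b t) = Tz a * Mc b"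
  using Mc_mult[OF _ _ one_even] by (simp add: Mc_one)

lemma Mc_mult_even: "b \<in> S \<Longrightarrow> c \<in> S_even S \<Longrightarrow> Mc (\<lambda>t. b t * c t) = Mc b * Mc c"
  using Mc_mult[OF one_minus] by (simp add: Tz_one)

lemma flip_mem: "f \<in> S \<Longrightarrow> flip f \<in> S"
  using flip_bounded by blast

lemma flip_plus: "f \<in> S_plus S \<Longrightarrow> flip f \<in> S_minus S"
  by (simp add: S_plus_def S_minus_def flip_mem fourier_flip)

lemma uminus_plus: "f \<in> S_plus S \<Longrightarrow> (\<lambda>t. - f t) \<in> S_plus S"
  using fourier_scale[of "-1" f] by (simp add: S_plus_def uminus_mem)

lemma evenI: "f \<in> S \<Longrightarrow> flip f = f \<Longrightarrow> f \<in> S_even S"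
  by (simp add: S_even_def eq_circle_refl)

text \<open>\<open>T(ab) - T(a) T(b)\<close> is of trace class by the axioms for \<open>M\<close>, and for \<open>a \<in> S\<^sub>-\<close> it is
  constant along diagonals, so it vanishes.\<close>

lemma Tz_mult_minus:
  assumes a: "a \<in> S_minus S" and b: "b \<in> S"
  shows "Tz (\<lambda>t. a t * b t) = Tz a * Tz b"
proof -
  have aS: "a \<in> S" and a0: "\<And>n. n > 0 \<Longrightarrow> fourier a n = 0" using a by (auto simp: S_minus_def)
  have ab: "(\<lambda>t. a t * b t) \<in> S" by (intro mult_mem aS b)
  define Z where "Z = Tz (\<lambda>t. a t * b t) - Tz a * Tz b"
  have "Z = Tz a * (Mc b - Tz b) - (Mc (\<lambda>t. a t * b t) - Tz (\<lambda>t. a t * b t))"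
    by (simp add: Z_def Mc_mult_minus[OF a b] algebra_simps)
  hence "tc Z" by (simp only:) (intro tc_diff tc_mult_left tc_Mc_diff b ab)
  then obtain c where Z: "nuclear Z c" by (rule tc_nuclear)
  \<comment> \<open>Shifting both indices by one puts a term \<open>l = 0\<close> in front of the
    series; it carries the coefficient of \<open>a\<close> at \<open>j + 1 > 0\<close>, which is
    zero for \<open>a\<close> in \<open>S_minus S\<close>.\<close>
  have shift: "ent (Tz a * Tz b) (Suc j) (Suc k) = ent (Tz a * Tz b) j k" for j k
  proof -
    have "(\<lambda>l. ent (Tz a) (Suc j) l * ent (Tz b) l (Suc k)) sums ent (Tz a * Tz b) (Suc j) (Suc k)"
      by (rule ent_mult)
    moreover have "ent (Tz a) (Suc j) 0 = 0" using a0[of "int (Suc j)"] by (simp add: Tz_S(2)[OF aS])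
    ultimately have "(\<lambda>l. ent (Tz a) (Suc j) (Suc l) * ent (Tz b) (Suc l) (Suc k)) sums ent (Tz a * Tz b) (Suc j) (Suc k)"
      by (subst sums_Suc_iff) simp
    hence "(\<lambda>l. ent (Tz a) j l * ent (Tz b) l k) sums ent (Tz a * Tz b) (Suc j) (Suc k)"
      by (simp add: Tz_S(2)[OF aS] Tz_S(2)[OF b])
    from sums_unique2[OF this ent_mult] show ?thesis .
  qed
  have "Z = 0"
    by (rule nuclear_Toeplitz_zero[OF Z]) (simp add: Z_def shift Tz_S(2)[OF ab])
  thus ?thesis by (simp add: Z_def)
qed

lemma Tz_flip: "f \<in> S \<Longrightarrow> Tz (flip f) = transp (Tz f)"
  by (rule clop_eqI) (simp add: Tz_S(2) flip_mem fourier_flip)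

text \<open>Transposition reverses the factors and flips both symbols, which reduces this to a left
  factor in \<open>S_minus S\<close>.\<close>

lemma Tz_mult_plus:
  assumes a: "a \<in> S" and b: "b \<in> S_plus S"
  shows "Tz (\<lambda>t. a t * b t) = Tz a * Tz b"
proof -
  have bS: "b \<in> S" using b by (simp add: S_plus_def)
  have "flip (\<lambda>t. a t * b t) = (\<lambda>t. flip b t * flip a t)"
    by (simp add: flip_def fun_eq_iff mult.commute)
  hence "transp (Tz (\<lambda>t. a t * b t)) = Tz (\<lambda>t. flip b t * flip a t)"
    using Tz_flip[OF mult_mem[OF a bS]] by simp
  also have "\<dots> = transp (Tz a * Tz b)"
    by (simp add: Tz_mult_minus[OF flip_plus[OF b] flip_mem[OF a]] Tz_flip a bS transp_mult)
  finally show ?thesis by (metis transp_transp)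
qed

text \<open>Applied to \<open>b_plus\<close>, and again to \<open>a_plus\<close>, where it says that
  \<open>exp U\<close> and \<open>exp L\<close> commute up to trace class.\<close>

lemma tc_commutator:
  assumes f: "f \<in> S_plus S"
  shows "tc (Tz (flip f) * Tz f - Tz f * Tz (flip f))"
proof -
  have fS: "f \<in> S" using f by (simp add: S_plus_def)
  have ff: "flip f \<in> S" by (rule flip_mem[OF fS])
  define c where "c = (\<lambda>t. f t + flip f t)"
  have cS: "c \<in> S" unfolding c_def by (intro add_mem fS ff)
  have c: "c \<in> S_even S"
    by (rule evenI[OF cS]) (simp add: c_def flip_def add.commute fun_eq_iff)
  have cc: "(\<lambda>t. c t * c t) \<in> S" by (intro mult_mem cS)
  have Tc: "Tz c = Tz f + Tz (flip f)" unfolding c_def by (rule Tz_add[OF fS ff])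
  \<comment> \<open>This splitting puts the \<open>S_minus\<close> factor on the left and the
    \<open>S_plus\<close> factor on the right, so \<open>Tz\<close> is multiplicative on both
    products; their sum exceeds \<open>Tz c * Tz c\<close> exactly by the commutator.\<close>
  have "(\<lambda>t. c t * c t) = (\<lambda>t. flip f t * c t + c t * f t)" by (simp add: c_def algebra_simps)
  hence "Tz (\<lambda>t. c t * c t) = Tz (flip f) * Tz c + Tz c * Tz f"
    by (simp add: Tz_add mult_mem ff cS fS Tz_mult_minus[OF flip_plus[OF f] cS] Tz_mult_plus[OF cS f])
  hence "Tz (flip f) * Tz f - Tz f * Tz (flip f) = Tz (\<lambda>t. c t * c t) - Tz c * Tz c"
    by (simp add: Tc algebra_simps)
  also have "\<dots> = (Mc c - Tz c) * Mc c + Tz c * (Mc c - Tz c) - (Mc (\<lambda>t. c t * c t) - Tz (\<lambda>t. c t * c t))"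
    by (simp add: Mc_mult_even[OF cS c] algebra_simps)
  finally show ?thesis
    by (simp only:) (intro tc_diff tc_add tc_mult_left tc_mult_right tc_Mc_diff cS cc)
qed

lemma Tz_exp_plus:
  assumes f: "f \<in> S_plus S"
  shows "Tz (\<lambda>t. exp (f t)) = exp (Tz f)"
proof (rule Tz_exp)
  show fS: "f \<in> S" using f by (simp add: S_plus_def)
  show "Tz (\<lambda>t. f t ^ k) = Tz f ^ k" for k
  proof (induction k)
    case (Suc k)
    have "Tz (\<lambda>t. f t ^ k * f t) = Tz f ^ k * Tz f"
      by (simp add: Tz_mult_plus[OF power_mem[OF fS] f] Suc)
    thus ?case by (simp add: power_Suc2 del: power_Suc)
  qed (simp add: Tz_one)
qed

lemma Tz_lower: "f \<in> S_plus S \<Longrightarrow> j < k \<Longrightarrow> ent (Tz f) j k = 0"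
  and Tz_diag: "f \<in> S_plus S \<Longrightarrow> ent (Tz f) j j = fourier f 0"
  by (auto simp: S_plus_def Tz_S(2))

text \<open>The negative coefficients of \<open>exp f\<close> stand above the diagonal of its
  Toeplitz operator, which is \<open>exp (Tz f)\<close> and hence lower triangular.\<close>

lemma exp_plus:
  assumes f: "f \<in> S_plus S"
  shows "(\<lambda>t. exp (f t)) \<in> S_plus S"
proof -
  have fS: "f \<in> S" using f by (simp add: S_plus_def)
  have "fourier (\<lambda>t. exp (f t)) n = 0" if "n < 0" for n
  proof -
    have "fourier (\<lambda>t. exp (f t)) n = ent (exp (Tz f)) 0 (nat (- n))"
      using Tz_S(2)[OF exp_S(1)[OF fS], of 0 "nat (- n)"] that by (simp add: Tz_exp_plus[OF f])
    also have "\<dots> = 0"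
      by (rule exp_lower(1)[OF Tz_lower[OF f] Tz_diag[OF f]]) (use that in auto)
    finally show ?thesis .
  qed
  thus ?thesis by (simp add: S_plus_def exp_S(1)[OF fS])
qed

lemma Mc_exp_even:
  assumes c: "c \<in> S_even S"
  shows "Mc (\<lambda>t. exp (c t)) = exp (Mc c)"
proof -
  have cS: "c \<in> S" using c by (simp add: S_even_def)
  obtain C where C: "\<forall>f\<in>S. norm (M f) \<le> C * nrm f" using M_bounded by blast
  show ?thesis
  proof (rule exp_homomorphism[OF cS, where C = C])
    show "norm (Mc g) \<le> C * nrm g" if "g \<in> S" for g
      using C that by (simp add: norm_clop.rep_eq blf_Mc)
    show "Mc (\<lambda>t. c t ^ k) = Mc c ^ k" for k
    proof (induction k)
      case (Suc k)
      have "Mc (\<lambda>t. c t ^ k * c t) = Mc c ^ k * Mc c"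
        by (simp add: Mc_mult_even[OF power_mem[OF cS] c] Suc)
      thus ?case by (simp add: power_Suc2 del: power_Suc)
    qed (simp add: Mc_one)
  qed (simp_all add: Mc_add Mc_scaleR)
qed

text \<open>The entries of \<open>Tz (flip f) * Tz f\<close> and of
  \<open>Tz f * Tz (flip f)\<close> are an infinite and a finite sum of the same terms
  \<open>?g l\<close>: the finite one covers \<open>l \<le> j + k\<close>, and the remaining terms
  are those of the Hankel square.\<close>

lemma Hankel_square:
  assumes f: "f \<in> S_plus S"
  shows "Hz (\<lambda>t. f t + flip f t) * Hz (\<lambda>t. f t + flip f t) = Tz (flip f) * Tz f - Tz f * Tz (flip f)"
proof (rule clop_eqI)
  fix j k
  have fS: "f \<in> S" and f0: "\<And>n. n < 0 \<Longrightarrow> fourier f n = 0" using f by (auto simp: S_plus_def)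
  have ff: "flip f \<in> S" by (rule flip_mem[OF fS])
  define \<beta> where "\<beta> = fourier f"
  let ?b = "\<lambda>t. f t + flip f t"
  let ?g = "\<lambda>l. \<beta> (int l - int j) * \<beta> (int l - int k)"
  \<comment> \<open>Hankel entries use indices at least 1, where the coefficients of
    \<open>flip f\<close> vanish.\<close>
  have H: "ent (Hz ?b) m n = \<beta> (int m + int n + 1)" for m n
    by (simp add: Hz_S(2) add_mem fS ff fourier_add_S fourier_flip f0 \<beta>_def)
  have L: "ent (Tz f) m n = \<beta> (int m - int n)" for m n by (simp add: Tz_S(2) fS \<beta>_def)
  have U: "ent (Tz (flip f)) m n = \<beta> (int n - int m)" for m n by (simp add: Tz_S(2) ff fourier_flip \<beta>_def)
  have "(\<lambda>l. ?g l) sums ent (Tz (flip f) * Tz f) j k"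
    using ent_mult[of "Tz (flip f)" j "Tz f" k] by (simp add: L U)
  hence UL: "(\<lambda>l. ?g (l + (j + k + 1))) sums (ent (Tz (flip f) * Tz f) j k - (\<Sum>l<j + k + 1. ?g l))"
    by (rule sums_split_initial_segment)
  have "(\<lambda>l. \<beta> (int j + int l + 1) * \<beta> (int l + int k + 1)) sums ent (Hz ?b * Hz ?b) j k"
    using ent_mult[of "Hz ?b" j "Hz ?b" k] by (simp add: H)
  moreover have "\<beta> (int j + int l + 1) * \<beta> (int l + int k + 1) = ?g (l + (j + k + 1))" for l
    by (simp add: algebra_simps)
  ultimately have HH: "ent (Hz ?b * Hz ?b) j k = ent (Tz (flip f) * Tz f) j k - (\<Sum>l<j + k + 1. ?g l)"
    using sums_unique2 UL by simp
  have "(\<lambda>l. \<beta> (int j - int l) * \<beta> (int k - int l)) sums ent (Tz f * Tz (flip f)) j k"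
    using ent_mult[of "Tz f" j "Tz (flip f)" k] by (simp add: L U)
  moreover have "(\<lambda>l. \<beta> (int j - int l) * \<beta> (int k - int l)) sums (\<Sum>l<j + k + 1. \<beta> (int j - int l) * \<beta> (int k - int l))"
    by (rule sums_finite) (auto simp: \<beta>_def f0)
  ultimately have "ent (Tz f * Tz (flip f)) j k = (\<Sum>l<j + k + 1. \<beta> (int j - int l) * \<beta> (int k - int l))"
    by (rule sums_unique2)
  \<comment> \<open>Reversal of the summation turns \<open>j - l\<close> into \<open>l - k\<close>
    and \<open>k - l\<close> into \<open>l - j\<close>.\<close>
  also have "\<dots> = (\<Sum>l<j + k + 1. ?g l)"
    by (rule sum.reindex_bij_witness[of _ "\<lambda>l. j + k - l" "\<lambda>l. j + k - l"]) (auto simp: of_nat_diff algebra_simps)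
  finally show "ent (Hz ?b * Hz ?b) j k = ent (Tz (flip f) * Tz f - Tz f * Tz (flip f)) j k"
    by (simp add: HH)
qed

end

section \<open>The determinant identity\<close>

lemma fredholm_det_blf: "fredholm_det (blf X) = det1 (X - 1)"
proof -
  have "blf X = id_blinfun + blf (X - 1)" by (simp add: minus_clop.rep_eq one_clop.rep_eq)
  thus ?thesis using fredholm_det_eq_fdet by metis
qed

theorem proposition4p1:
  fixes S :: "(complex \<Rightarrow> complex) set"
    and nrm :: "(complex \<Rightarrow> complex) \<Rightarrow> real"
    and M :: "(complex \<Rightarrow> complex) \<Rightarrow> ell2 \<Rightarrow>\<^sub>L ell2"
    and b_plus a_plus b a :: "complex \<Rightarrow> complex"
    and K :: "ell2 \<Rightarrow>\<^sub>L ell2"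
  assumes "compatible_pair S nrm M"
    and "b_plus \<in> S_plus S"
    and "a_plus = (\<lambda>t. exp (b_plus t))"
    and "b = (\<lambda>t. b_plus t + flip b_plus t)"
    and "a = (\<lambda>t. a_plus t * flip a_plus t)"
    and "K = (M (\<lambda>t. inverse (a_plus t)) o\<^sub>L toeplitz a_plus) - id_blinfun"
  shows "a = (\<lambda>t. exp (b t))
    \<and> trace_class ((toeplitz (\<lambda>t. inverse (a t)) o\<^sub>L M a) - id_blinfun)
    \<and> trace_class (M b - toeplitz b)
    \<and> trace_class (hankel b o\<^sub>L hankel b)
    \<and> trace_class K
    \<and> (\<forall>N\<ge>1. trace_class (Q_proj N o\<^sub>L K o\<^sub>L Q_proj N))
    \<and> (\<forall>N\<ge>1. det_section N (M a) =
           G_exp b ^ N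
           * fredholm_det (toeplitz (\<lambda>t. inverse (a t)) o\<^sub>L M a)
           * fredholm_det (id_blinfun + (Q_proj N o\<^sub>L K o\<^sub>L Q_proj N)))
    \<and> fredholm_det (toeplitz (\<lambda>t. inverse (a t)) o\<^sub>L M a) =
           exp (op_trace (M b - toeplitz b) + 1 / 2 * op_trace (hankel b o\<^sub>L hankel b))"
proof -
  interpret compatible_pair S nrm M by fact
  have bp: "b_plus \<in> S_plus S" by fact
  have bpS: "b_plus \<in> S" using bp by (simp add: S_plus_def)
  have bm: "flip b_plus \<in> S_minus S" by (rule flip_plus[OF bp])
  have bmS: "flip b_plus \<in> S" by (rule flip_mem[OF bpS])
  have bS: "b \<in> S" unfolding assms by (intro add_mem bpS bmS)
  have b_even: "b \<in> S_even S"
    by (rule evenI[OF bS]) (simp add: assms flip_def add.commute fun_eq_iff)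
  have mb_even: "(\<lambda>t. - b t) \<in> S_even S"
    by (rule evenI[OF uminus_mem[OF bS]]) (simp add: assms flip_def add.commute fun_eq_iff)
  have a_exp: "a = (\<lambda>t. exp (b t))"
    by (simp add: assms flip_def exp_add)
  have aS: "a \<in> S" unfolding a_exp by (rule exp_S(1)[OF bS])
  have ia: "(\<lambda>t. inverse (a t)) = (\<lambda>t. exp (- b t))" by (simp add: a_exp exp_minus)
  have iaS: "(\<lambda>t. inverse (a t)) \<in> S" unfolding ia by (rule exp_S(1)[OF uminus_mem[OF bS]])
  have ap: "a_plus \<in> S_plus S" unfolding assms by (rule exp_plus[OF bp])
  have apS: "a_plus \<in> S" using ap by (simp add: S_plus_def)
  have mbp: "(\<lambda>t. - b_plus t) \<in> S_plus S" by (rule uminus_plus[OF bp])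
  have iap: "(\<lambda>t. inverse (a_plus t)) = (\<lambda>t. exp (- b_plus t))" by (simp add: assms exp_minus)
  have iapp: "(\<lambda>t. inverse (a_plus t)) \<in> S_plus S" unfolding iap by (rule exp_plus[OF mbp])
  have iapS: "(\<lambda>t. inverse (a_plus t)) \<in> S" using iapp by (simp add: S_plus_def)

  define U where "U = Tz (flip b_plus)"
  define L where "L = Tz b_plus"
  define B where "B = Mc b"
  define D where "D = B - U - L"
  define z where "z = fourier b_plus 0"

  have U_transp: "U = transp L" unfolding U_def L_def by (rule Tz_flip[OF bpS])
  have Tb: "Tz b = U + L" unfolding assms U_def L_def by (simp add: Tz_add bpS bmS add.commute)
  have Tap: "Tz a_plus = exp L" unfolding L_def assms by (rule Tz_exp_plus[OF bp])
  have Tap': "Tz (flip a_plus) = exp U" by (simp add: Tz_flip[OF apS] Tap U_transp exp_transp)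
  have Tiap: "Tz (\<lambda>t. inverse (a_plus t)) = exp (- L)"
    unfolding iap Tz_exp_plus[OF mbp] by (simp add: Tz_uminus bpS L_def)
  have Tiap': "Tz (flip (\<lambda>t. inverse (a_plus t))) = exp (- U)"
  proof -
    have "transp (- L) = - U"
      unfolding U_transp by (rule clop_eqI) simp
    thus ?thesis by (simp add: Tz_flip[OF iapS] Tiap exp_transp[symmetric])
  qed
  have Ta: "Tz a = exp U * exp L"
  proof -
    have "a = (\<lambda>t. flip a_plus t * a_plus t)" by (simp add: assms mult.commute)
    thus ?thesis using Tz_mult_plus[OF flip_mem[OF apS] ap] by (simp add: Tap Tap')
  qed
  have Tia: "Tz (\<lambda>t. inverse (a t)) = exp (- U) * exp (- L)"
  proof -
    have "(\<lambda>t. inverse (a t)) = (\<lambda>t. flip (\<lambda>t. inverse (a_plus t)) t * inverse (a_plus t))"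
      by (simp add: assms flip_def mult.commute)
    thus ?thesis using Tz_mult_plus[OF flip_mem[OF iapS] iapp] by (simp add: Tiap Tiap')
  qed
  have Ma: "Mc a = exp B" unfolding a_exp B_def by (rule Mc_exp_even[OF b_even])
  have Mia: "Mc (\<lambda>t. inverse (a t)) = exp (- B)"
  proof -
    have "Mc (\<lambda>t. - b t) = - B" using Mc_scaleR[OF bS, of "-1"] by (simp add: B_def)
    thus ?thesis unfolding ia using Mc_exp_even[OF mb_even] by simp
  qed
  \<comment> \<open>The product rule for \<open>M\<close> wants an \<open>S_minus\<close> factor on
    the left: the inverse of \<open>a_plus\<close> is \<open>flip a_plus\<close> times the inverse
    of \<open>a\<close>, and the latter is the exponential of an even function.\<close>
  have Miap: "Mc (\<lambda>t. inverse (a_plus t)) = exp U * exp (- B)"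
  proof -
    have "(\<lambda>t. inverse (a_plus t)) = (\<lambda>t. flip a_plus t * inverse (a t))"
      by (simp add: assms flip_def field_simps fun_eq_iff)
    thus ?thesis using Mc_mult_minus[OF flip_plus[OF ap] iaS] by (simp add: Tap' Mia)
  qed

  define E where "E = exp (- U) * exp (- L) * exp B"
  define A where "A = exp (- L) * exp B * exp (- U)"
  define A' where "A' = exp U * exp (- B) * exp L"
  have blf_E: "toeplitz (\<lambda>t. inverse (a t)) o\<^sub>L M a = blf E"
    by (simp add: E_def times_clop.rep_eq Tz_S(1)[OF iaS, symmetric] blf_Mc[OF aS, symmetric] Tia Ma)
  have blf_K: "K = blf (A' - 1)"
    by (simp add: assms(6) A'_def times_clop.rep_eq minus_clop.rep_eq one_clop.rep_eq
      Tz_S(1)[OF apS, symmetric] blf_Mc[OF iapS, symmetric] Tap Miap)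
  have blf_D: "M b - toeplitz b = blf D"
  proof -
    have "D = Mc b - Tz b" by (simp add: D_def B_def Tb)
    thus ?thesis by (simp add: minus_clop.rep_eq blf_Mc[OF bS] Tz_S(1)[OF bS])
  qed
  have blf_H: "hankel b o\<^sub>L hankel b = blf (U * L - L * U)"
  proof -
    have "Hz b * Hz b = U * L - L * U"
      unfolding assms U_def L_def by (rule Hankel_square[OF bp])
    hence "blf (Hz b) o\<^sub>L blf (Hz b) = blf (U * L - L * U)" by (metis times_clop.rep_eq)
    thus ?thesis by (simp only: Hz_S(1)[OF bS])
  qed

  have tcD: "tc D" unfolding blf_D[symmetric] using tc_Mc_diff[OF bS]
    by (simp add: minus_clop.rep_eq blf_Mc[OF bS] Tz_S(1)[OF bS])
  have tcH: "tc (U * L - L * U)" unfolding U_def L_def by (rule tc_commutator[OF bp])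
  \<comment> \<open>\<open>Mc a - Tz a\<close> compares \<open>exp B\<close> with
    \<open>exp U * exp L\<close>. The order is reversed at the price of the commutator for
    \<open>a_plus\<close>, because \<open>exp L * exp U\<close> is what the outer factors in
    \<open>E\<close> and \<open>A'\<close> cancel.\<close>
  have tcexp: "tc (exp B - exp L * exp U)"
  proof -
    have "exp B - exp L * exp U = (Mc a - Tz a) + (Tz (flip a_plus) * Tz a_plus - Tz a_plus * Tz (flip a_plus))"
      by (simp add: Ma Ta Tap Tap')
    thus ?thesis by (simp only:) (intro tc_add tc_Mc_diff aS tc_commutator ap)
  qed
  have tcE: "tc (E - 1)"
  proof -
    have "exp (- U) * exp (- L) * (exp L * exp U) = exp (- U) * (exp (- L) * exp L) * exp U"
      by (simp only: mult.assoc)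
    hence "E - 1 = exp (- U) * exp (- L) * (exp B - exp L * exp U)"
      by (simp add: E_def right_diff_distrib exp_minus_mult)
    thus ?thesis by (simp only:) (intro tc_mult_left tcexp)
  qed
  have tcA': "tc (A' - 1)"
  proof -
    have "exp U * exp (- B) * (exp L * exp U) * exp (- U) = exp U * exp (- B) * exp L * (exp U * exp (- U))"
      by (simp only: mult.assoc)
    moreover have "exp U * exp (- B) * exp B * exp (- U) = exp U * (exp (- B) * exp B) * exp (- U)"
      by (simp only: mult.assoc)
    ultimately have "A' - 1 = - (exp U * exp (- B) * (exp B - exp L * exp U) * exp (- U))"
      by (simp add: A'_def right_diff_distrib left_diff_distrib exp_minus_mult)
    thus ?thesis by (simp only:) (intro tc_uminus tc_mult_right tc_mult_left tcexp)
  qed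

  obtain cD where nD: "nuclear D cD" by (rule tc_nuclear[OF tcD])
  obtain cH where nH: "nuclear (U * L - L * U) cH" by (rule tc_nuclear[OF tcH])
  obtain cE where nE: "nuclear (E - 1) cE" by (rule tc_nuclear[OF tcE])
  obtain cA' where nA': "nuclear (A' - 1) cA'" by (rule tc_nuclear[OF tcA'])
  \<comment> \<open>\<open>A\<close> and \<open>E\<close> are conjugate by \<open>exp U\<close>, so
    \<open>A - 1\<close> inherits nuclearity and determinant from \<open>E - 1\<close>.\<close>
  have AE: "A - 1 = exp U * (E - 1) * exp (- U)"
  proof -
    have "exp U * E * exp (- U) = (exp U * exp (- U)) * exp (- L) * exp B * exp (- U)"
      by (simp only: E_def mult.assoc)
    thus ?thesis by (simp add: A_def right_diff_distrib left_diff_distrib exp_minus_mult)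
  qed
  have nA: "nuclear (A - 1) (norm (exp (- U)) * (norm (exp U) * cE))"
    unfolding AE by (intro nuclear_mult_right nuclear_mult_left nE)
  have detA: "det1 (A - 1) = det1 (E - 1)"
    unfolding AE by (rule det1_conjugate[OF nE]) (rule exp_minus_mult)
  have AA': "A * A' = 1"
  proof -
    have "A * A' = exp (- L) * (exp B * ((exp (- U) * exp U) * exp (- B))) * exp L"
      by (simp only: A_def A'_def mult.assoc)
    thus ?thesis by (simp add: exp_minus_mult)
  qed

  have detE: "det1 (E - 1) = exp (trc D + 1 / 2 * trc (U * L - L * U))"
  proof -
    \<comment> \<open>\<open>det1_exp_triple\<close> subtracts half the trace of
      \<open>L * U - U * L\<close>, the negative of the Hankel square; hence the plus sign.\<close>
    have "L * U - U * L = (- 1) *\<^sub>R (U * L - L * U)" by simp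
    hence "trc (L * U - U * L) = - trc (U * L - L * U)" using trc_scaleR[OF nH, of "-1"] by simp
    moreover have "nuclear (L * U - U * L) cH" using nuclear_uminus[OF nH] by simp
    ultimately show ?thesis
      using det1_exp_triple[OF nD[unfolded D_def]] by (simp add: E_def D_def)
  qed

  have det_sec: "det_section N (M a) = G_exp b ^ N * det1 (E - 1) * det1 ((1 - clop_P N) * (A' - 1) * (1 - clop_P N))" for N
  proof -
    note low = exp_lower[OF Tz_lower[OF bp] Tz_diag[OF bp], folded L_def z_def]
    have "exp L * A * exp U = (exp L * exp (- L)) * exp B * (exp (- U) * exp U)"
      by (simp only: A_def mult.assoc)
    hence "M a = blf (exp L * A * exp U)" by (simp add: exp_minus_mult Ma[symmetric] blf_Mc[OF aS])
    hence "det_section N (M a) = ldet (ent (exp L * A * exp U)) {..<N}" by (simp add: det_section_eq_ldet)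
    also have "\<dots> = exp z ^ (2 * N) * ldet (ent A) {..<N}"
      by (rule ldet_section_triangular) (simp_all add: low U_transp exp_transp)
    \<comment> \<open>\<open>b\<close> has mean \<open>2 * z\<close>, since \<open>b_plus\<close>
      and its flip each contribute \<open>z\<close>; this matches the two triangular
      factors.\<close>
    also have "exp z ^ (2 * N) = G_exp b ^ N"
    proof -
      have "fourier b 0 = 2 * z"
        unfolding assms by (simp add: fourier_add_S bpS bmS fourier_flip z_def)
      thus ?thesis by (simp add: fourier_zero_eq power_mult exp_double)
    qed
    also have "ldet (ent A) {..<N} = det1 (E - 1) * det1 ((1 - clop_P N) * (A' - 1) * (1 - clop_P N))"
      unfolding detA[symmetric] by (rule Jacobi_section[OF AA' nA nA'])
    finally show ?thesis by (simp add: mult.assoc)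
  qed
  have blf_QKQ: "Q_proj N o\<^sub>L K o\<^sub>L Q_proj N = blf ((1 - clop_P N) * (A' - 1) * (1 - clop_P N))" for N
    by (simp only: times_clop.rep_eq blf_clop_Q blf_K)
  show ?thesis
  proof (intro conjI allI impI)
    show "a = (\<lambda>t. exp (b t))" by (rule a_exp)
    show "trace_class ((toeplitz (\<lambda>t. inverse (a t)) o\<^sub>L M a) - id_blinfun)"
      unfolding blf_E using tcE by (simp add: minus_clop.rep_eq one_clop.rep_eq)
    show "trace_class (M b - toeplitz b)" unfolding blf_D by (rule tcD)
    show "trace_class (hankel b o\<^sub>L hankel b)" unfolding blf_H by (rule tcH)
    show "trace_class K" unfolding blf_K by (rule tcA')
    show "trace_class (Q_proj N o\<^sub>L K o\<^sub>L Q_proj N)" for N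
      unfolding blf_QKQ by (intro tc_mult_right tc_mult_left tcA')
    show "det_section N (M a) = G_exp b ^ N * fredholm_det (toeplitz (\<lambda>t. inverse (a t)) o\<^sub>L M a)
        * fredholm_det (id_blinfun + (Q_proj N o\<^sub>L K o\<^sub>L Q_proj N))" for N
      unfolding blf_E blf_QKQ fredholm_det_blf fredholm_det_eq_fdet by (rule det_sec)
    show "fredholm_det (toeplitz (\<lambda>t. inverse (a t)) o\<^sub>L M a) =
        exp (op_trace (M b - toeplitz b) + 1 / 2 * op_trace (hankel b o\<^sub>L hankel b))"
      unfolding blf_E blf_D blf_H fredholm_det_blf by (rule detE)
  qed
qed

end
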